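(* Let $\omega$ be a non-Lipschitz Osgood modulus of continuity. Then the space $L^1_{\mathrm{per}}(\mathbb{R}_+; c_{\omega}(\mathbb{T}^2; \mathbb{R}^2))$, with the topology induced by its norm $\|\cdot\|_{L^1_{\mathrm{per}}c_\omega}$, contains a residual set $\mathcal{X}$ such that for all $b \in \mathcal{X}$ the topological entropy of the time-one flow map $X_1^b : \mathbb{T}^2 \to \mathbb{T}^2$ is infinite, i.e. $h_{\mathrm{top}}(X_1^b) = +\infty$.
   Context: $\mathbb{R}_+ = [0,\infty)$. $\mathbb{T}^2$ is the two-dimensional flat torus, identified when convenient with $[-1,1]^2$ with opposite sides identified, and $\mathsf{d}$ is its geodesic distance. A non-Lipschitz Osgood modulus of continuity is a function $\omega : [0,\infty) \to [0,\infty)$, continuous on $[0,\infty)$ and $C^1$ on $(0,\infty)$, increasing and concave, such that $\omega(0)=0$, $\int_0^1 \frac{1}{\omega(s)}\,ds = \infty$ and $\lim_{s\to 0^+} \frac{s}{\omega(s)} = 0$. For $f : \mathbb{T}^2 \to \mathbb{R}^2$ put $[f]_\omega = \sup_{x\neq y} \frac{|f(x)-f(y)|}{\omega(\mathsf{d}(x,y))}$ and $\|f\|_\omega = \|f\|_{C^0} + [f]_\omega$. Let $C_\omega(\mathbb{T}^2;\mathbb{R}^2) = \{f : \|f\|_\omega < \infty\}$ and let $c_\omega(\mathbb{T}^2;\mathbb{R}^2)$ be the closure of $C^\infty(\mathbb{T}^2;\mathbb{R}^2)$ with respect to $\|\cdot\|_\omega$. Equivalently, $f\in C_\omega$ belongs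 to $c_\omega$ if and only if $\lim_{r\to 0}\sup_{0<\mathsf{d}(x,y)<r}\frac{|f(x)-f(y)|}{\omega(\mathsf{d}(x,y))}=0$. $L^1_{\mathrm{per}}(\mathbb{R}_+; c_\omega(\mathbb{T}^2;\mathbb{R}^2))$ is the space of (strongly measurable in time, identified when equal for a.e. $t$) velocity fields $b$ with $b(t,\cdot)\in c_\omega(\mathbb{T}^2;\mathbb{R}^2)$, $b(t+1,\cdot)=b(t,\cdot)$ for all $t\in\mathbb{R}_+$, and $\|b\|_{L^1_{\mathrm{per}}c_\omega} := \int_0^1 \|b(t,\cdot)\|_\omega\,dt < \infty$. For such $b$, the flow map $X_t^b : \mathbb{T}^2\to\mathbb{T}^2$ is the unique solution of $\frac{d}{dt}X_t^b(x) = b(t,X_t^b(x))$, $X_0^b(x)=x$ (in the integral sense); it is well defined and continuous under the Osgood condition. A subset of a topological space is residual if it contains a countable intersection of open dense sets. Topological entropy: let $X$ be a compact metric space and $T: X\to X$ continuous. For an open cover $\alpha$ let $N(\alpha)$ be the cardinality of its smallest subcover; the join of open covers $\alpha_1,\dots,\alpha_n$ is $\bigvee_{i=1}^n\alpha_i = \{\bigcap_{i=1}^n A_i : A_i\in\alpha_i\}$; $T^{-i}\alpha = \{T^{-i}O : O\in\alpha\}$; $h_{\mathrm{top}}(T,\alpha) = \lim_{n\to\infty}\frac1n\log N(\bigvee_{i=0}^{n-1}T^{-i}\alpha)$; and $h_{\mathrm{top}}(T) = \sup_\alpha h_{\mathrm{top}}(T,\alpha)$, the supremum being over all finite open covers $\alpha$.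 *)

theory Defs
  imports "HOL-Analysis.Analysis"
begin

section \<open>The flat torus\<close>

definition torus_rel :: "real^2 \<Rightarrow> real^2 \<Rightarrow> bool" where
  "torus_rel x y \<longleftrightarrow> (\<forall>i. \<exists>k::int. x $ i - y $ i = 2 * of_int k)"

lemma equivp_torus_rel: "equivp torus_rel"
proof (rule equivpI)
  show "reflp torus_rel"
    by (rule reflpI) (auto simp: torus_rel_def intro: exI[of _ 0])
  show "symp torus_rel"
  proof (rule sympI)
    fix x y assume "torus_rel x y"
    then show "torus_rel y x"
      unfolding torus_rel_def by (metis minus_diff_eq mult_minus_right of_int_minus)
  qed
  show "transp torus_rel"
  proof (rule transpI)
    fix x y z assume 1: "torus_rel x y" and 2: "torus_rel y z"
    show "torus_rel x z"
      unfolding torus_rel_def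
    proof
      fix i
      obtain k l :: int where "x $ i - y $ i = 2 * of_int k" "y $ i - z $ i = 2 * of_int l"
        using 1 2 unfolding torus_rel_def by blast
      then have "x $ i - z $ i = 2 * of_int (k + l)" by simp
      then show "\<exists>k::int. x $ i - z $ i = 2 * of_int k" by blast
    qed
  qed
qed

quotient_type torus = "real^2" / torus_rel
  morphisms rep_torus torus_proj
  by (rule equivp_torus_rel)

lemma torus_proj_eq_iff: "torus_proj x = torus_proj y \<longleftrightarrow> torus_rel x y"
  by (rule torus.abs_eq_iff)

lemma torus_proj_surj: "\<exists>x. torus_proj x = p"
  using Quotient_abs_rep[OF Quotient_torus] by blast

lemma torus_rel_translate: "torus_rel x x' \<Longrightarrow> torus_rel y (y - x + x')"
proof -
  assume a: "torus_rel x x'"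
  show ?thesis unfolding torus_rel_def
  proof
    fix i
    obtain k :: int where "x $ i - x' $ i = 2 * of_int k"
      using a unfolding torus_rel_def by blast
    then have "y $ i - (y - x + x') $ i = 2 * of_int k" by simp
    then show "\<exists>k::int. y $ i - (y - x + x') $ i = 2 * of_int k" by blast
  qed
qed

lemma torus_rel_closed:
  assumes "\<And>e. e > 0 \<Longrightarrow> \<exists>z. torus_rel y z \<and> dist x z < e"
  shows "torus_rel x y"
  unfolding torus_rel_def
proof
  fix i
  define r where "r = (x $ i - y $ i) / 2"
  define e where "e = min (frac r) (1 - frac r)"
  have "\<exists>k::int. r = of_int k"
  proof (rule ccontr)
    assume n: "\<nexists>k::int. r = of_int k"
    then have "frac r \<noteq> 0" by (metis Ints_cases frac_eq_0_iff)
    then have "frac r > 0" using frac_ge_0[of r] by linarith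
    then have "e > 0" using frac_lt_1[of r] unfolding e_def by auto
    then obtain z where z: "torus_rel y z" "dist x z < e" using assms by blast
    obtain k :: int where k: "y $ i - z $ i = 2 * of_int k"
      using z(1) unfolding torus_rel_def by blast
    have "\<bar>x $ i - z $ i\<bar> < e"
      using z(2) dist_vec_nth_le[of x i z] by (simp add: dist_real_def)
    moreover have "x $ i - z $ i = 2 * (r + of_int k)" using k by (simp add: r_def field_simps)
    ultimately have b: "\<bar>r + of_int k\<bar> < e" by (simp add: abs_mult)
    define m where "m = \<lfloor>r\<rfloor> + k"
    have rm: "r + of_int k = frac r + of_int m" by (simp add: m_def frac_def)
    have f: "frac r \<ge> e" "frac r \<le> 1 - e" unfolding e_def by auto
    consider "m \<ge> 0" | "m \<le> -1" by linarith
    then show False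
    proof cases
      case 1
      then have "of_int m \<ge> (0::real)" by simp
      then show False using b rm f by linarith
    next
      case 2
      then have "of_int m \<le> (-1::real)" by linarith
      then show False using b rm f by linarith
    qed
  qed
  then obtain k :: int where "r = of_int k" by blast
  then show "\<exists>k::int. x $ i - y $ i = 2 * of_int k"
    by (intro exI[of _ k]) (simp add: r_def)
qed

text \<open>Geodesics of the flat torus are projections of line segments, so the geodesic distance of two
  points is the least Euclidean distance of their lifts.\<close>

instantiation torus :: metric_space
begin

definition dist_torus :: "torus \<Rightarrow> torus \<Rightarrow> real" where
  "dist_torus p q = Inf {dist x y | x y. torus_proj x = p \<and> torus_proj y = q}"

definition uniformity_torus :: "(torus \<times> torus) filter" where
  "uniformity_torus = (INF e\<in>{0<..}. principal {(p, q). dist p q < e})"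

definition open_torus :: "torus set \<Rightarrow> bool" where
  "open_torus U \<longleftrightarrow> (\<forall>x\<in>U. eventually (\<lambda>(x', y). x' = x \<longrightarrow> y \<in> U) uniformity)"

lemma dist_torus_le: "dist (torus_proj x) (torus_proj y) \<le> dist x y"
  unfolding dist_torus_def by (rule cInf_lower) (auto intro: bdd_belowI[of _ 0])

lemma dist_torus_approx:
  assumes "e > dist (torus_proj x) q"
  obtains y where "torus_proj y = q" "dist x y < e"
proof -
  have "Inf {dist x' y | x' y. torus_proj x' = torus_proj x \<and> torus_proj y = q} < e"
    using assms unfolding dist_torus_def by simp
  moreover have "{dist x' y | x' y. torus_proj x' = torus_proj x \<and> torus_proj y = q} \<noteq> {}"
    using torus_proj_surj[of q] by blast
  ultimately obtain x' y where *: "torus_proj x' = torus_proj x" "torus_proj y = q" "dist x' y < e"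
    using cInf_lessD by (smt (verit, best) mem_Collect_eq)
  have "torus_rel y (y - x' + x)"
    using *(1) by (intro torus_rel_translate) (simp add: torus_proj_eq_iff)
  then have "torus_proj (y - x' + x) = q" using *(2) torus_proj_eq_iff by metis
  moreover have "dist x (y - x' + x) = dist x' y" by (simp add: dist_norm norm_minus_commute)
  ultimately show ?thesis using that *(3) by metis
qed

instance
proof
  show "uniformity = (INF e\<in>{0<..}. principal {(p, q :: torus). dist p q < e})"
    by (rule uniformity_torus_def)
  show "open U \<longleftrightarrow> (\<forall>x\<in>U. eventually (\<lambda>(x', y). x' = x \<longrightarrow> y \<in> U) uniformity)" for U :: "torus set"
    by (rule open_torus_def)
  fix p q r :: torus
  obtain x where x: "torus_proj x = p" using torus_proj_surj by blast
  have nn: "dist a b \<ge> 0" for a b :: torus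
    unfolding dist_torus_def
    using torus_proj_surj[of a] torus_proj_surj[of b] by (intro cInf_greatest) auto
  show "dist p q = 0 \<longleftrightarrow> p = q"
  proof
    assume d: "dist p q = 0"
    obtain y where y: "torus_proj y = q" using torus_proj_surj by blast
    have "torus_rel x y"
    proof (rule torus_rel_closed)
      fix e :: real assume "e > 0"
      then have "e > dist (torus_proj x) q" using d x by simp
      then obtain z where "torus_proj z = q" "dist x z < e" by (rule dist_torus_approx)
      then show "\<exists>z. torus_rel y z \<and> dist x z < e" using y torus_proj_eq_iff by metis
    qed
    then show "p = q" using x y torus_proj_eq_iff by metis
  next
    assume "p = q"
    then have "dist p q \<le> 0" using dist_torus_le[of x x] x by simp
    then show "dist p q = 0" using nn[of p q] by linarith
  qed
  show "dist p q \<le> dist p r + dist q r"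
  proof (rule field_le_epsilon)
    fix e :: real assume e: "e > 0"
    obtain z where z: "torus_proj z = r" using torus_proj_surj by blast
    have sym: "dist a b = dist b a" for a b :: torus
      unfolding dist_torus_def by (subst dist_commute) (rule arg_cong[of _ _ Inf], blast)
    have "dist p r + e / 2 > dist (torus_proj z) p" "dist q r + e / 2 > dist (torus_proj z) q"
      using e z sym by auto
    then obtain x' y' where "torus_proj x' = p" "dist z x' < dist p r + e / 2"
      "torus_proj y' = q" "dist z y' < dist q r + e / 2" by (metis dist_torus_approx)
    moreover have "dist (torus_proj x') (torus_proj y') \<le> dist z x' + dist z y'"
      using dist_torus_le[of x' y'] dist_triangle2[of x' y' z] by (simp add: dist_commute)
    ultimately show "dist p q \<le> dist p r + dist q r + e" by simp
  qed
qed

end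

lemma continuous_on_torus_proj: "continuous_on S torus_proj"
  unfolding continuous_on_iff using dist_torus_le le_less_trans by blast

lemma compact_torus: "compact (UNIV :: torus set)"
proof -
  have "p \<in> torus_proj ` cbox (\<chi> i. -1) (\<chi> i. 1)" for p
  proof -
    obtain x where x: "torus_proj x = p" using torus_proj_surj by blast
    define y :: "real^2" where "y = (\<chi> i. x $ i - 2 * of_int \<lfloor>(x $ i + 1) / 2\<rfloor>)"
    have "-1 \<le> y $ i \<and> y $ i \<le> 1" for i
      using floor_correct[of "(x $ i + 1) / 2"] unfolding y_def by (simp add: field_simps)
    then have "y \<in> cbox (\<chi> i. -1) (\<chi> i. 1)" by (simp add: mem_box_cart)
    moreover have "torus_rel x y" unfolding torus_rel_def y_def by auto
    ultimately show ?thesis using x torus_proj_eq_iff by (metis imageI)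
  qed
  then have "(UNIV :: torus set) = torus_proj ` cbox (\<chi> i. -1) (\<chi> i. 1)" by blast
  then show ?thesis using compact_continuous_image[OF continuous_on_torus_proj compact_cbox] by metis
qed


section \<open>Moduli of continuity and the spaces of vector fields\<close>

text \<open>\<open>\<omega>\<close> is a total function on the reals, but only its values on \<open>[0,\<infinity>)\<close> matter. Positivity on
  \<open>(0,\<infinity>)\<close> is implicit in writing \<open>1/\<omega>\<close> and \<open>s/\<omega>(s)\<close>; it is stated because division by zero is
  zero in HOL. ``Increasing'' is read in the weak sense.\<close>

definition nonlipschitz_osgood :: "(real \<Rightarrow> real) \<Rightarrow> bool" where
  "nonlipschitz_osgood \<omega> \<longleftrightarrow>
     continuous_on {0..} \<omega> \<and>
     \<omega> C1_differentiable_on {0<..} \<and>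
     mono_on {0..} \<omega> \<and>
     concave_on {0..} \<omega> \<and>
     \<omega> 0 = 0 \<and>
     (\<forall>s>0. \<omega> s > 0) \<and>
     (\<integral>\<^sup>+ s. ennreal (1 / \<omega> s) \<partial>lebesgue_on {0<..1}) = \<infinity> \<and>
     ((\<lambda>s. s / \<omega> s) \<longlongrightarrow> 0) (at_right 0)"

definition C0_norm :: "(torus \<Rightarrow> real^2) \<Rightarrow> ennreal" where
  "C0_norm f = (SUP x. ennreal (norm (f x)))"

definition omega_seminorm :: "(real \<Rightarrow> real) \<Rightarrow> (torus \<Rightarrow> real^2) \<Rightarrow> ennreal" where
  "omega_seminorm \<omega> f =
     (SUP (x, y) \<in> {(x, y). x \<noteq> y}. ennreal (norm (f x - f y) / \<omega> (dist x y)))"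

definition omega_norm :: "(real \<Rightarrow> real) \<Rightarrow> (torus \<Rightarrow> real^2) \<Rightarrow> ennreal" where
  "omega_norm \<omega> f = C0_norm f + omega_seminorm \<omega> f"

definition C_omega :: "(real \<Rightarrow> real) \<Rightarrow> (torus \<Rightarrow> real^2) set" where
  "C_omega \<omega> = {f. omega_norm \<omega> f < \<infinity>}"

fun Ck :: "nat \<Rightarrow> ('a::real_normed_vector \<Rightarrow> 'b::real_normed_vector) \<Rightarrow> bool" where
  "Ck 0 f \<longleftrightarrow> continuous_on UNIV f"
| "Ck (Suc k) f \<longleftrightarrow>
     (\<forall>x. f differentiable (at x)) \<and> (\<forall>v. Ck k (\<lambda>x. frechet_derivative f (at x) v))"

definition smooth_torus :: "(torus \<Rightarrow> real^2) \<Rightarrow> bool" where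
  "smooth_torus f \<longleftrightarrow> (\<forall>k. Ck k (f \<circ> torus_proj))"

definition c_omega :: "(real \<Rightarrow> real) \<Rightarrow> (torus \<Rightarrow> real^2) set" where
  "c_omega \<omega> = {f \<in> C_omega \<omega>.
     \<forall>e>0. \<exists>g. smooth_torus g \<and> omega_norm \<omega> (\<lambda>x. f x - g x) < ennreal e}"


section \<open>Time-periodic velocity fields\<close>

text \<open>A velocity field is a function of all real times whose values at negative times are
  irrelevant.\<close>

type_synonym velocity = "real \<Rightarrow> torus \<Rightarrow> real^2"

text \<open>Bochner measurability with respect to \<open>omega_norm\<close>. The library's notion needs a Banach space
  type, whereas \<open>c_omega \<omega>\<close> is a set depending on \<open>\<omega>\<close>.\<close>

definition strongly_measurable :: "(real \<Rightarrow> real) \<Rightarrow> velocity \<Rightarrow> bool" where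
  "strongly_measurable \<omega> b \<longleftrightarrow>
     (\<exists>s :: nat \<Rightarrow> velocity.
        (\<forall>n. simple_function (lebesgue_on {0..}) (s n) \<and> (\<forall>t\<ge>0. s n t \<in> c_omega \<omega>)) \<and>
        (AE t in lebesgue_on {0..}.
           (\<lambda>n. omega_norm \<omega> (\<lambda>x. b t x - s n t x)) \<longlonglongrightarrow> 0))"

definition L1_norm :: "(real \<Rightarrow> real) \<Rightarrow> velocity \<Rightarrow> ennreal" where
  "L1_norm \<omega> b = (\<integral>\<^sup>+ t. omega_norm \<omega> (b t) \<partial>lebesgue_on {0..1})"

definition L1per_fields :: "(real \<Rightarrow> real) \<Rightarrow> velocity set" where
  "L1per_fields \<omega> = {b.
     strongly_measurable \<omega> b \<and>
     (\<forall>t\<ge>0. b t \<in> c_omega \<omega>) \<and>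
     (\<forall>t\<ge>0. b (t + 1) = b t) \<and>
     L1_norm \<omega> b < \<infinity>}"

definition ae_eq :: "(real \<Rightarrow> real) \<Rightarrow> (velocity \<times> velocity) set" where
  "ae_eq \<omega> = {(a, b). a \<in> L1per_fields \<omega> \<and> b \<in> L1per_fields \<omega> \<and>
     (AE t in lebesgue_on {0..}. a t = b t)}"

definition L1per :: "(real \<Rightarrow> real) \<Rightarrow> velocity set set" where
  "L1per \<omega> = L1per_fields \<omega> // ae_eq \<omega>"

text \<open>The distance \<open>\<parallel>A - B\<parallel>\<close> of two classes: the common value of \<open>L1_norm\<close> on the differences of
  their representatives.\<close>

definition L1per_dist :: "(real \<Rightarrow> real) \<Rightarrow> velocity set \<Rightarrow> velocity set \<Rightarrow> real" where
  "L1per_dist \<omega> A B =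
     enn2real (the_elem ((\<lambda>(a, b). L1_norm \<omega> (\<lambda>t x. a t x - b t x)) ` (A \<times> B)))"

text \<open>\<open>L1per_dist\<close> is a metric, so \<open>Metric_space.mtopology\<close> below is the norm topology.\<close>

lemma C0_norm_triangle: "C0_norm (\<lambda>x. f x - h x) \<le> C0_norm (\<lambda>x. f x - g x) + C0_norm (\<lambda>x. g x - h x)"
  unfolding C0_norm_def
proof (rule SUP_least)
  fix x
  have "norm (f x - h x) \<le> norm (f x - g x) + norm (g x - h x)"
    by (metis dist_norm dist_triangle)
  then have "ennreal (norm (f x - h x)) \<le> ennreal (norm (f x - g x)) + ennreal (norm (g x - h x))"
    by (simp flip: ennreal_plus)
  also have "\<dots> \<le> (SUP x. ennreal (norm (f x - g x))) + (SUP x. ennreal (norm (g x - h x)))"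
    by (intro add_mono SUP_upper) auto
  finally show "ennreal (norm (f x - h x)) \<le> \<dots>" .
qed

lemma omega_seminorm_triangle:
  "omega_seminorm \<omega> (\<lambda>x. f x - h x) \<le> omega_seminorm \<omega> (\<lambda>x. f x - g x) + omega_seminorm \<omega> (\<lambda>x. g x - h x)"
  unfolding omega_seminorm_def
proof (rule SUP_least, clarify)
  fix x y :: torus assume xy: "x \<noteq> y"
  let ?w = "\<omega> (dist x y)"
  let ?q = "\<lambda>f. ennreal (norm (f x - f y) / ?w)"
  have le: "?q (\<lambda>x. f x - h x) \<le> ?q (\<lambda>x. f x - g x) + ?q (\<lambda>x. g x - h x)"
  proof (cases "?w > 0")
    case True
    have "f x - h x - (f y - h y) = (f x - g x - (f y - g y)) + (g x - h x - (g y - h y))" by simp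
    then have "norm (f x - h x - (f y - h y)) \<le> norm (f x - g x - (f y - g y)) + norm (g x - h x - (g y - h y))"
      by (metis norm_triangle_ineq)
    then show ?thesis using True
      by (simp add: divide_right_mono flip: ennreal_plus add_divide_distrib)
  next
    case False
    then have "norm (f x - h x - (f y - h y)) / ?w \<le> 0" by (simp add: divide_nonneg_nonpos)
    then show ?thesis by (simp add: ennreal_neg)
  qed
  also have "\<dots> \<le> (SUP (x, y) \<in> {(x, y). x \<noteq> y}. ennreal (norm ((f x - g x) - (f y - g y)) / \<omega> (dist x y)))
    + (SUP (x, y) \<in> {(x, y). x \<noteq> y}. ennreal (norm ((g x - h x) - (g y - h y)) / \<omega> (dist x y)))"
    using xy by (intro add_mono SUP_upper2[where i="(x,y)"]) auto
  finally show "?q (\<lambda>x. f x - h x) \<le> \<dots>" .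
qed

lemma omega_norm_triangle:
  "omega_norm \<omega> (\<lambda>x. f x - h x) \<le> omega_norm \<omega> (\<lambda>x. f x - g x) + omega_norm \<omega> (\<lambda>x. g x - h x)"
  unfolding omega_norm_def
  using add_mono[OF C0_norm_triangle[of f h g] omega_seminorm_triangle[of \<omega> f h g]]
  by (simp add: ac_simps)

lemma omega_norm_minus_commute: "omega_norm \<omega> (\<lambda>x. f x - g x) = omega_norm \<omega> (\<lambda>x. g x - f x)"
proof -
  have "norm (f x - g x - (f y - g y)) = norm (g x - f x - (g y - f y))" for x y
    by (metis (no_types, opaque_lifting) minus_diff_eq norm_minus_commute diff_diff_eq2 diff_add_eq add_diff_eq)
  then show ?thesis
    unfolding omega_norm_def C0_norm_def omega_seminorm_def by (simp add: norm_minus_commute)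
qed

lemma omega_norm_eq_0: assumes "omega_norm \<omega> (\<lambda>x. f x - g x) = 0" shows "f = g"
proof
  fix x
  have "C0_norm (\<lambda>x. f x - g x) = 0" using assms unfolding omega_norm_def by simp
  then have "ennreal (norm (f x - g x)) \<le> 0"
    unfolding C0_norm_def using SUP_upper[of x UNIV "\<lambda>x. ennreal (norm (f x - g x))"] by simp
  then show "f x = g x" by simp
qed

lemma omega_norm_zero: "omega_norm \<omega> (\<lambda>x. 0) = 0"
proof -
  have "omega_seminorm \<omega> (\<lambda>x. 0) \<le> 0"
    unfolding omega_seminorm_def by (rule SUP_least) auto
  then show ?thesis by (simp add: omega_norm_def C0_norm_def)
qed

lemma Ck_zero: "Ck k (\<lambda>x. 0)"
proof (induction k)
  case (Suc k) 
  have "frechet_derivative (\<lambda>x::'a. 0::'b) (at x) = (\<lambda>v. 0)" for x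
    by simp
  then show ?case using Suc by simp
qed simp

lemma zero_in_c_omega: "(\<lambda>x. 0) \<in> c_omega \<omega>"
proof -
  have "smooth_torus (\<lambda>x. 0)" by (simp add: smooth_torus_def comp_def Ck_zero)
  moreover have "omega_norm \<omega> (\<lambda>x. 0 - 0) < ennreal e" if "e > 0" for e
    using that by (simp add: omega_norm_zero)
  ultimately show ?thesis
    unfolding c_omega_def C_omega_def using omega_norm_zero by fastforce
qed

lemma strongly_measurable_zero: "strongly_measurable \<omega> (\<lambda>t x. 0)"
  unfolding strongly_measurable_def
  by (rule exI[of _ "\<lambda>n t x. 0"]) (simp add: zero_in_c_omega omega_norm_zero)

lemma AE_unit_interval:
  assumes "AE t in lebesgue_on {0..}. P t" shows "AE t in lebesgue_on {0..1::real}. P t"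
proof -
  have "AE t in lebesgue. t \<in> {0..} \<longrightarrow> P t"
    using assms by (subst (asm) AE_restrict_space_iff) simp_all
  then have "AE t in lebesgue. t \<in> {0..1} \<longrightarrow> P t" by (rule eventually_mono) simp
  then show ?thesis by (subst AE_restrict_space_iff) simp_all
qed

lemma omega_norm_diff_measurable:
  assumes "strongly_measurable \<omega> a" "strongly_measurable \<omega> b"
  shows "\<exists>m. m \<in> borel_measurable (lebesgue_on {0..1}) \<and>
    (AE t in lebesgue_on {0..1}. omega_norm \<omega> (\<lambda>x. a t x - b t x) = m t)"
proof -
  let ?N = "\<lambda>f g. omega_norm \<omega> (\<lambda>x. f x - g x)"
  obtain s where s: "\<And>n. simple_function (lebesgue_on {0..}) (s n)"
    and s': "AE t in lebesgue_on {0..}. (\<lambda>n. ?N (a t) (s n t)) \<longlonglongrightarrow> 0"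
    using assms(1) unfolding strongly_measurable_def by blast
  obtain r where r: "\<And>n. simple_function (lebesgue_on {0..}) (r n)"
    and r': "AE t in lebesgue_on {0..}. (\<lambda>n. ?N (b t) (r n t)) \<longlonglongrightarrow> 0"
    using assms(2) unfolding strongly_measurable_def by blast
  define m where "m t = liminf (\<lambda>n. ?N (s n t) (r n t))" for t
  have sf: "(\<lambda>t. ?N (s n t) (r n t)) \<in> borel_measurable (lebesgue_on {0..})" for n
    by (rule borel_measurable_simple_function)
       (rule simple_function_compose2[OF s r, where h = ?N])
  have m: "m \<in> borel_measurable (lebesgue_on {0..})"
    unfolding m_def using sf by measurable
  have "AE t in lebesgue_on {0..}. ?N (a t) (b t) = m t"
    using s' r'
  proof eventually_elim
    case (elim t)
    let ?e = "\<lambda>n. ?N (a t) (s n t) + ?N (b t) (r n t)"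
    have e: "?e \<longlonglongrightarrow> 0" using tendsto_add[OF elim] by simp
    have 1: "?N (s n t) (r n t) \<le> ?N (a t) (b t) + ?e n" for n
    proof -
      have "?N (s n t) (r n t) \<le> ?N (s n t) (a t) + ?N (a t) (r n t)" by (rule omega_norm_triangle)
      also have "\<dots> \<le> ?N (s n t) (a t) + (?N (a t) (b t) + ?N (b t) (r n t))"
        by (intro add_left_mono omega_norm_triangle)
      also have "\<dots> = ?N (a t) (b t) + ?e n"
        by (simp add: omega_norm_minus_commute[of \<omega> "s n t" "a t"] ac_simps)
      finally show ?thesis .
    qed
    have 2: "?N (a t) (b t) \<le> ?N (s n t) (r n t) + ?e n" for n
    proof -
      have "?N (a t) (b t) \<le> ?N (a t) (s n t) + ?N (s n t) (b t)" by (rule omega_norm_triangle)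
      also have "\<dots> \<le> ?N (a t) (s n t) + (?N (s n t) (r n t) + ?N (r n t) (b t))"
        by (intro add_left_mono omega_norm_triangle)
      also have "\<dots> = ?N (s n t) (r n t) + ?e n"
        by (simp add: omega_norm_minus_commute[of \<omega> "r n t" "b t"] ac_simps)
      finally show ?thesis .
    qed
    have "(\<lambda>n. ?N (s n t) (r n t)) \<longlonglongrightarrow> ?N (a t) (b t)"
    proof (rule tendsto_sandwich)
      show "(\<lambda>n. ?N (a t) (b t) - ?e n) \<longlonglongrightarrow> ?N (a t) (b t)"
        using tendsto_diff_ennreal[OF tendsto_const e, of "?N (a t) (b t)"]
        by (cases "?N (a t) (b t) = top") simp_all
      show "(\<lambda>n. ?N (a t) (b t) + ?e n) \<longlonglongrightarrow> ?N (a t) (b t)"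
        using tendsto_add[OF tendsto_const e, of "?N (a t) (b t)"] by simp
      show "\<forall>\<^sub>F n in sequentially. ?N (a t) (b t) - ?e n \<le> ?N (s n t) (r n t)"
        using order_tendstoD(2)[OF e, of 1]
      proof (rule eventually_mono)
        fix n assume "?e n < 1"
        then have "?e n \<noteq> top" by (metis ennreal_one_less_top not_less_iff_gr_or_eq order.strict_trans)
        then show "?N (a t) (b t) - ?e n \<le> ?N (s n t) (r n t)"
          using 2[of n] by (subst ennreal_minus_le_iff) (simp add: add.commute)
      qed simp
      show "\<forall>\<^sub>F n in sequentially. ?N (s n t) (r n t) \<le> ?N (a t) (b t) + ?e n"
        using 1 by simp
    qed
    then show ?case unfolding m_def by (simp add: lim_imp_Liminf)
  qed
  then have "AE t in lebesgue_on {0..1}. ?N (a t) (b t) = m t" by (rule AE_unit_interval)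
  moreover have "m \<in> borel_measurable (lebesgue_on {0..1})"
    by (rule measurable_restrict_mono[OF m]) simp
  ultimately show ?thesis by blast
qed

lemma L1_norm_triangle:
  assumes "strongly_measurable \<omega> a" "strongly_measurable \<omega> b" "strongly_measurable \<omega> c"
  shows "L1_norm \<omega> (\<lambda>t x. a t x - c t x) \<le> L1_norm \<omega> (\<lambda>t x. a t x - b t x) + L1_norm \<omega> (\<lambda>t x. b t x - c t x)"
proof -
  let ?L = "lebesgue_on {0..1::real}"
  obtain m where m: "m \<in> borel_measurable ?L" "AE t in ?L. omega_norm \<omega> (\<lambda>x. a t x - b t x) = m t"
    using omega_norm_diff_measurable[OF assms(1,2)] by blast
  obtain k where k: "k \<in> borel_measurable ?L" "AE t in ?L. omega_norm \<omega> (\<lambda>x. b t x - c t x) = k t"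
    using omega_norm_diff_measurable[OF assms(2,3)] by blast
  have "L1_norm \<omega> (\<lambda>t x. a t x - c t x) \<le> (\<integral>\<^sup>+t. m t + k t \<partial>?L)"
    unfolding L1_norm_def
  proof (rule nn_integral_mono_AE)
    show "AE t in ?L. omega_norm \<omega> (\<lambda>x. a t x - c t x) \<le> m t + k t"
      using m(2) k(2)
    proof eventually_elim
      case (elim t)
      show ?case using omega_norm_triangle[of \<omega> "a t" "c t" "b t"] unfolding elim .
    qed
  qed
  also have "\<dots> = (\<integral>\<^sup>+t. m t \<partial>?L) + (\<integral>\<^sup>+t. k t \<partial>?L)"
    by (rule nn_integral_add[OF m(1) k(1)])
  also have "(\<integral>\<^sup>+t. m t \<partial>?L) = L1_norm \<omega> (\<lambda>t x. a t x - b t x)"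
    unfolding L1_norm_def by (rule nn_integral_cong_AE[symmetric, OF m(2)])
  also have "(\<integral>\<^sup>+t. k t \<partial>?L) = L1_norm \<omega> (\<lambda>t x. b t x - c t x)"
    unfolding L1_norm_def by (rule nn_integral_cong_AE[symmetric, OF k(2)])
  finally show ?thesis .
qed

lemma L1_norm_minus_commute: "L1_norm \<omega> (\<lambda>t x. a t x - b t x) = L1_norm \<omega> (\<lambda>t x. b t x - a t x)"
  unfolding L1_norm_def by (subst omega_norm_minus_commute) (rule refl)

lemma L1_norm_diff_finite:
  assumes "a \<in> L1per_fields \<omega>" "b \<in> L1per_fields \<omega>"
  shows "L1_norm \<omega> (\<lambda>t x. a t x - b t x) < \<infinity>"
proof -
  have "L1_norm \<omega> (\<lambda>t x. a t x - b t x) \<le> L1_norm \<omega> (\<lambda>t x. a t x - 0) + L1_norm \<omega> (\<lambda>t x. 0 - b t x)"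
    using assms by (intro L1_norm_triangle[where b = "\<lambda>t x. 0"] strongly_measurable_zero)
      (simp_all add: L1per_fields_def)
  also have "L1_norm \<omega> (\<lambda>t x. 0 - b t x) = L1_norm \<omega> (\<lambda>t x. b t x - 0)"
    by (rule L1_norm_minus_commute[where a = "\<lambda>t x. 0"])
  also have "L1_norm \<omega> (\<lambda>t x. a t x - 0) + L1_norm \<omega> (\<lambda>t x. b t x - 0) < \<infinity>"
    using assms by (simp add: L1per_fields_def)
  finally show ?thesis .
qed

lemma equiv_ae_eq: "equiv (L1per_fields \<omega>) (ae_eq \<omega>)"
proof (rule equivI)
  show "trans (ae_eq \<omega>)"
  proof (rule transI)
    fix a b c assume "(a, b) \<in> ae_eq \<omega>" "(b, c) \<in> ae_eq \<omega>"
    moreover from this have "AE t in lebesgue_on {0..}. a t = b t" "AE t in lebesgue_on {0..}. b t = c t"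
      by (auto simp: ae_eq_def)
    then have "AE t in lebesgue_on {0..}. a t = c t" by eventually_elim simp
    ultimately show "(a, c) \<in> ae_eq \<omega>" by (simp add: ae_eq_def)
  qed
  show "sym (ae_eq \<omega>)" by (rule symI) (simp add: ae_eq_def eq_commute)
qed (auto simp: refl_on_def ae_eq_def)

lemma L1per_dist_eq:
  assumes A: "A \<in> L1per \<omega>" "B \<in> L1per \<omega>" and a: "a \<in> A" "b \<in> B"
  shows "L1per_dist \<omega> A B = enn2real (L1_norm \<omega> (\<lambda>t x. a t x - b t x))"
proof -
  have "L1_norm \<omega> (\<lambda>t x. a' t x - b' t x) = L1_norm \<omega> (\<lambda>t x. a t x - b t x)"
    if "a' \<in> A" "b' \<in> B" for a' b'
  proof -
    have "(a, a') \<in> ae_eq \<omega>" "(b, b') \<in> ae_eq \<omega>"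
      using A a that unfolding L1per_def by (meson quotient_eq_iff[OF equiv_ae_eq] )+
    then have "AE t in lebesgue_on {0..}. a t = a' t \<and> b t = b' t" by (auto simp: ae_eq_def)
    then have "AE t in lebesgue_on {0..1}. a t = a' t \<and> b t = b' t" by (rule AE_unit_interval)
    then show ?thesis unfolding L1_norm_def
      by (intro nn_integral_cong_AE) (erule eventually_mono, simp)
  qed
  then have "(\<lambda>(a, b). L1_norm \<omega> (\<lambda>t x. a t x - b t x)) ` (A \<times> B)
      = (\<lambda>_. L1_norm \<omega> (\<lambda>t x. a t x - b t x)) ` (A \<times> B)"
    by (intro image_cong) auto
  also have "\<dots> = {L1_norm \<omega> (\<lambda>t x. a t x - b t x)}"
    using a by (subst image_constant[of "(a, b)"]) auto
  finally show ?thesis unfolding L1per_dist_def by simp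
qed

lemma periodic_nat:
  fixes b :: velocity
  assumes "\<forall>t\<ge>0. b (t + 1) = b t" "t \<ge> 0" shows "b (t + real n) = b t"
proof (induction n)
  case (Suc n)
  have "b (t + real n + 1) = b (t + real n)" using assms by simp
  then show ?case using Suc by (simp add: algebra_simps)
qed simp

lemma L1_norm_zero_imp:
  assumes a: "a \<in> L1per_fields \<omega>" and b: "b \<in> L1per_fields \<omega>"
    and z: "L1_norm \<omega> (\<lambda>t x. a t x - b t x) = 0"
  shows "AE t in lebesgue_on {0..}. a t = b t"
proof -
  let ?L = "lebesgue_on {0..1::real}"
  obtain m where m: "m \<in> borel_measurable ?L" "AE t in ?L. omega_norm \<omega> (\<lambda>x. a t x - b t x) = m t"
    using omega_norm_diff_measurable[of \<omega> a b] a b unfolding L1per_fields_def by blast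
  have "(\<integral>\<^sup>+t. m t \<partial>?L) = 0"
    using z unfolding L1_norm_def using nn_integral_cong_AE[OF m(2)] by simp
  then have "AE t in ?L. m t = 0" using nn_integral_0_iff_AE[OF m(1)] by simp
  with m(2) have "AE t in ?L. a t = b t"
  proof eventually_elim
    case (elim t)
    then show ?case using omega_norm_eq_0[of \<omega> "a t" "b t"] by simp
  qed
  then have "AE t in lebesgue. t \<in> {0..1} \<longrightarrow> a t = b t"
    by (subst (asm) AE_restrict_space_iff) simp_all
  then obtain N where N: "negligible N" "\<And>t. t \<in> {0..1} \<Longrightarrow> t \<notin> N \<Longrightarrow> a t = b t"
  proof (rule AE_E3)
    fix N assume "\<And>t. t \<in> space lebesgue - N \<Longrightarrow> t \<in> {0..1} \<longrightarrow> a t = b t" "N \<in> null_sets lebesgue"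
    then show ?thesis by (intro that[of N]) (simp_all add: negligible_iff_null_sets)
  qed
  have "negligible (\<Union>n::nat. (+) (real n) ` N)"
    by (intro negligible_Union_nat negligible_translation N(1))
  moreover have "{t. \<not> (t \<in> {0..} \<longrightarrow> a t = b t)} \<subseteq> (\<Union>n::nat. (+) (real n) ` N)"
  proof clarsimp
    fix t :: real assume t: "t \<ge> 0" "a t \<noteq> b t"
    define n where "n = nat \<lfloor>t\<rfloor>"
    have n: "t - real n \<in> {0..1}" using t by (simp add: n_def) linarith
    have "a (t - real n + real n) = a (t - real n)" "b (t - real n + real n) = b (t - real n)"
      using a b n periodic_nat[of a "t - real n" n] periodic_nat[of b "t - real n" n]
      unfolding L1per_fields_def atLeastAtMost_iff by blast+
    then have "t - real n \<in> N" using N(2)[OF n] t by fastforce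
    then show "\<exists>n. t \<in> (+) (real n) ` N" by (intro exI[of _ n] image_eqI[of _ _ "t - real n"]) simp_all
  qed
  ultimately have "AE t in lebesgue. t \<in> {0..} \<longrightarrow> a t = b t"
    by (intro AE_I'[of "\<Union>n::nat. (+) (real n) ` N"]) (simp_all add: negligible_iff_null_sets)
  then show ?thesis by (subst AE_restrict_space_iff) simp_all
qed

lemma Metric_space_L1per: "Metric_space (L1per \<omega>) (L1per_dist \<omega>)"
proof
  have ex: "\<exists>a. a \<in> A \<and> a \<in> L1per_fields \<omega>" if "A \<in> L1per \<omega>" for A
    using that unfolding L1per_def
    by (elim quotientE) (use equiv_class_self[OF equiv_ae_eq] in blast)
  have sym: "L1per_dist \<omega> A B = L1per_dist \<omega> B A" for A B
  proof -
    let ?d = "\<lambda>(a, b). L1_norm \<omega> (\<lambda>t x. a t x - b t x)"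
    have "?d ` (A \<times> B) = (?d \<circ> prod.swap) ` (A \<times> B)"
      by (intro image_cong refl) (clarsimp, rule L1_norm_minus_commute)
    also have "\<dots> = ?d ` (B \<times> A)"
      unfolding image_comp[symmetric] product_swap ..
    finally have "?d ` (A \<times> B) = ?d ` (B \<times> A)" .
    then show ?thesis unfolding L1per_dist_def by simp
  qed
  show "L1per_dist \<omega> A B = L1per_dist \<omega> B A" for A B by (rule sym)
  show "0 \<le> L1per_dist \<omega> A B" for A B
    by (simp add: L1per_dist_def)
  show "(L1per_dist \<omega> A B = 0) = (A = B)" if AB: "A \<in> L1per \<omega>" "B \<in> L1per \<omega>" for A B
  proof -
    obtain a b where ab: "a \<in> A" "a \<in> L1per_fields \<omega>" "b \<in> B" "b \<in> L1per_fields \<omega>"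
      using ex AB by metis
    have "L1per_dist \<omega> A B = 0 \<longleftrightarrow> L1_norm \<omega> (\<lambda>t x. a t x - b t x) = 0"
      using L1_norm_diff_finite[OF ab(2,4)] by (auto simp: L1per_dist_eq[OF AB ab(1,3)] enn2real_eq_0_iff)
    also have "\<dots> \<longleftrightarrow> (a, b) \<in> ae_eq \<omega>"
    proof
      assume "(a, b) \<in> ae_eq \<omega>"
      then have "AE t in lebesgue_on {0..1}. a t = b t"
        by (intro AE_unit_interval) (simp add: ae_eq_def)
      then have "L1_norm \<omega> (\<lambda>t x. a t x - b t x) = (\<integral>\<^sup>+t. 0 \<partial>lebesgue_on {0..1::real})"
        unfolding L1_norm_def
        by (intro nn_integral_cong_AE) (erule eventually_mono, simp add: omega_norm_zero)
      then show "L1_norm \<omega> (\<lambda>t x. a t x - b t x) = 0" by simp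
    qed (use L1_norm_zero_imp[OF ab(2,4)] ab in \<open>simp add: ae_eq_def\<close>)
    also have "\<dots> \<longleftrightarrow> A = B"
      using quotient_eq_iff[OF equiv_ae_eq _ _ ab(1,3)] AB unfolding L1per_def by simp
    finally show ?thesis .
  qed
  show "L1per_dist \<omega> A C \<le> L1per_dist \<omega> A B + L1per_dist \<omega> B C"
    if ABC: "A \<in> L1per \<omega>" "B \<in> L1per \<omega>" "C \<in> L1per \<omega>" for A B C
  proof -
    obtain a b c where abc: "a \<in> A" "a \<in> L1per_fields \<omega>" "b \<in> B" "b \<in> L1per_fields \<omega>"
      "c \<in> C" "c \<in> L1per_fields \<omega>"
      using ex ABC by metis
    have "L1_norm \<omega> (\<lambda>t x. a t x - c t x) \<le> L1_norm \<omega> (\<lambda>t x. a t x - b t x) + L1_norm \<omega> (\<lambda>t x. b t x - c t x)"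
      using abc by (intro L1_norm_triangle) (simp_all add: L1per_fields_def)
    moreover have "L1_norm \<omega> (\<lambda>t x. a t x - b t x) < top" "L1_norm \<omega> (\<lambda>t x. b t x - c t x) < top"
      using L1_norm_diff_finite[OF abc(2,4)] L1_norm_diff_finite[OF abc(4,6)] by simp_all
    ultimately show ?thesis
      using ABC abc by (simp add: L1per_dist_eq enn2real_mono flip: enn2real_plus)
  qed
qed

definition L1per_topology :: "(real \<Rightarrow> real) \<Rightarrow> velocity set topology" where
  "L1per_topology \<omega> = Metric_space.mtopology (L1per \<omega>) (L1per_dist \<omega>)"

definition residual_in :: "'a topology \<Rightarrow> 'a set \<Rightarrow> bool" where
  "residual_in T S \<longleftrightarrow> S \<subseteq> topspace T \<and>
     (\<exists>U :: nat \<Rightarrow> 'a set.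
        (\<forall>n. openin T (U n) \<and> T closure_of (U n) = topspace T) \<and> (\<Inter>n. U n) \<subseteq> S)"


section \<open>The flow\<close>

text \<open>Integral form of \<open>\<gamma>' = b(t,\<gamma>)\<close>, \<open>\<gamma>(0) = x\<close>; displacements are vectors, so the equation is
  written for lifts \<open>z\<close> of the initial point.\<close>

definition integral_curve :: "velocity \<Rightarrow> torus \<Rightarrow> (real \<Rightarrow> torus) \<Rightarrow> bool" where
  "integral_curve b x \<gamma> \<longleftrightarrow>
     (\<forall>t\<ge>0. (\<lambda>s. b s (\<gamma> s)) absolutely_integrable_on {0..t} \<and>
        (\<forall>z. torus_proj z = x \<longrightarrow> \<gamma> t = torus_proj (z + integral {0..t} (\<lambda>s. b s (\<gamma> s)))))"

text \<open>Integral curves are unique only on \<open>[0,\<infinity>)\<close>, hence the description of the point reached at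
  time \<open>t \<ge> 0\<close> rather than of the curve.\<close>

definition flow :: "velocity \<Rightarrow> real \<Rightarrow> torus \<Rightarrow> torus" where
  "flow b t x = (THE y. \<exists>\<gamma>. integral_curve b x \<gamma> \<and> \<gamma> t = y)"


section \<open>Topological entropy\<close>

text \<open>Here the compact metric space is a type; compactness of \<open>UNIV\<close> and continuity of the map are left
  to the use of the definitions (see \<open>compact_torus\<close>).\<close>

definition open_cover :: "'a::metric_space set set \<Rightarrow> bool" where
  "open_cover \<alpha> \<longleftrightarrow> (\<forall>A\<in>\<alpha>. open A) \<and> \<Union>\<alpha> = UNIV"

definition cover_number :: "'a set set \<Rightarrow> nat" where
  "cover_number \<alpha> = (LEAST n. \<exists>\<beta>\<subseteq>\<alpha>. finite \<beta> \<and> \<Union>\<beta> = UNIV \<and> card \<beta> = n)"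

definition cover_join :: "nat \<Rightarrow> (nat \<Rightarrow> 'a set set) \<Rightarrow> 'a set set" where
  "cover_join n \<alpha> = {(\<Inter>i<n. A i) | A. \<forall>i<n. A i \<in> \<alpha> i}"

definition entropy_cover :: "('a \<Rightarrow> 'a) \<Rightarrow> 'a set set \<Rightarrow> real" where
  "entropy_cover T \<alpha> =
     lim (\<lambda>n. ln (real (cover_number (cover_join n (\<lambda>i. (\<lambda>A. (T ^^ i) -` A) ` \<alpha>)))) / real n)"

definition htop :: "('a::metric_space \<Rightarrow> 'a) \<Rightarrow> ereal" where
  "htop T = (SUP \<alpha> \<in> {\<alpha>. finite \<alpha> \<and> open_cover \<alpha>}. ereal (entropy_cover T \<alpha>))"

end

(*
  The fields need not be divergence free, and only s / omega(s) -> 0 matters: it makes the sine shear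
  of wavelength 2d and amplitude M d small in the norm of c_omega, for every fixed M, once d is small.

  Density.  Approximate b by a field c0 that is simple in time and smooth in space, and replace it on
  a short time interval [0,tau] by a horizontal and then a vertical sine shear of wavelength 2d.  The
  time-one map, lifted to the plane, is X o V o H with X bi-Lipschitz and onto, with a constant K
  that does not depend on d.  If a path climbs by 2d, then H makes it wide, so it crosses N well
  separated boxes of size about K^2 d; V makes each crossing so dense in its box that its image under
  X climbs by 2d again.  No assumption on the direction in which X maps the path is needed.
  Iteration gives N^n separated orbits of length n, and this survives perturbations of the map of
  uniform size d, hence on a small ball around the modified field (Gronwall).

  Genericity.  A field b in the balls of all N is a limit of Lipschitz fields so fast that its
  integral curves are limits of theirs; this yields existence, uniqueness and continuity of the flow
  of b without the Osgood condition, and its time-one map has entropy at least ln N for all N.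
*)
theory Submission
  imports Defs
begin

section \<open>Entropy of a map that stretches a family of sets\<close>

text \<open>The obstacle is a circle of constants: the amplitude of the shears has to beat the
  distortion K of what follows, so K must not see the shears. Hence they occupy an initial interval
  of their own; between tau and 1 the field is c0, whose Lipschitz constant L is fixed first, and K
  = exp L. All heights, widths, gaps and amplitudes are then multiples of d by factors depending on
  K and N only, and d is made small last. A shear of amplitude a run for time tau/2 at speed 2a/tau
  costs in L1 a multiple of a (1 + pi/omega(d)) that does not depend on tau; with a proportional to
  d this tends to zero. The Lipschitz constant of the complete field comes after these choices and
  only decides the radius of the ball.

  A climb of 2d is the unit of the argument because it covers a full wavelength, along which the
  sine attains both 1 and -1. Paths are used, rather than curves with controlled slope, because
  intermediate values survive a uniform perturbation of the map and slopes do not. Surjectivity of X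
  allows targets to be chosen in its image and pulled back.\<close>

lemma subadditive_convergent:
  fixes a :: "nat \<Rightarrow> real"
  assumes nonneg: "\<And>n. a n \<ge> 0" and sub: "\<And>m n. a (m + n) \<le> a m + a n"
  shows "convergent (\<lambda>n. a n / real n)"
proof -
  define l where "l = (INF n\<in>{1..}. a n / real n)"
  have bdd: "bdd_below ((\<lambda>n. a n / real n) ` {1..})"
    by (rule bdd_belowI[of _ 0]) (auto simp: nonneg)
  have mult: "a (q * p) \<le> real q * a p" if "q \<ge> 1" for p q
    using that
  proof (induction q rule: dec_induct)
    case (step q)
    have "a (Suc q * p) \<le> a (q * p) + a p" using sub[of "q * p" p] by (simp add: add.commute)
    then show ?case using step.IH by (simp add: algebra_simps)
  qed simp
  have "(\<lambda>n. a n / real n) \<longlonglongrightarrow> l"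
  proof (rule LIMSEQ_I)
    fix e :: real assume e: "e > 0"
    have "(INF n\<in>{1..}. a n / real n) < l + e / 2" using e by (simp add: l_def)
    then obtain p where p: "p \<ge> 1" "a p / real p < l + e / 2"
      by (subst (asm) cINF_less_iff[OF _ bdd]) auto
    define C where "C = (\<Sum>r<p. a r)"
    have C: "a r \<le> C" if "r < p" for r
      unfolding C_def using that by (intro member_le_sum) (auto simp: nonneg)
    obtain n0 where n0: "real n0 > 2 * C / e" using reals_Archimedean2 by blast
    have "\<bar>a n / real n - l\<bar> < e" if n: "n \<ge> max (max n0 p) 1" for n
    proof -
      have lb: "l \<le> a n / real n" unfolding l_def using n by (intro cINF_lower[OF bdd]) auto
      have q: "n div p \<ge> 1" using n p by (simp add: div_greater_zero_iff Suc_leI)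
      \<comment> \<open>Division with remainder: each block of length p costs \<open>a p\<close>,
        and the remainder costs at most the constant C, which disappears after division by
        n.\<close>
      have "a n \<le> a (n div p * p) + a (n mod p)"
        using sub[of "n div p * p" "n mod p"] by simp
      also have "\<dots> \<le> real (n div p) * a p + C"
        using mult[OF q, of p] C[of "n mod p"] p by simp
      also have "real (n div p) * a p \<le> real n / real p * a p"
        by (intro mult_right_mono nonneg of_nat_div_le_of_nat)
      finally have "a n \<le> real n * (a p / real p) + C" by (simp add: mult.commute)
      then have "a n / real n \<le> a p / real p + C / real n"
        using n by (simp add: field_simps)
      moreover have "C / real n < e / 2"
      proof -
        have "2 * C / e < real n" using n0 n by (meson less_le_trans max.bounded_iff of_nat_mono)
        then show ?thesis using e n by (simp add: field_simps)
      qed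
      ultimately show ?thesis using lb p by linarith
    qed
    then show "\<exists>no. \<forall>n\<ge>no. norm (a n / real n - l) < e"
      by (intro exI[of _ "max (max n0 p) 1"]) auto
  qed
  then show ?thesis by (auto simp: convergent_def)
qed

section \<open>Cover numbers of iterated joins\<close>

lemma cover_join_finite:
  assumes "\<And>i. i < n \<Longrightarrow> finite (\<alpha> i)"
  shows "finite (cover_join n \<alpha>)"
proof -
  have "cover_join n \<alpha> \<subseteq> (\<lambda>A. \<Inter>i<n. A i) ` (Pi\<^sub>E {..<n} \<alpha>)"
  proof
    fix B assume "B \<in> cover_join n \<alpha>"
    then obtain A where A: "B = (\<Inter>i<n. A i)" "\<forall>i<n. A i \<in> \<alpha> i" by (auto simp: cover_join_def)
    then have "B = (\<Inter>i<n. restrict A {..<n} i)" "restrict A {..<n} \<in> Pi\<^sub>E {..<n} \<alpha>" by auto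
    then show "B \<in> (\<lambda>A. \<Inter>i<n. A i) ` (Pi\<^sub>E {..<n} \<alpha>)" by blast
  qed
  then show ?thesis by (rule finite_subset) (intro finite_imageI finite_PiE, simp_all add: assms)
qed

lemma cover_join_covers:
  assumes "\<And>i. i < n \<Longrightarrow> \<Union>(\<alpha> i) = UNIV"
  shows "\<Union>(cover_join n \<alpha>) = UNIV"
proof -
  have "x \<in> \<Union>(cover_join n \<alpha>)" for x
  proof -
    have "\<forall>i. \<exists>A. i < n \<longrightarrow> A \<in> \<alpha> i \<and> x \<in> A"
      using assms by (metis UNIV_I UnionE)
    then obtain A where "\<forall>i. i < n \<longrightarrow> A i \<in> \<alpha> i \<and> x \<in> A i" by metis
    then show ?thesis unfolding cover_join_def by (intro UnionI[of "\<Inter>i<n. A i"]) auto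
  qed
  then show ?thesis by auto
qed

lemma cover_number_attained:
  assumes "finite \<alpha>" "\<Union>\<alpha> = UNIV"
  shows "\<exists>\<beta>\<subseteq>\<alpha>. finite \<beta> \<and> \<Union>\<beta> = UNIV \<and> card \<beta> = cover_number \<alpha>"
proof -
  have "\<exists>n. \<exists>\<beta>\<subseteq>\<alpha>. finite \<beta> \<and> \<Union>\<beta> = UNIV \<and> card \<beta> = n" using assms by blast
  then show ?thesis
    unfolding cover_number_def by (rule LeastI_ex)
qed

lemma cover_number_le: "\<beta> \<subseteq> \<alpha> \<Longrightarrow> finite \<beta> \<Longrightarrow> \<Union>\<beta> = UNIV \<Longrightarrow> cover_number \<alpha> \<le> card \<beta>"
  unfolding cover_number_def by (rule Least_le) blast

abbreviation iterated_join :: "('a \<Rightarrow> 'a) \<Rightarrow> 'a set set \<Rightarrow> nat \<Rightarrow> 'a set set" where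
  "iterated_join T \<alpha> n \<equiv> cover_join n (\<lambda>i. (\<lambda>A. (T ^^ i) -` A) ` \<alpha>)"

lemma iterated_join_cover:
  assumes "finite \<alpha>" "\<Union>\<alpha> = UNIV"
  shows "finite (iterated_join T \<alpha> n)" "\<Union>(iterated_join T \<alpha> n) = UNIV"
proof -
  show "finite (iterated_join T \<alpha> n)" by (rule cover_join_finite) (simp add: assms)
  show "\<Union>(iterated_join T \<alpha> n) = UNIV"
  proof (rule cover_join_covers)
    fix i
    have "\<Union>((\<lambda>A. (T ^^ i) -` A) ` \<alpha>) = (T ^^ i) -` \<Union>\<alpha>" by blast
    then show "\<Union>((\<lambda>A. (T ^^ i) -` A) ` \<alpha>) = UNIV" using assms by simp
  qed
qed

lemma cover_number_pos:
  assumes "finite \<alpha>" "\<Union>\<alpha> = (UNIV :: 'a set)"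
  shows "cover_number \<alpha> \<ge> 1"
proof -
  obtain \<beta> where b: "finite \<beta>" "\<Union>\<beta> = (UNIV :: 'a set)" "card \<beta> = cover_number \<alpha>"
    using cover_number_attained[OF assms] by (elim exE conjE)
  from b(2) have "\<beta> \<noteq> {}" by (metis Union_empty UNIV_not_empty)
  then show ?thesis using b by (metis One_nat_def Suc_leI card_gt_0_iff)
qed

lemma iterated_join_add:
  assumes "A \<in> iterated_join T \<alpha> m" "B \<in> iterated_join T \<alpha> n"
  shows "A \<inter> (T ^^ m) -` B \<in> iterated_join T \<alpha> (m + n)"
proof -
  obtain A' where A': "A = (\<Inter>i<m. A' i)" "\<forall>i<m. A' i \<in> (\<lambda>A. (T ^^ i) -` A) ` \<alpha>"
    using assms(1) unfolding cover_join_def by blast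
  obtain B' where B': "B = (\<Inter>i<n. B' i)" "\<forall>i<n. B' i \<in> (\<lambda>A. (T ^^ i) -` A) ` \<alpha>"
    using assms(2) unfolding cover_join_def by blast
  define C where "C i = (if i < m then A' i else (T ^^ m) -` B' (i - m))" for i
  have "C i \<in> (\<lambda>A. (T ^^ i) -` A) ` \<alpha>" if "i < m + n" for i
  proof (cases "i < m")
    case False
    then have "i - m < n" using that by simp
    then obtain D where D: "D \<in> \<alpha>" "B' (i - m) = (T ^^ (i - m)) -` D" using B' by blast
    have "(T ^^ m) -` ((T ^^ (i - m)) -` D) = (T ^^ i) -` D"
      using False by (simp add: vimage_comp flip: funpow_add)
    then show ?thesis using D False by (auto simp: C_def)
  qed (use A' in \<open>simp add: C_def\<close>)
  moreover have "(\<Inter>i<m+n. C i) = A \<inter> (T ^^ m) -` B"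
  proof
    show "(\<Inter>i<m+n. C i) \<subseteq> A \<inter> (T ^^ m) -` B"
    proof
      fix x assume x: "x \<in> (\<Inter>i<m+n. C i)"
      have "x \<in> A' i" if "i < m" for i using x that by (force simp: C_def)
      moreover have "(T ^^ m) x \<in> B' i" if "i < n" for i
      proof -
        have "x \<in> C (m + i)" using x that by simp
        then show ?thesis by (simp add: C_def)
      qed
      ultimately show "x \<in> A \<inter> (T ^^ m) -` B" by (simp add: A' B')
    qed
    show "A \<inter> (T ^^ m) -` B \<subseteq> (\<Inter>i<m+n. C i)"
      by (auto simp: A' B' C_def)
  qed
  ultimately show ?thesis unfolding cover_join_def by (intro CollectI exI[of _ C]) simp
qed

text \<open>An itinerary of length m + n is one of length m followed by one of length n read after m
  steps, so two subcovers combine into one indexed by pairs. For the logarithms this is the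
  subadditivity in Fekete's lemma.\<close>

lemma cover_number_iterated_join_add:
  assumes "finite \<alpha>" "\<Union>\<alpha> = UNIV"
  shows "cover_number (iterated_join T \<alpha> (m + n))
    \<le> cover_number (iterated_join T \<alpha> m) * cover_number (iterated_join T \<alpha> n)"
proof -
  obtain \<beta> where b: "\<beta> \<subseteq> iterated_join T \<alpha> m" "finite \<beta>" "\<Union>\<beta> = UNIV"
    "card \<beta> = cover_number (iterated_join T \<alpha> m)"
    using cover_number_attained[OF iterated_join_cover[OF assms, where T = T and n = m]] by (elim exE conjE)
  obtain \<gamma> where c: "\<gamma> \<subseteq> iterated_join T \<alpha> n" "finite \<gamma>" "\<Union>\<gamma> = UNIV"
    "card \<gamma> = cover_number (iterated_join T \<alpha> n)"
    using cover_number_attained[OF iterated_join_cover[OF assms, where T = T and n = n]] by (elim exE conjE)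
  define \<delta> where "\<delta> = (\<lambda>(A, B). A \<inter> (T ^^ m) -` B) ` (\<beta> \<times> \<gamma>)"
  have "\<delta> \<subseteq> iterated_join T \<alpha> (m + n)"
    unfolding \<delta>_def using b c by (auto intro!: iterated_join_add)
  moreover have "\<Union>\<delta> = UNIV"
  proof -
    have "x \<in> \<Union>\<delta>" for x
    proof -
      have "x \<in> \<Union>\<beta>" "(T ^^ m) x \<in> \<Union>\<gamma>" using b(3) c(3) by simp_all
      then obtain A B where "A \<in> \<beta>" "x \<in> A" "B \<in> \<gamma>" "(T ^^ m) x \<in> B" by (elim UnionE)
      then show ?thesis unfolding \<delta>_def
        by (intro UnionI[of "A \<inter> (T ^^ m) -` B"] image_eqI[of _ _ "(A, B)"]) simp_all
    qed
    then show ?thesis by auto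
  qed
  ultimately have "cover_number (iterated_join T \<alpha> (m + n)) \<le> card \<delta>"
    by (intro cover_number_le) (use b c in \<open>simp_all add: \<delta>_def\<close>)
  also have "\<dots> \<le> card (\<beta> \<times> \<gamma>)" unfolding \<delta>_def by (rule card_image_le) (use b c in simp)
  finally show ?thesis using b c by (simp add: card_cartesian_product)
qed

text \<open>\<open>entropy_cover\<close> is defined through \<open>lim\<close>, which says nothing
  about a sequence until its convergence is known; Fekete's lemma supplies it.\<close>

lemma entropy_cover_LIMSEQ:
  assumes "finite \<alpha>" "\<Union>\<alpha> = UNIV"
  shows "(\<lambda>n. ln (real (cover_number (iterated_join T \<alpha> n))) / real n) \<longlonglongrightarrow> entropy_cover T \<alpha>"
proof -
  let ?c = "\<lambda>n. cover_number (iterated_join T \<alpha> n)"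
  have pos: "?c n \<ge> 1" for n by (intro cover_number_pos iterated_join_cover assms)
  have "convergent (\<lambda>n. ln (real (?c n)) / real n)"
  proof (rule subadditive_convergent)
    show "ln (real (?c n)) \<ge> 0" for n using pos[of n] by (intro ln_ge_zero) simp
    show "ln (real (?c (m + n))) \<le> ln (real (?c m)) + ln (real (?c n))" for m n
    proof -
      have "real (?c (m + n)) \<le> real (?c m) * real (?c n)"
        using cover_number_iterated_join_add[OF assms, where T = T and m = m and n = n] by (simp flip: of_nat_mult)
      then have "ln (real (?c (m + n))) \<le> ln (real (?c m) * real (?c n))"
        using pos[of "m + n"] by (intro ln_mono) simp_all
      then show ?thesis using pos[of m] pos[of n] by (subst (asm) ln_mult_pos) simp_all
    qed
  qed
  then show ?thesis unfolding entropy_cover_def by (simp add: convergent_LIMSEQ_iff)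
qed

text \<open>Induction through the images: separated points are chosen in the image of each
  \<open>B i\<close>, and one preimage of each is kept, which copes with a non-injective T. Points
  from different \<open>B i\<close> are told apart at time one, points from the same
  \<open>B i\<close> at a later time.\<close>

lemma horseshoe_separated_points:
  fixes T :: "'a::metric_space \<Rightarrow> 'a"
  assumes step: "\<And>A. A \<in> K \<Longrightarrow> \<exists>B. (\<forall>i<N. B i \<subseteq> A \<and> T ` B i \<in> K) \<and>
      (\<forall>i<N. \<forall>j<N. i \<noteq> j \<longrightarrow> (\<forall>x\<in>B i. \<forall>y\<in>B j. dist (T x) (T y) \<ge> \<rho>))"
    and ne: "{} \<notin> K" and rho: "\<rho> > 0" and A: "A \<in> K"
  shows "\<exists>S\<subseteq>A. finite S \<and> card S = N ^ n \<and>
    (\<forall>x\<in>S. \<forall>y\<in>S. x \<noteq> y \<longrightarrow> (\<exists>i\<le>n. dist ((T ^^ i) x) ((T ^^ i) y) \<ge> \<rho>))"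
  using A
proof (induction n arbitrary: A)
  case 0
  then obtain x where "x \<in> A" using ne by (metis equals0I)
  then show ?case by (intro exI[of _ "{x}"]) auto
next
  case (Suc n)
  obtain B where B: "\<And>i. i < N \<Longrightarrow> B i \<subseteq> A" "\<And>i. i < N \<Longrightarrow> T ` B i \<in> K"
    "\<And>i j x y. i < N \<Longrightarrow> j < N \<Longrightarrow> i \<noteq> j \<Longrightarrow> x \<in> B i \<Longrightarrow> y \<in> B j \<Longrightarrow> dist (T x) (T y) \<ge> \<rho>"
    using step[OF Suc.prems] by metis
  have "\<exists>S\<subseteq>B i. finite S \<and> card S = N ^ n \<and>
    (\<forall>x\<in>S. \<forall>y\<in>S. x \<noteq> y \<longrightarrow> (\<exists>i\<le>Suc n. dist ((T ^^ i) x) ((T ^^ i) y) \<ge> \<rho>))" if i: "i < N" for i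
  proof -
    obtain S where S: "S \<subseteq> T ` B i" "finite S" "card S = N ^ n"
      "\<And>x y. x \<in> S \<Longrightarrow> y \<in> S \<Longrightarrow> x \<noteq> y \<Longrightarrow> (\<exists>i\<le>n. dist ((T ^^ i) x) ((T ^^ i) y) \<ge> \<rho>)"
      using Suc.IH[OF B(2)[OF i]] by blast
    obtain S' where S': "S' \<subseteq> B i" "inj_on T S'" "S = T ` S'"
      using S(1) by (metis subset_image_inj)
    have "finite S'" "card S' = N ^ n"
      using S S' by (simp_all add: card_image finite_image_iff)
    moreover have "\<exists>i\<le>Suc n. dist ((T ^^ i) x) ((T ^^ i) y) \<ge> \<rho>"
      if xy: "x \<in> S'" "y \<in> S'" "x \<noteq> y" for x y
    proof -
      have "T x \<noteq> T y" using xy S'(2) by (auto dest: inj_onD)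
      then obtain j where "j \<le> n" "dist ((T ^^ j) (T x)) ((T ^^ j) (T y)) \<ge> \<rho>"
        using S(4)[of "T x" "T y"] xy S'(3) by blast
      then show ?thesis by (intro exI[of _ "Suc j"]) (simp add: funpow_Suc_right del: funpow.simps)
    qed
    ultimately show ?thesis using S'(1) by blast
  qed
  then obtain S where S: "\<And>i. i < N \<Longrightarrow> S i \<subseteq> B i" "\<And>i. i < N \<Longrightarrow> finite (S i)"
    "\<And>i. i < N \<Longrightarrow> card (S i) = N ^ n"
    "\<And>i x y. i < N \<Longrightarrow> x \<in> S i \<Longrightarrow> y \<in> S i \<Longrightarrow> x \<noteq> y \<Longrightarrow> \<exists>j\<le>Suc n. dist ((T ^^ j) x) ((T ^^ j) y) \<ge> \<rho>"
    by metis
  have disj: "S i \<inter> S j = {}" if "i < N" "j < N" "i \<noteq> j" for i j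
    using B(3)[OF that] S(1)[of i] S(1)[of j] that rho by force
  have "card (\<Union>i<N. S i) = (\<Sum>i<N. card (S i))"
    by (rule card_UN_disjoint) (use S disj in auto)
  then have "card (\<Union>i<N. S i) = N ^ Suc n" using S(3) by simp
  moreover have "\<exists>l\<le>Suc n. dist ((T ^^ l) x) ((T ^^ l) y) \<ge> \<rho>"
    if x: "x \<in> S i" "i < N" and y: "y \<in> S j" "j < N" and "x \<noteq> y" for x y i j
  proof (cases "i = j")
    case True
    then show ?thesis using S(4)[of i x y] that by blast
  next
    case False
    have "dist (T x) (T y) \<ge> \<rho>" using B(3)[OF x(2) y(2) False] S(1) x y by blast
    then show ?thesis by (intro exI[of _ 1]) simp
  qed
  moreover have "(\<Union>i<N. S i) \<subseteq> A" using S(1) B(1) by blast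
  ultimately show ?case using S(2) by (intro exI[of _ "\<Union>i<N. S i"]) auto
qed

text \<open>Each point of S is sent to a member of a smallest subcover containing it. Two points
  with the same member would share an element of \<alpha> at every time below n and so never be
  \<rho> apart; hence the map is injective.\<close>

lemma cover_number_ge_separated:
  fixes T :: "'a::metric_space \<Rightarrow> 'a"
  assumes \<alpha>: "finite \<alpha>" "\<Union>\<alpha> = UNIV" and small: "\<And>A x y. A \<in> \<alpha> \<Longrightarrow> x \<in> A \<Longrightarrow> y \<in> A \<Longrightarrow> dist x y < \<rho>"
    and S: "finite S" "\<And>x y. x \<in> S \<Longrightarrow> y \<in> S \<Longrightarrow> x \<noteq> y \<Longrightarrow> \<exists>i<n. dist ((T ^^ i) x) ((T ^^ i) y) \<ge> \<rho>"
  shows "card S \<le> cover_number (iterated_join T \<alpha> n)"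
proof -
  obtain \<beta> where b: "\<beta> \<subseteq> iterated_join T \<alpha> n" "finite \<beta>" "\<Union>\<beta> = UNIV"
    "card \<beta> = cover_number (iterated_join T \<alpha> n)"
    using cover_number_attained[OF iterated_join_cover[OF \<alpha>, where T = T and n = n]] by (elim exE conjE)
  have "\<exists>C. C \<in> \<beta> \<and> x \<in> C" for x using b(3) UNIV_I[of x] by (metis UnionE)
  then obtain C where C: "\<And>x. C x \<in> \<beta>" "\<And>x. x \<in> C x" by metis
  have "inj_on C S"
  proof (rule inj_onI, rule ccontr)
    fix x y assume xy: "x \<in> S" "y \<in> S" "C x = C y" "x \<noteq> y"
    obtain i where i: "i < n" "dist ((T ^^ i) x) ((T ^^ i) y) \<ge> \<rho>" using S(2) xy by blast
    have "C x \<in> iterated_join T \<alpha> n" using C b by blast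
    then obtain A' where A': "C x = (\<Inter>i<n. A' i)" "\<forall>i<n. A' i \<in> (\<lambda>A. (T ^^ i) -` A) ` \<alpha>"
      unfolding cover_join_def by blast
    obtain D where D: "D \<in> \<alpha>" "A' i = (T ^^ i) -` D" using A' i by blast
    have "x \<in> A' i" "y \<in> A' i" using A'(1) C(2)[of x] C(2)[of y] xy(3) i(1) by auto
    then have "dist ((T ^^ i) x) ((T ^^ i) y) < \<rho>" using small[OF D(1)] D(2) by auto
    then show False using i by simp
  qed
  then have "card S \<le> card \<beta>" using C(1) b(2) by (intro card_inj_on_le[of C]) auto
  then show ?thesis using b by simp
qed

text \<open>The horseshoe is a self-reproducing family K instead of a fixed set with a Markov
  partition. This suits images of paths, which are replaced by new paths at every step and never
  return to an old one.\<close>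

lemma htop_ge_horseshoe:
  fixes T :: "'a::metric_space \<Rightarrow> 'a"
  assumes step: "\<And>A. A \<in> K \<Longrightarrow> \<exists>B. (\<forall>i<N. B i \<subseteq> A \<and> T ` B i \<in> K) \<and>
      (\<forall>i<N. \<forall>j<N. i \<noteq> j \<longrightarrow> (\<forall>x\<in>B i. \<forall>y\<in>B j. dist (T x) (T y) \<ge> \<rho>))"
    and K: "{} \<notin> K" "K \<noteq> {}" and rho: "\<rho> > 0" and N: "N \<ge> 1" and cpt: "compact (UNIV :: 'a set)"
  shows "htop T \<ge> ereal (ln (real N))"
proof -
  have "(UNIV :: 'a set) \<subseteq> \<Union>((\<lambda>x. ball x (\<rho> / 2)) ` UNIV)" using rho by auto
  then obtain \<alpha> where \<alpha>: "\<alpha> \<subseteq> (\<lambda>x. ball x (\<rho> / 2)) ` UNIV" "finite \<alpha>" "(UNIV :: 'a set) \<subseteq> \<Union>\<alpha>"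
    by (rule compactE[OF cpt]) auto
  have cov: "\<Union>\<alpha> = UNIV" using \<alpha>(3) by (rule top.extremum_uniqueI)
  have small: "dist x y < \<rho>" if A: "A \<in> \<alpha>" "x \<in> A" "y \<in> A" for A x y
  proof -
    obtain z where "A = ball z (\<rho> / 2)" using subsetD[OF \<alpha>(1) A(1)] by (elim rangeE)
    then show ?thesis using A dist_triangle_half_r[of z x \<rho> y] by simp
  qed
  obtain A where A: "A \<in> K" using K by blast
  let ?c = "\<lambda>n. cover_number (iterated_join T \<alpha> n)"
  \<comment> \<open>Points distinguished at the times 0 to n require the join of length
    \<open>Suc n\<close>; the resulting factor n / (n + 1) disappears in the limit.\<close>
  have lb: "N ^ n \<le> ?c (Suc n)" for n
  proof -
    obtain S where S: "finite S" "card S = N ^ n"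
      "\<And>x y. x \<in> S \<Longrightarrow> y \<in> S \<Longrightarrow> x \<noteq> y \<Longrightarrow> \<exists>i\<le>n. dist ((T ^^ i) x) ((T ^^ i) y) \<ge> \<rho>"
      using horseshoe_separated_points[OF step K(1) rho A, where n = n] by blast
    have "card S \<le> ?c (Suc n)"
      by (rule cover_number_ge_separated[OF \<alpha>(2) cov small S(1)])
        (use S(3) in \<open>auto simp: less_Suc_eq_le\<close>)
    then show ?thesis using S by simp
  qed
  have "ln (real N) \<le> entropy_cover T \<alpha>"
  proof (rule LIMSEQ_le)
    show "(\<lambda>n. real n / real (Suc n) * ln (real N)) \<longlonglongrightarrow> ln (real N)"
      using tendsto_mult[OF LIMSEQ_n_over_Suc_n tendsto_const[of "ln (real N)"]] by simp
    show "(\<lambda>n. ln (real (?c (Suc n))) / real (Suc n)) \<longlonglongrightarrow> entropy_cover T \<alpha>"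
      by (rule LIMSEQ_Suc[OF entropy_cover_LIMSEQ[OF \<alpha>(2) cov]])
    have "real n / real (Suc n) * ln (real N) \<le> ln (real (?c (Suc n))) / real (Suc n)" for n
    proof -
      have "real n * ln (real N) = ln (real (N ^ n))" using N by (simp add: ln_realpow)
      also have "\<dots> \<le> ln (real (?c (Suc n)))"
        using lb[of n] N by (intro ln_mono) (simp_all del: of_nat_power)
      finally show ?thesis by (simp add: divide_right_mono)
    qed
    then show "\<exists>n0. \<forall>n\<ge>n0. real n / real (Suc n) * ln (real N) \<le> ln (real (?c (Suc n))) / real (Suc n)"
      by blast
  qed
  also have "ereal (entropy_cover T \<alpha>) \<le> htop T"
    unfolding htop_def using \<alpha> cov by (intro SUP_upper) (auto simp: open_cover_def)
  finally show ?thesis by simp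
qed

section \<open>Stretching of paths by strong shears\<close>

text \<open>Take u as the last time with value at most \<alpha> and v as the first time after u with
  value at least \<beta>; the intermediate value theorem turns the inequalities at u and v into
  equalities.\<close>

lemma crossing_subinterval_up:
  fixes f :: "real \<Rightarrow> real"
  assumes cont: "continuous_on {s..t} f" and st: "s \<le> t" and f: "f s \<le> \<alpha>" "\<alpha> \<le> \<beta>" "\<beta> \<le> f t"
  shows "\<exists>u v. s \<le> u \<and> u \<le> v \<and> v \<le> t \<and> (\<forall>r\<in>{u..v}. \<alpha> \<le> f r \<and> f r \<le> \<beta>) \<and> f u = \<alpha> \<and> f v = \<beta>"
proof -
  have "closed ({s..t} \<inter> f -` {..\<alpha>})" by (rule continuous_closed_preimage[OF cont]) auto
  then have "compact ({s..t} \<inter> f -` {..\<alpha>})"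
    by (metis Int_lower1 bounded_closed_interval bounded_subset compact_eq_bounded_closed)
  moreover have "{s..t} \<inter> f -` {..\<alpha>} \<noteq> {}" using f st by force
  ultimately have "\<exists>u\<in>{s..t} \<inter> f -` {..\<alpha>}. \<forall>r\<in>{s..t} \<inter> f -` {..\<alpha>}. r \<le> u"
    by (rule compact_attains_sup)
  then obtain u where u: "u \<in> {s..t}" "f u \<le> \<alpha>" "\<And>r. r \<in> {s..t} \<Longrightarrow> f r \<le> \<alpha> \<Longrightarrow> r \<le> u"
    by blast
  have cont': "continuous_on {u..t} f" using cont u by (auto intro: continuous_on_subset)
  have "\<exists>r\<ge>u. r \<le> t \<and> f r = \<alpha>" using u f cont' by (intro IVT') auto
  then obtain r where r: "u \<le> r" "r \<le> t" "f r = \<alpha>" by blast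
  with u have "r = u" by (metis atLeastAtMost_iff order.trans order_antisym order_refl)
  with r have fu: "f u = \<alpha>" by simp
  have "closed ({u..t} \<inter> f -` {\<beta>..})" by (rule continuous_closed_preimage[OF cont']) auto
  then have "compact ({u..t} \<inter> f -` {\<beta>..})"
    by (metis Int_lower1 bounded_closed_interval bounded_subset compact_eq_bounded_closed)
  moreover have "{u..t} \<inter> f -` {\<beta>..} \<noteq> {}" using f u by force
  ultimately have "\<exists>v\<in>{u..t} \<inter> f -` {\<beta>..}. \<forall>r\<in>{u..t} \<inter> f -` {\<beta>..}. v \<le> r"
    by (rule compact_attains_inf)
  then obtain v where v: "v \<in> {u..t}" "f v \<ge> \<beta>" "\<And>r. r \<in> {u..t} \<Longrightarrow> f r \<ge> \<beta> \<Longrightarrow> v \<le> r"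
    by blast
  have "continuous_on {u..v} f" using cont' v by (auto intro: continuous_on_subset)
  then have "\<exists>r\<ge>u. r \<le> v \<and> f r = \<beta>" using v f fu by (intro IVT') auto
  then obtain r' where r': "u \<le> r'" "r' \<le> v" "f r' = \<beta>" by blast
  with v have "r' = v" by (metis atLeastAtMost_iff order.trans order_antisym order_refl)
  with r' have fv: "f v = \<beta>" by simp
  have "\<alpha> \<le> f x \<and> f x \<le> \<beta>" if x: "x \<in> {u..v}" for x
  proof
    show "\<alpha> \<le> f x"
    proof (rule ccontr)
      assume "\<not> \<alpha> \<le> f x"
      then have "x \<le> u" using u(1) u(3)[of x] v(1) x by simp
      then have "x = u" using x by simp
      then show False using fu \<open>\<not> \<alpha> \<le> f x\<close> by simp
    qed
    show "f x \<le> \<beta>"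
    proof (rule ccontr)
      assume "\<not> f x \<le> \<beta>"
      then have "v \<le> x" using v(1) v(3)[of x] x by simp
      then have "x = v" using x by simp
      then show False using fv \<open>\<not> f x \<le> \<beta>\<close> by simp
    qed
  qed
  then show ?thesis using u v fu fv by (intro exI[of _ u] exI[of _ v]) auto
qed

text \<open>The high value may come before the low one; that case is the ascending one for -f. The
  conclusion fixes no order of \<open>s'\<close> and \<open>t'\<close> either, so the direction in
  which a path runs never has to be tracked.\<close>

lemma crossing_subinterval:
  fixes f :: "real \<Rightarrow> real"
  assumes cont: "continuous_on {u..v} f" and st: "s \<in> {u..v}" "t \<in> {u..v}"
    and f: "f s \<le> \<alpha>" "\<alpha> \<le> \<beta>" "\<beta> \<le> f t"
  shows "\<exists>u' v'. u \<le> u' \<and> u' \<le> v' \<and> v' \<le> v \<and> (\<forall>r\<in>{u'..v'}. \<alpha> \<le> f r \<and> f r \<le> \<beta>) \<and>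
    (\<exists>s'\<in>{u'..v'}. \<exists>t'\<in>{u'..v'}. f s' = \<alpha> \<and> f t' = \<beta>)"
proof (cases "s \<le> t")
  case True
  have "continuous_on {s..t} f" using cont st by (auto intro: continuous_on_subset)
  from crossing_subinterval_up[OF this True f] obtain u' v' where
    uv: "s \<le> u'" "u' \<le> v'" "v' \<le> t" "\<forall>r\<in>{u'..v'}. \<alpha> \<le> f r \<and> f r \<le> \<beta>" "f u' = \<alpha>" "f v' = \<beta>" by blast
  have "u \<le> u'" "v' \<le> v" "u' \<in> {u'..v'}" "v' \<in> {u'..v'}" using uv(1-3) st by auto
  then show ?thesis using uv by blast
next
  case False
  have "continuous_on {t..s} (\<lambda>x. - f x)" using cont st
    by (auto intro: continuous_on_subset intro!: continuous_intros)
  from crossing_subinterval_up[OF this, of "-\<beta>" "-\<alpha>"] False f obtain u' v' where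
    uv: "t \<le> u'" "u' \<le> v'" "v' \<le> s" "\<forall>r\<in>{u'..v'}. \<alpha> \<le> f r \<and> f r \<le> \<beta>" "f u' = \<beta>" "f v' = \<alpha>"
    by force
  have "u \<le> u'" "v' \<le> v" "u' \<in> {u'..v'}" "v' \<in> {u'..v'}" using uv(1-3) st by auto
  then show ?thesis using uv by blast
qed

lemma intermediate_value:
  fixes f :: "real \<Rightarrow> real"
  assumes "continuous_on {u..v} f" "s \<in> {u..v}" "t \<in> {u..v}" "f s \<le> y" "y \<le> f t"
  shows "\<exists>r\<in>{u..v}. f r = y"
  using crossing_subinterval[OF assms(1), OF assms(2-4) order_refl assms(5)] by force

lemma sin_eq_1_in_period:
  assumes "\<delta> > 0"
  shows "\<exists>y\<in>{c..c + 2 * \<delta>}. sin (pi * y / \<delta>) = 1"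
proof -
  define x where "x = c / \<delta>"
  define j where "j = \<lceil>(x - 1 / 2) / 2\<rceil>"
  define y where "y = \<delta> * (2 * of_int j + 1 / 2)"
  have "x \<le> 2 * of_int j + 1 / 2" "2 * of_int j + 1 / 2 \<le> x + 2"
    using ceiling_correct[of "(x - 1 / 2) / 2"] unfolding j_def[symmetric] by (auto simp: field_simps)
  then have "\<delta> * x \<le> y" "y \<le> \<delta> * (x + 2)"
    unfolding y_def using assms by (intro mult_left_mono; simp)+
  then have "y \<in> {c..c + 2 * \<delta>}" using assms by (simp add: distrib_left x_def)
  moreover have "pi * y / \<delta> = 2 * pi * of_int j + pi / 2" using assms by (simp add: y_def field_simps)
  then have "sin (pi * y / \<delta>) = 1" by (simp add: sin_add sin_int_2pin cos_int_2pin)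
  ultimately show ?thesis by blast
qed

lemma sin_eq_minus_1_in_period:
  assumes "\<delta> > 0"
  shows "\<exists>y\<in>{c..c + 2 * \<delta>}. sin (pi * y / \<delta>) = -1"
proof -
  obtain y where y: "y \<in> {c - \<delta>..c - \<delta> + 2 * \<delta>}" "sin (pi * y / \<delta>) = 1"
    using sin_eq_1_in_period[OF assms] by blast
  have "pi * (y + \<delta>) / \<delta> = pi * y / \<delta> + pi" using assms by (simp add: field_simps)
  then have "sin (pi * (y + \<delta>) / \<delta>) = -1" using y by (simp add: sin_add)
  then show ?thesis using y by (intro bexI[of _ "y + \<delta>"]) auto
qed

section \<open>Sine shears of wavelength 2 * \<delta> and their action on paths\<close>

definition hshear :: "real \<Rightarrow> real \<Rightarrow> real^2 \<Rightarrow> real^2" where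
  "hshear a \<delta> x = x + (a * sin (pi * x $ 2 / \<delta>)) *\<^sub>R axis 1 1"

definition vshear :: "real \<Rightarrow> real \<Rightarrow> real^2 \<Rightarrow> real^2" where
  "vshear a \<delta> x = x + (a * sin (pi * x $ 1 / \<delta>)) *\<^sub>R axis 2 1"

lemma hshear_nth [simp]: "hshear a \<delta> x $ 1 = x $ 1 + a * sin (pi * x $ 2 / \<delta>)" "hshear a \<delta> x $ 2 = x $ 2"
  by (simp_all add: hshear_def axis_def)

lemma vshear_nth [simp]: "vshear a \<delta> x $ 2 = x $ 2 + a * sin (pi * x $ 1 / \<delta>)" "vshear a \<delta> x $ 1 = x $ 1"
  by (simp_all add: vshear_def axis_def)

lemma continuous_on_hshear: "continuous_on S (hshear a \<delta>)"
  unfolding hshear_def divide_inverse by (intro continuous_intros)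

lemma continuous_on_vshear: "continuous_on S (vshear a \<delta>)"
  unfolding vshear_def divide_inverse by (intro continuous_intros)

lemma norm_le_sum_nth: "norm (x :: real^2) \<le> \<bar>x $ 1\<bar> + \<bar>x $ 2\<bar>"
  using norm_le_l1_cart[of x] by (simp add: sum_2)

lemma dist_le_sum_nth: "dist (x :: real^2) y \<le> \<bar>x $ 1 - y $ 1\<bar> + \<bar>x $ 2 - y $ 2\<bar>"
  using norm_le_sum_nth[of "x - y"] by (simp add: dist_norm)

lemma abs_nth_diff_le_dist: "\<bar>x $ i - y $ i\<bar> \<le> dist (x :: real^2) y"
  using component_le_norm_cart[of "x - y" i] by (simp add: dist_norm)

text \<open>Restrict to the part of the path above a window of width 2 * \<delta> around
  \<open>q $ 1\<close>. The window contains a full period, so the sine attains 1 and -1 there; since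
  the path is thin, its sheared height passes from below \<open>q $ 2\<close> to above it and takes
  this value in between. The horizontal error is at most the width of the window.\<close>

lemma vshear_path_dense:
  fixes h :: "real \<Rightarrow> real^2"
  assumes \<delta>: "\<delta> > 0" and h: "continuous_on {u..v} h"
    and wide: "s0 \<in> {u..v}" "t0 \<in> {u..v}" "h s0 $ 1 \<le> \<xi>" "\<xi> + S \<le> h t0 $ 1" "2 * \<delta> \<le> S"
    and thin: "\<And>r. r \<in> {u..v} \<Longrightarrow> h r $ 2 \<in> {y0..y0 + 2 * \<delta>}"
    and q: "\<xi> \<le> q $ 1" "q $ 1 \<le> \<xi> + S" "\<bar>q $ 2 - (y0 + \<delta>)\<bar> \<le> a - \<delta>"
  shows "\<exists>r\<in>{u..v}. dist (vshear a \<delta> (h r)) q \<le> 2 * \<delta>"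
proof -
  \<comment> \<open>The window starts at \<open>q $ 1\<close>, unless it would then stick out beyond
    \<xi> + S; in that case it is pushed back to the right end.\<close>
  define c where "c = min (q $ 1) (\<xi> + S - 2 * \<delta>)"
  have c: "\<xi> \<le> c" "c + 2 * \<delta> \<le> \<xi> + S" "c \<le> q $ 1" "q $ 1 \<le> c + 2 * \<delta>"
    using wide q \<delta> by (auto simp: c_def)
  have h1: "continuous_on {u..v} (\<lambda>r. h r $ 1)" by (intro continuous_intros h)
  have "h s0 $ 1 \<le> c" "c + 2 * \<delta> \<le> h t0 $ 1" "c \<le> c + 2 * \<delta>" using wide c \<delta> by simp_all
  from crossing_subinterval[OF h1, OF wide(1,2) this(1,3,2)] obtain u' v' s' t' where
    uv: "u \<le> u'" "u' \<le> v'" "v' \<le> v" and in_window: "\<And>r. r \<in> {u'..v'} \<Longrightarrow> c \<le> h r $ 1 \<and> h r $ 1 \<le> c + 2 * \<delta>"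
    and st': "s' \<in> {u'..v'}" "t' \<in> {u'..v'}" "h s' $ 1 = c" "h t' $ 1 = c + 2 * \<delta>" by blast
  have h': "continuous_on {u'..v'} h" using h uv by (auto intro: continuous_on_subset)
  have h1': "continuous_on {u'..v'} (\<lambda>r. h r $ 1)" by (intro continuous_intros h')
  have hit: "\<exists>r\<in>{u'..v'}. h r $ 1 = y" if "y \<in> {c..c + 2 * \<delta>}" for y
    using intermediate_value[OF h1', OF st'(1,2), of y] st' that by simp
  obtain tp where tp: "tp \<in> {u'..v'}" "sin (pi * h tp $ 1 / \<delta>) = 1"
    using sin_eq_1_in_period[OF \<delta>, of c] hit by metis
  obtain tm where tm: "tm \<in> {u'..v'}" "sin (pi * h tm $ 1 / \<delta>) = -1"
    using sin_eq_minus_1_in_period[OF \<delta>, of c] hit by metis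
  have "continuous_on {u'..v'} (\<lambda>r. vshear a \<delta> (h r) $ 2)"
    by (intro continuous_intros continuous_on_compose2[OF continuous_on_vshear h']) auto
  moreover have "vshear a \<delta> (h tm) $ 2 \<le> q $ 2" "q $ 2 \<le> vshear a \<delta> (h tp) $ 2"
    using tp tm thin[of tp] thin[of tm] uv q by (auto simp: abs_le_iff)
  ultimately obtain r where r: "r \<in> {u'..v'}" "vshear a \<delta> (h r) $ 2 = q $ 2"
    using intermediate_value[of u' v' "\<lambda>r. vshear a \<delta> (h r) $ 2" tm tp "q $ 2"] tp tm by blast
  have "dist (vshear a \<delta> (h r)) q \<le> \<bar>h r $ 1 - q $ 1\<bar>"
    using dist_le_sum_nth[of "vshear a \<delta> (h r)" q] r by simp
  also have "\<dots> \<le> 2 * \<delta>" using in_window[OF r(1)] c by linarith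
  finally show ?thesis using r uv by auto
qed

text \<open>The bound R on the horizontal extent is what prevents the path from undoing the
  displacement caused by the horizontal shear. The low point may come before or after the high
  one.\<close>

definition tall_path :: "real \<Rightarrow> real \<Rightarrow> (real \<Rightarrow> real^2) \<Rightarrow> real \<Rightarrow> real \<Rightarrow> bool" where
  "tall_path \<delta> R g u v \<longleftrightarrow> continuous_on {u..v} g \<and>
     (\<exists>s\<in>{u..v}. \<exists>t\<in>{u..v}. g s $ 2 + 2 * \<delta> \<le> g t $ 2) \<and>
     (\<forall>s\<in>{u..v}. \<forall>t\<in>{u..v}. \<bar>g s $ 1 - g t $ 1\<bar> \<le> R)"

text \<open>Origin of the constants. Put \<rho> = (2 * K + 2) * \<delta>. The image of a box
  crossing comes within (2 * K + 1) * \<delta> of every point of a ball of radius \<rho>, so hitting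
  its top and bottom leaves a climb of 2 * \<delta>. The box must contain the preimage under X of
  this ball: hence the width S = 2 * K * \<rho> and, starting from a strip of half-height \<delta>,
  the amplitude a2 = K * \<rho> + \<delta>. R bounds the diameter of the image of a crossing. The
  horizontal shear has to provide N boxes and as many gaps 4 * K * \<delta> in spite of the extent
  R; a gap of this size is still 2 * \<delta> after X and two errors of size \<delta>.\<close>

locale shear_composition =
  fixes X F :: "real^2 \<Rightarrow> real^2" and K \<delta> a1 a2 S R :: real and N :: nat
  assumes \<delta>: "\<delta> > 0" and K: "K \<ge> 1"
    and X_lipschitz: "\<And>p q. dist (X p) (X q) \<le> K * dist p q"
    and X_expansive: "\<And>p q. dist p q \<le> K * dist (X p) (X q)"
    and X_surj: "surj X"
    and F_cont: "continuous_on UNIV F"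
    and F_close: "\<And>x. dist (F x) (X (vshear a2 \<delta> (hshear a1 \<delta> x))) \<le> \<delta>"
    and S: "S = 2 * K * (2 * K + 2) * \<delta>" and a2: "a2 = (K * (2 * K + 2) + 1) * \<delta>"
    and R: "R = K * (S + 2 * a2 + 2 * \<delta>) + 2 * \<delta>"
    and a1: "real N * (S + 4 * K * \<delta>) + R \<le> 2 * a1"
begin

lemma F_dist_upper:
  "dist (F x) (F y) \<le> K * dist (vshear a2 \<delta> (hshear a1 \<delta> x)) (vshear a2 \<delta> (hshear a1 \<delta> y)) + 2 * \<delta>"
proof -
  let ?P = "\<lambda>x. vshear a2 \<delta> (hshear a1 \<delta> x)"
  have "dist (F x) (F y) \<le> dist (F x) (X (?P x)) + dist (X (?P x)) (X (?P y)) + dist (X (?P y)) (F y)"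
    by (meson add_right_mono dist_triangle dist_triangle_le order_trans order_refl)
  then show ?thesis
    using F_close[of x] F_close[of y] X_lipschitz[of "?P x" "?P y"] by (simp add: dist_commute)
qed

lemma F_dist_lower:
  "dist (vshear a2 \<delta> (hshear a1 \<delta> x)) (vshear a2 \<delta> (hshear a1 \<delta> y)) \<le> K * (dist (F x) (F y) + 2 * \<delta>)"
proof -
  let ?P = "\<lambda>x. vshear a2 \<delta> (hshear a1 \<delta> x)"
  have "dist (X (?P x)) (X (?P y)) \<le> dist (F x) (X (?P x)) + dist (F x) (F y) + dist (F y) (X (?P y))"
    by (smt (verit) dist_commute dist_triangle)
  then have "dist (X (?P x)) (X (?P y)) \<le> dist (F x) (F y) + 2 * \<delta>"
    using F_close[of x] F_close[of y] by simp
  then have "K * dist (X (?P x)) (X (?P y)) \<le> K * (dist (F x) (F y) + 2 * \<delta>)"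
    using K by (intro mult_left_mono) simp_all
  then show ?thesis using X_expansive[of "?P x" "?P y"] by linarith
qed

lemma constants: "a2 > 0" "S > 0" "R > 0" "2 * \<delta> \<le> S"
proof -
  have K2: "1 * 1 \<le> K * (2 * K + 2)" using K by (intro mult_mono) simp_all
  then have "1 * \<delta> \<le> K * (2 * K + 2) * \<delta>" using \<delta> by (intro mult_right_mono) simp_all
  then show S2: "2 * \<delta> \<le> S" by (simp add: S)
  show a20: "a2 > 0" unfolding a2 using K2 \<delta> by (intro mult_pos_pos) simp_all
  show "S > 0" using \<delta> S2 by simp
  then show "R > 0" unfolding R using K \<delta> a20 S2 by (intro add_nonneg_pos mult_nonneg_nonneg) simp_all
qed

lemma shear_dist:
  assumes "\<bar>hshear a1 \<delta> x $ 1 - hshear a1 \<delta> y $ 1\<bar> \<le> A" "\<bar>x $ 2 - y $ 2\<bar> \<le> B"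
  shows "dist (vshear a2 \<delta> (hshear a1 \<delta> x)) (vshear a2 \<delta> (hshear a1 \<delta> y)) \<le> A + 2 * a2 + B"
proof -
  let ?s = "\<lambda>x. a2 * sin (pi * hshear a1 \<delta> x $ 1 / \<delta>)"
  have s: "\<bar>?s x\<bar> \<le> a2" for x
    using constants(1) mult_left_mono[OF abs_sin_le_one, of a2] by (simp add: abs_mult)
  have "dist (vshear a2 \<delta> (hshear a1 \<delta> x)) (vshear a2 \<delta> (hshear a1 \<delta> y))
    \<le> \<bar>hshear a1 \<delta> x $ 1 - hshear a1 \<delta> y $ 1\<bar> + \<bar>(x $ 2 + ?s x) - (y $ 2 + ?s y)\<bar>"
    using dist_le_sum_nth[of "vshear a2 \<delta> (hshear a1 \<delta> x)" "vshear a2 \<delta> (hshear a1 \<delta> y)"]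
    by (simp del: hshear_nth(1))
  then show ?thesis using assms s[of x] s[of y] by linarith
qed

text \<open>Targets are chosen near \<open>X q\<close>, with q the centre of the box, and pulled
  back by surjectivity; expansiveness places their preimages in the box, where the sheared path is
  dense. Since the image of the path comes close to a whole ball, it is tall however X turns the
  plane.\<close>

lemma tall_image:
  assumes g: "continuous_on {u..v} g"
    and wide: "s0 \<in> {u..v}" "t0 \<in> {u..v}" "hshear a1 \<delta> (g s0) $ 1 = \<xi>" "hshear a1 \<delta> (g t0) $ 1 = \<xi> + S"
    and between: "\<And>r. r \<in> {u..v} \<Longrightarrow> \<xi> \<le> hshear a1 \<delta> (g r) $ 1 \<and> hshear a1 \<delta> (g r) $ 1 \<le> \<xi> + S"
    and thin: "\<And>r. r \<in> {u..v} \<Longrightarrow> g r $ 2 \<in> {y0..y0 + 2 * \<delta>}"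
  shows "tall_path \<delta> R (F \<circ> g) u v"
proof -
  define \<rho> where "\<rho> = (2 * K + 2) * \<delta>"
  have \<rho>: "\<rho> > 0" "S = 2 * (K * \<rho>)" "a2 = K * \<rho> + \<delta>"
    using \<delta> K by (simp add: \<rho>_def, simp_all add: \<rho>_def S a2 algebra_simps)
  define q where "q = (vector [\<xi> + S / 2, y0 + \<delta>] :: real^2)"
  have q: "q $ 1 = \<xi> + S / 2" "q $ 2 = y0 + \<delta>" by (simp_all add: q_def)
  have hc: "continuous_on {u..v} (\<lambda>r. hshear a1 \<delta> (g r))"
    by (rule continuous_on_compose2[OF continuous_on_hshear g]) auto
  have hit: "\<exists>r\<in>{u..v}. dist (F (g r)) p \<le> (2 * K + 1) * \<delta>" if p: "dist p (X q) \<le> \<rho>" for p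
  proof -
    obtain q' where q': "p = X q'" using X_surj by (metis surj_def)
    have "dist q' q \<le> K * dist p (X q)" using X_expansive[of q' q] q' by simp
    also have "\<dots> \<le> K * \<rho>" using p K by (intro mult_left_mono) simp_all
    finally have d: "\<bar>q' $ 1 - q $ 1\<bar> \<le> K * \<rho>" "\<bar>q' $ 2 - q $ 2\<bar> \<le> K * \<rho>"
      using abs_nth_diff_le_dist order_trans by blast+
    have "\<exists>r\<in>{u..v}. dist (vshear a2 \<delta> (hshear a1 \<delta> (g r))) q' \<le> 2 * \<delta>"
    proof (rule vshear_path_dense[OF \<delta> hc wide(1,2)])
      show "hshear a1 \<delta> (g s0) $ 1 \<le> \<xi>" "\<xi> + S \<le> hshear a1 \<delta> (g t0) $ 1" "2 * \<delta> \<le> S"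
        using wide constants by simp_all
      show "hshear a1 \<delta> (g r) $ 2 \<in> {y0..y0 + 2 * \<delta>}" if "r \<in> {u..v}" for r
        using thin[OF that] by simp
      show "\<xi> \<le> q' $ 1" "q' $ 1 \<le> \<xi> + S" "\<bar>q' $ 2 - (y0 + \<delta>)\<bar> \<le> a2 - \<delta>"
        using d q \<rho> by linarith+
    qed
    then obtain r where r: "r \<in> {u..v}" "dist (vshear a2 \<delta> (hshear a1 \<delta> (g r))) q' \<le> 2 * \<delta>" by blast
    have "dist (X (vshear a2 \<delta> (hshear a1 \<delta> (g r)))) p \<le> K * (2 * \<delta>)"
      unfolding q' using r(2) K by (intro order_trans[OF X_lipschitz] mult_left_mono) simp_all
    then have "dist (F (g r)) p \<le> \<delta> + K * (2 * \<delta>)"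
      using F_close[of "g r"] dist_triangle[of "F (g r)" p "X (vshear a2 \<delta> (hshear a1 \<delta> (g r)))"] by linarith
    then show ?thesis using r(1) by (auto simp: algebra_simps)
  qed
  \<comment> \<open>The climb between the points near \<open>X q + e\<close> and
    \<open>X q - e\<close> is at least 2 * \<rho> - 2 * (2 * K + 1) * \<delta> = 2 *
    \<delta>.\<close>
  define e where "e = (axis 2 \<rho> :: real^2)"
  have e: "e $ 2 = \<rho>" "norm e \<le> \<rho>"
    using \<rho> norm_le_sum_nth[of e] by (simp_all add: e_def axis_def)
  obtain t where t: "t \<in> {u..v}" "dist (F (g t)) (X q + e) \<le> (2 * K + 1) * \<delta>"
    using hit[of "X q + e"] e by (auto simp: dist_norm)
  obtain s where s: "s \<in> {u..v}" "dist (F (g s)) (X q - e) \<le> (2 * K + 1) * \<delta>"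
    using hit[of "X q - e"] e by (auto simp: dist_norm)
  have "F (g s) $ 2 + 2 * \<delta> \<le> F (g t) $ 2"
    using abs_nth_diff_le_dist[of "F (g t)" 2 "X q + e"] abs_nth_diff_le_dist[of "F (g s)" 2 "X q - e"]
      s(2) t(2) e by (simp add: \<rho>_def abs_le_iff algebra_simps)
  moreover have "\<bar>F (g s) $ 1 - F (g t) $ 1\<bar> \<le> R" if st: "s \<in> {u..v}" "t \<in> {u..v}" for s t
  proof -
    have "dist (vshear a2 \<delta> (hshear a1 \<delta> (g s))) (vshear a2 \<delta> (hshear a1 \<delta> (g t))) \<le> S + 2 * a2 + 2 * \<delta>"
      by (rule shear_dist) (use between[OF st(1)] between[OF st(2)] thin[OF st(1)] thin[OF st(2)] in auto)
    then have "K * dist (vshear a2 \<delta> (hshear a1 \<delta> (g s))) (vshear a2 \<delta> (hshear a1 \<delta> (g t)))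
      \<le> K * (S + 2 * a2 + 2 * \<delta>)" using K by (intro mult_left_mono) simp_all
    then have "dist (F (g s)) (F (g t)) \<le> R"
      unfolding R using F_dist_upper[of "g s" "g t"] by linarith
    then show ?thesis using abs_nth_diff_le_dist order_trans by blast
  qed
  moreover have "continuous_on {u..v} (F \<circ> g)"
    by (intro continuous_on_compose g continuous_on_subset[OF F_cont]) simp
  ultimately show ?thesis using s(1) t(1) unfolding tall_path_def comp_def by blast
qed

text \<open>The path is first cut to a piece of height exactly 2 * \<delta>, then its sheared copy
  is cut into crossings of N separated boxes. The upper bound on the distances serves the passage to
  the torus, where only pairs at distance at most 1 keep their distance.\<close>

lemma stretching:
  assumes "tall_path \<delta> R g u v"
  shows "\<exists>U V. (\<forall>i<N. {U i..V i} \<subseteq> {u..v} \<and> tall_path \<delta> R (F \<circ> g) (U i) (V i)) \<and>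
    (\<forall>i<N. \<forall>j<N. i \<noteq> j \<longrightarrow> (\<forall>s\<in>{U i..V i}. \<forall>t\<in>{U j..V j}.
      2 * \<delta> \<le> dist (F (g s)) (F (g t)) \<and>
      dist (F (g s)) (F (g t)) \<le> K * (R + 2 * a1 + 2 * a2 + 2 * \<delta>) + 2 * \<delta>))"
proof -
  let ?h = "\<lambda>r. hshear a1 \<delta> (g r) $ 1"
  have g: "continuous_on {u..v} g" and narrow: "\<And>s t. s \<in> {u..v} \<Longrightarrow> t \<in> {u..v} \<Longrightarrow> \<bar>g s $ 1 - g t $ 1\<bar> \<le> R"
    using assms by (auto simp: tall_path_def)
  obtain s0 t0 where st0: "s0 \<in> {u..v}" "t0 \<in> {u..v}" "g s0 $ 2 + 2 * \<delta> \<le> g t0 $ 2"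
    using assms by (auto simp: tall_path_def)
  define y0 where "y0 = g s0 $ 2"
  have g2: "continuous_on {u..v} (\<lambda>r. g r $ 2)" by (intro continuous_intros g)
  have "g s0 $ 2 \<le> y0" "y0 \<le> y0 + 2 * \<delta>" "y0 + 2 * \<delta> \<le> g t0 $ 2" using st0 \<delta> by (simp_all add: y0_def)
  from crossing_subinterval[OF g2, OF st0(1,2) this] obtain u' v' s' t' where
    uv: "u \<le> u'" "u' \<le> v'" "v' \<le> v" and thin: "\<And>r. r \<in> {u'..v'} \<Longrightarrow> g r $ 2 \<in> {y0..y0 + 2 * \<delta>}"
    and st': "s' \<in> {u'..v'}" "t' \<in> {u'..v'}" "g s' $ 2 = y0" "g t' $ 2 = y0 + 2 * \<delta>" by auto
  have sub: "{u'..v'} \<subseteq> {u..v}" using uv by auto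
  have g': "continuous_on {u'..v'} g" using g sub by (rule continuous_on_subset)
  have g2': "continuous_on {u'..v'} (\<lambda>r. g r $ 2)" by (intro continuous_intros g')
  have hit: "\<exists>r\<in>{u'..v'}. g r $ 2 = y" if "y \<in> {y0..y0 + 2 * \<delta>}" for y
    using intermediate_value[OF g2', OF st'(1,2), of y] st' that by simp
  obtain tp where tp: "tp \<in> {u'..v'}" "sin (pi * g tp $ 2 / \<delta>) = 1"
    using sin_eq_1_in_period[OF \<delta>, of y0] hit by metis
  obtain tm where tm: "tm \<in> {u'..v'}" "sin (pi * g tm $ 2 / \<delta>) = -1"
    using sin_eq_minus_1_in_period[OF \<delta>, of y0] hit by metis
  \<comment> \<open>Between the two extremes of the sine the shear moves points apart by 2 * a1, of
    which the extent of the path itself takes back at most R.\<close>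
  have wide: "?h tm + real N * (S + 4 * K * \<delta>) \<le> ?h tp"
    using tp tm narrow[of tm tp] sub a1 by (simp add: subset_iff abs_le_iff)
  have hc: "continuous_on {u'..v'} ?h"
    by (intro continuous_intros continuous_on_compose2[OF continuous_on_hshear g']) auto
  define \<xi> where "\<xi> i = ?h tm + real i * (S + 4 * K * \<delta>)" for i :: nat
  have D: "S + 4 * K * \<delta> > 0" using constants K \<delta> by (simp add: add_pos_pos)
  have piece: "\<exists>U V. {U..V} \<subseteq> {u'..v'} \<and> tall_path \<delta> R (F \<circ> g) U V \<and>
      (\<forall>r\<in>{U..V}. \<xi> i \<le> ?h r \<and> ?h r \<le> \<xi> i + S)" if i: "i < N" for i
  proof -
    have "real (Suc i) * (S + 4 * K * \<delta>) \<le> real N * (S + 4 * K * \<delta>)"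
      using i D by (intro mult_right_mono) simp_all
    moreover have "K * \<delta> > 0" "0 \<le> real i * (S + 4 * K * \<delta>)" using K \<delta> D by simp_all
    ultimately have "?h tm \<le> \<xi> i" "\<xi> i \<le> \<xi> i + S" "\<xi> i + S \<le> ?h tp"
      using wide constants D by (simp_all add: \<xi>_def algebra_simps)
    from crossing_subinterval[OF hc, OF tm(1) tp(1) this] obtain U V s1 t1 where
      UV: "u' \<le> U" "U \<le> V" "V \<le> v'" "\<And>r. r \<in> {U..V} \<Longrightarrow> \<xi> i \<le> ?h r \<and> ?h r \<le> \<xi> i + S"
        "s1 \<in> {U..V}" "t1 \<in> {U..V}" "?h s1 = \<xi> i" "?h t1 = \<xi> i + S"
      by blast
    have UVsub: "{U..V} \<subseteq> {u'..v'}" using UV by auto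
    have "tall_path \<delta> R (F \<circ> g) U V"
      by (rule tall_image[OF continuous_on_subset[OF g' UVsub] UV(5-8) UV(4) thin])
        (use UVsub in auto)
    then show ?thesis using UVsub UV(4) by blast
  qed
  then obtain U V where UV: "\<And>i. i < N \<Longrightarrow> {U i..V i} \<subseteq> {u'..v'}"
    "\<And>i. i < N \<Longrightarrow> tall_path \<delta> R (F \<circ> g) (U i) (V i)"
    "\<And>i r. i < N \<Longrightarrow> r \<in> {U i..V i} \<Longrightarrow> \<xi> i \<le> ?h r \<and> ?h r \<le> \<xi> i + S"
    by metis
  have apart: "4 * K * \<delta> \<le> \<bar>?h s - ?h t\<bar>"
    if "i < N" "j < N" "i < j" "s \<in> {U i..V i}" "t \<in> {U j..V j}" for i j s t
  proof -
    have "real (Suc i) * (S + 4 * K * \<delta>) \<le> real j * (S + 4 * K * \<delta>)"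
      using that D by (intro mult_right_mono) simp_all
    then have "\<xi> i + S + 4 * K * \<delta> \<le> \<xi> j" by (simp add: \<xi>_def algebra_simps)
    then show ?thesis using UV(3)[of i s] UV(3)[of j t] that by linarith
  qed
  have "2 * \<delta> \<le> dist (F (g s)) (F (g t)) \<and>
      dist (F (g s)) (F (g t)) \<le> K * (R + 2 * a1 + 2 * a2 + 2 * \<delta>) + 2 * \<delta>"
    if ij: "i < N" "j < N" "i \<noteq> j" and s: "s \<in> {U i..V i}" and t: "t \<in> {U j..V j}" for i j s t
  proof
    let ?P = "\<lambda>x. vshear a2 \<delta> (hshear a1 \<delta> x)"
    have "4 * K * \<delta> \<le> \<bar>?h s - ?h t\<bar>"
      using ij s t apart[of i j s t] apart[of j i t s] by (metis abs_minus_commute linorder_neqE_nat)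
    also have "\<dots> \<le> dist (?P (g s)) (?P (g t))"
      using abs_nth_diff_le_dist[of "?P (g s)" 1 "?P (g t)"] by (simp del: hshear_nth(1))
    also have "\<dots> \<le> K * (dist (F (g s)) (F (g t)) + 2 * \<delta>)" by (rule F_dist_lower)
    finally have "K * (4 * \<delta>) \<le> K * (dist (F (g s)) (F (g t)) + 2 * \<delta>)" by (simp add: mult.assoc mult.left_commute)
    then show "2 * \<delta> \<le> dist (F (g s)) (F (g t))" using K by simp
    have st: "s \<in> {u'..v'}" "t \<in> {u'..v'}" using UV(1) ij s t by blast+
    have a1': "a1 \<ge> 0" using a1 constants D by (smt (verit) mult_nonneg_nonneg of_nat_0_le_iff)
    then have sin_le: "\<bar>a1 * sin x\<bar> \<le> a1" for x
      using mult_left_mono[OF abs_sin_le_one, of a1] by (simp add: abs_mult)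
    have "\<bar>?h s - ?h t\<bar> \<le> R + 2 * a1"
      using narrow[of s t] st sub
        sin_le[of "pi * g s $ 2 / \<delta>"] sin_le[of "pi * g t $ 2 / \<delta>"]
      by (simp add: subset_iff abs_le_iff)
    then have "dist (?P (g s)) (?P (g t)) \<le> R + 2 * a1 + 2 * a2 + 2 * \<delta>"
      by (rule shear_dist) (use thin[OF st(1)] thin[OF st(2)] in auto)
    then have "K * dist (?P (g s)) (?P (g t)) \<le> K * (R + 2 * a1 + 2 * a2 + 2 * \<delta>)"
      using K by (intro mult_left_mono) simp_all
    then show "dist (F (g s)) (F (g t)) \<le> K * (R + 2 * a1 + 2 * a2 + 2 * \<delta>) + 2 * \<delta>"
      using F_dist_upper[of "g s" "g t"] by linarith
  qed
  moreover have "{U i..V i} \<subseteq> {u..v}" if "i < N" for i using UV(1)[OF that] sub by blast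
  ultimately show ?thesis using UV(2) by (intro exI[of _ U] exI[of _ V] conjI allI impI ballI) simp_all
qed

end

section \<open>Velocity fields along curves\<close>

lemma norm_le_omega_norm: "ennreal (norm (f x)) \<le> omega_norm \<omega> f"
proof -
  have "ennreal (norm (f x)) \<le> C0_norm f" unfolding C0_norm_def by (rule SUP_upper) simp
  then show ?thesis unfolding omega_norm_def by (simp add: add_increasing2)
qed

lemma norm_diff_le_omega_seminorm:
  assumes \<omega>: "nonlipschitz_osgood \<omega>" and f: "omega_norm \<omega> f < \<infinity>"
  shows "norm (f x - f y) \<le> enn2real (omega_seminorm \<omega> f) * \<omega> (dist x y)"
proof (cases "x = y")
  case False
  then have pos: "\<omega> (dist x y) > 0" using \<omega> by (simp add: nonlipschitz_osgood_def)
  have fin: "omega_seminorm \<omega> f < \<infinity>" using f by (auto simp: omega_norm_def less_top)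
  have "ennreal (norm (f x - f y) / \<omega> (dist x y)) \<le> omega_seminorm \<omega> f"
    unfolding omega_seminorm_def using False by (intro SUP_upper2[where i = "(x, y)"]) auto
  then have "norm (f x - f y) / \<omega> (dist x y) \<le> enn2real (omega_seminorm \<omega> f)"
    using fin pos by (metis divide_nonneg_pos enn2real_ennreal enn2real_mono infinity_ennreal_def norm_ge_zero)
  then show ?thesis using pos by (simp add: field_simps)
qed (use \<omega> in \<open>simp add: nonlipschitz_osgood_def\<close>)

lemma c_omega_continuous:
  assumes \<omega>: "nonlipschitz_osgood \<omega>" and f: "f \<in> c_omega \<omega>"
  shows "continuous_on S f"
  unfolding continuous_on_iff
proof (intro ballI allI impI)
  fix x and e :: real assume e: "e > 0"
  define C where "C = enn2real (omega_seminorm \<omega> f) + 1"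
  have C: "C > 0" "omega_norm \<omega> f < \<infinity>"
    using f by (auto simp: C_def add_nonneg_pos c_omega_def C_omega_def)
  have "continuous_on {0..} \<omega>" "\<omega> 0 = 0" using \<omega> by (auto simp: nonlipschitz_osgood_def)
  then obtain d where d: "d > 0" "\<And>r. r \<in> {0..} \<Longrightarrow> dist r 0 < d \<Longrightarrow> dist (\<omega> r) (\<omega> 0) < e / C"
    using e C unfolding continuous_on_iff by (metis atLeast_iff divide_pos_pos order_refl)
  have "dist (f y) (f x) < e" if "dist y x < d" for y
  proof -
    have "\<bar>\<omega> (dist y x)\<bar> < e / C" using d(2)[of "dist y x"] that \<open>\<omega> 0 = 0\<close> by (simp add: dist_real_def)
    then have "C * \<bar>\<omega> (dist y x)\<bar> < e" using C by (simp add: field_simps)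
    moreover have "norm (f y - f x) \<le> C * \<bar>\<omega> (dist y x)\<bar>"
      by (rule order_trans[OF norm_diff_le_omega_seminorm[OF \<omega> C(2)]])
        (auto simp: C_def intro!: order_trans[OF mult_left_mono[OF abs_ge_self]] mult_right_mono)
    ultimately show ?thesis by (simp add: dist_norm)
  qed
  then show "\<exists>d>0. \<forall>y\<in>S. dist y x < d \<longrightarrow> dist (f y) (f x) < e" using d(1) by blast
qed

text \<open>Multiplication by the indicator of the complement of the exceptional null set turns
  convergence a.e. into convergence everywhere; completeness of the measure then discards the null
  set.\<close>

lemma borel_measurable_AE_limit:
  fixes f :: "nat \<Rightarrow> 'a::euclidean_space \<Rightarrow> 'b::euclidean_space"
  assumes f: "\<And>n. f n \<in> borel_measurable (lebesgue_on S)" and S: "S \<in> sets lebesgue"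
    and lim: "AE t in lebesgue_on S. (\<lambda>n. f n t) \<longlonglongrightarrow> g t"
  shows "g \<in> borel_measurable (lebesgue_on S)"
proof -
  let ?g = "\<lambda>t. if t \<in> S then g t else 0"
  let ?f = "\<lambda>n t. if t \<in> S then f n t else 0"
  have "AE t in lebesgue. t \<in> S \<longrightarrow> (\<lambda>n. f n t) \<longlonglongrightarrow> g t"
    using lim S by (subst (asm) AE_restrict_space_iff) simp_all
  then obtain N where N: "N \<in> null_sets lebesgue" "\<And>t. t \<notin> N \<Longrightarrow> t \<in> S \<Longrightarrow> (\<lambda>n. f n t) \<longlonglongrightarrow> g t"
    unfolding completion.AE_iff_null_sets by auto
  have N': "- N \<in> sets lebesgue" using N(1) by (metis Compl_in_sets_lebesgue null_setsD2)
  have "(\<lambda>t. indicator (- N) t *\<^sub>R ?g t) \<in> borel_measurable lebesgue"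
  proof (rule borel_measurable_LIMSEQ_metric)
    have "?f n \<in> borel_measurable lebesgue" for n
      using f[of n] S by (simp add: borel_measurable_if)
    then show "(\<lambda>t. indicator (- N) t *\<^sub>R ?f n t) \<in> borel_measurable lebesgue" for n
      using N' by (intro borel_measurable_scaleR borel_measurable_indicator) auto
    show "(\<lambda>n. indicator (- N) t *\<^sub>R ?f n t) \<longlonglongrightarrow> indicator (- N) t *\<^sub>R ?g t" for t
      using N(2)[of t] by (cases "t \<in> N"; cases "t \<in> S") simp_all
  qed
  moreover have "AE t in lebesgue. indicator (- N) t *\<^sub>R ?g t = ?g t"
    by (rule AE_I'[OF N(1)]) (auto simp: indicator_def)
  ultimately have "?g \<in> borel_measurable lebesgue" by (rule borel_measurable_AE)
  then show ?thesis using S by (simp add: borel_measurable_if)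
qed

text \<open>Strong measurability enters here: the approximating fields converge in the sup norm for
  a.e. t, hence along every curve at once.\<close>

lemma field_along_measurable:
  assumes \<omega>: "nonlipschitz_osgood \<omega>" and b: "strongly_measurable \<omega> b"
    and \<gamma>: "continuous_on {0..1} \<gamma>"
  shows "(\<lambda>t. b t (\<gamma> t)) \<in> borel_measurable (lebesgue_on {0..1})"
proof -
  obtain s where s: "\<And>n. simple_function (lebesgue_on {0..}) (s n)" "\<And>n t. t \<ge> 0 \<Longrightarrow> s n t \<in> c_omega \<omega>"
    and lim: "AE t in lebesgue_on {0..}. (\<lambda>n. omega_norm \<omega> (\<lambda>x. b t x - s n t x)) \<longlonglongrightarrow> 0"
    using b unfolding strongly_measurable_def by blast
  have mn: "(\<lambda>t. s n t (\<gamma> t)) \<in> borel_measurable (lebesgue_on {0..1})" for n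
  \<comment> \<open>A simple function has finitely many values, so the composition is glued from
    finitely many continuous functions of t.\<close>
  proof (rule measurable_compose_countable'[where f = "\<lambda>f t. f (\<gamma> t)" and g = "s n" and I = "s n ` {0..}"])
    show "(\<lambda>t. f (\<gamma> t)) \<in> borel_measurable (lebesgue_on {0..1})" if "f \<in> s n ` {0..}" for f
    proof (rule continuous_imp_measurable_on_sets_lebesgue)
      have "f \<in> c_omega \<omega>" using that s(2) by auto
      then show "continuous_on {0..1} (\<lambda>t. f (\<gamma> t))"
        by (rule continuous_on_compose2[OF c_omega_continuous[OF \<omega>, where S = UNIV] \<gamma>]) simp
    qed simp
    have sp: "space (lebesgue_on {0..}) = {0::real..}" by simp
    show "countable (s n ` {0..})"
      using s(1)[of n] unfolding simple_function_def sp by (simp add: countable_finite)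
    have m: "s n \<in> measurable (lebesgue_on {0..}) (count_space (s n ` {0..}))"
      using measurable_simple_function[OF s(1)[of n]] by (auto simp: measurable_def)
    show "s n \<in> measurable (lebesgue_on {0..1}) (count_space (s n ` {0..}))"
      by (rule measurable_restrict_mono[OF m]) simp
  qed
  have ae: "AE t in lebesgue_on {0..1}. (\<lambda>n. s n t (\<gamma> t)) \<longlonglongrightarrow> b t (\<gamma> t)"
    using AE_unit_interval[OF lim]
  proof eventually_elim
    case (elim t)
    have "(\<lambda>n. ennreal (norm (b t (\<gamma> t) - s n t (\<gamma> t)))) \<longlonglongrightarrow> 0"
      by (rule tendsto_sandwich[OF _ _ tendsto_const elim]) (simp_all add: norm_le_omega_norm[of "\<lambda>x. b t x - s _ t x"])
    then have "(\<lambda>n. norm (b t (\<gamma> t) - s n t (\<gamma> t))) \<longlonglongrightarrow> 0"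
      by (simp add: tendsto_ennreal_iff flip: ennreal_0)
    then show ?case by (subst tendsto_dist_iff) (simp add: dist_norm norm_minus_commute)
  qed
  show ?thesis by (rule borel_measurable_AE_limit[OF mn _ ae]) simp
qed

lemma zero_in_L1per_fields: "(\<lambda>t x. 0) \<in> L1per_fields \<omega>"
  by (simp add: L1per_fields_def strongly_measurable_zero zero_in_c_omega L1_norm_def omega_norm_zero)

lemma abs_integrable_bounded:
  fixes f :: "real \<Rightarrow> real^2"
  assumes f: "f \<in> borel_measurable (lebesgue_on {0..1})"
    and bd: "(\<integral>\<^sup>+t. ennreal (norm (f t)) \<partial>lebesgue_on {0..1}) \<le> C" "C < \<infinity>"
  shows "f absolutely_integrable_on {0..1}" "integral {0..1} (\<lambda>t. norm (f t)) \<le> enn2real C"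
proof -
  have i: "integrable (lebesgue_on {0..1}) f"
    by (rule integrableI_bounded[OF f]) (use bd in \<open>auto intro: le_less_trans\<close>)
  then have "integrable (lebesgue_on {0..1}) (\<lambda>t. norm (f t))" by simp
  then show "f absolutely_integrable_on {0..1}"
    using f by (simp add: absolutely_integrable_measurable comp_def)
  have "integral {0..1} (\<lambda>t. norm (f t)) = (\<integral>t. norm (f t) \<partial>lebesgue_on {0..1})"
    using i by (intro lebesgue_integral_eq_integral[symmetric]) simp_all
  also have "\<dots> = enn2real (\<integral>\<^sup>+t. ennreal (norm (f t)) \<partial>lebesgue_on {0..1})"
    using i by (intro integral_eq_nn_integral) simp_all
  also have "\<dots> \<le> enn2real C" using bd by (intro enn2real_mono) simp_all
  finally show "integral {0..1} (\<lambda>t. norm (f t)) \<le> enn2real C" .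
qed

text \<open>The bound is the same for all curves because the \<omega>-norm dominates the sup norm.
  Comparison with the zero field gives integrability of one field along a curve.\<close>

lemma field_along_diff:
  assumes \<omega>: "nonlipschitz_osgood \<omega>" and b: "b \<in> L1per_fields \<omega>" and c: "c \<in> L1per_fields \<omega>"
    and \<gamma>: "continuous_on {0..1} \<gamma>"
  shows "(\<lambda>t. b t (\<gamma> t) - c t (\<gamma> t)) absolutely_integrable_on {0..1}"
    "integral {0..1} (\<lambda>t. norm (b t (\<gamma> t) - c t (\<gamma> t))) \<le> enn2real (L1_norm \<omega> (\<lambda>t x. b t x - c t x))"
proof -
  have "(\<lambda>t. b t (\<gamma> t)) \<in> borel_measurable (lebesgue_on {0..1})"
    "(\<lambda>t. c t (\<gamma> t)) \<in> borel_measurable (lebesgue_on {0..1})"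
    using b c by (auto simp: L1per_fields_def intro!: field_along_measurable[OF \<omega> _ \<gamma>])
  then have m: "(\<lambda>t. b t (\<gamma> t) - c t (\<gamma> t)) \<in> borel_measurable (lebesgue_on {0..1})"
    by (rule borel_measurable_diff)
  have le: "(\<integral>\<^sup>+t. ennreal (norm (b t (\<gamma> t) - c t (\<gamma> t))) \<partial>lebesgue_on {0..1}) \<le> L1_norm \<omega> (\<lambda>t x. b t x - c t x)"
    unfolding L1_norm_def by (intro nn_integral_mono norm_le_omega_norm[of "\<lambda>x. b _ x - c _ x"])
  show "(\<lambda>t. b t (\<gamma> t) - c t (\<gamma> t)) absolutely_integrable_on {0..1}"
    "integral {0..1} (\<lambda>t. norm (b t (\<gamma> t) - c t (\<gamma> t))) \<le> enn2real (L1_norm \<omega> (\<lambda>t x. b t x - c t x))"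
    using abs_integrable_bounded[OF m le L1_norm_diff_finite[OF b c]] by auto
qed

lemma field_along_abs_integrable:
  assumes "nonlipschitz_osgood \<omega>" "b \<in> L1per_fields \<omega>" "continuous_on {0..1} \<gamma>"
  shows "(\<lambda>t. b t (\<gamma> t)) absolutely_integrable_on {0..1}"
  using field_along_diff(1)[OF assms(1,2) zero_in_L1per_fields assms(3)] by simp

lemma integral_field_diff_bound:
  assumes \<omega>: "nonlipschitz_osgood \<omega>" and b: "b \<in> L1per_fields \<omega>" and c: "c \<in> L1per_fields \<omega>"
    and \<gamma>: "continuous_on {0..1} \<gamma>" and t: "t \<in> {0..1}"
  shows "norm (integral {0..t} (\<lambda>t. b t (\<gamma> t) - c t (\<gamma> t))) \<le> enn2real (L1_norm \<omega> (\<lambda>t x. b t x - c t x))"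
proof -
  let ?f = "\<lambda>t. b t (\<gamma> t) - c t (\<gamma> t)"
  note f = field_along_diff[OF \<omega> b c \<gamma>]
  have ft: "?f absolutely_integrable_on {0..t}"
    by (rule absolutely_integrable_on_subinterval[OF f(1)]) (use t in auto)
  have "norm (integral {0..t} ?f) \<le> integral {0..t} (\<lambda>t. norm (?f t))"
    using ft by (intro integral_norm_bound_integral) (auto simp: absolutely_integrable_on_def)
  also have "\<dots> \<le> integral {0..1} (\<lambda>t. norm (?f t))"
    using ft f(1) t by (intro integral_subset_le) (auto simp: absolutely_integrable_on_def)
  finally show ?thesis using f(2) by linarith
qed

text \<open>An integrable majorant for dominated convergence, uniform in space. It is built from the
  measurable m because the norm of \<open>b t\<close> is only known to agree with a measurable
  function for a.e. t.\<close>

lemma field_dominated: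
  assumes b: "b \<in> L1per_fields \<omega>"
  shows "\<exists>h. integrable (lebesgue_on {0..1}) h \<and> (AE t in lebesgue_on {0..1}. \<forall>x. norm (b t x) \<le> h t)"
proof -
  let ?L = "lebesgue_on {0..1::real}"
  obtain m where m: "m \<in> borel_measurable ?L" "AE t in ?L. omega_norm \<omega> (\<lambda>x. b t x - 0) = m t"
    using omega_norm_diff_measurable[of \<omega> b "\<lambda>t x. 0"] b strongly_measurable_zero
    unfolding L1per_fields_def by blast
  have "(\<integral>\<^sup>+t. m t \<partial>?L) = L1_norm \<omega> b"
    unfolding L1_norm_def using m(2) by (intro nn_integral_cong_AE) (auto elim: eventually_mono)
  then have fin: "(\<integral>\<^sup>+t. m t \<partial>?L) < \<infinity>" using b by (simp add: L1per_fields_def)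
  have top: "AE t in ?L. m t \<noteq> \<infinity>" using fin m(1) by (intro nn_integral_PInf_AE) auto
  have "(\<integral>\<^sup>+t. ennreal (norm (enn2real (m t))) \<partial>?L) = (\<integral>\<^sup>+t. m t \<partial>?L)"
    using top by (intro nn_integral_cong_AE) (auto elim!: eventually_mono simp: less_top)
  then have "integrable ?L (\<lambda>t. enn2real (m t))" using m(1) fin by (intro integrableI_bounded) auto
  moreover have "AE t in ?L. \<forall>x. norm (b t x) \<le> enn2real (m t)"
    using m(2) top
  proof eventually_elim
    case (elim t)
    have "ennreal (norm (b t x)) \<le> m t" for x using norm_le_omega_norm[of "b t" x \<omega>] elim by simp
    then have "enn2real (ennreal (norm (b t x))) \<le> enn2real (m t)" for x
      using elim by (intro enn2real_mono) (auto simp: less_top)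
    then show ?case by simp
  qed
  ultimately show ?thesis by blast
qed

text \<open>Dominated convergence: each \<open>b s\<close> is continuous, and the majorant does not
  depend on the curve. The limit curve is not assumed continuous; measurability along it is
  inherited from the approximations.\<close>

lemma field_integral_tendsto:
  fixes \<gamma> :: "real \<Rightarrow> torus"
  assumes \<omega>: "nonlipschitz_osgood \<omega>" and b: "b \<in> L1per_fields \<omega>"
    and \<gamma>n: "\<And>n. continuous_on {0..1} (\<gamma>n n)" and lim: "\<And>t. t \<in> {0..1} \<Longrightarrow> (\<lambda>n. \<gamma>n n t) \<longlonglongrightarrow> \<gamma> t"
  shows "(\<lambda>s. b s (\<gamma> s)) absolutely_integrable_on {0..1}"
    "t \<in> {0..1} \<Longrightarrow> (\<lambda>n. integral {0..t} (\<lambda>s. b s (\<gamma>n n s))) \<longlonglongrightarrow> integral {0..t} (\<lambda>s. b s (\<gamma> s))"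
proof -
  let ?L = "lebesgue_on {0..1::real}"
  obtain h where h: "integrable ?L h" "AE t in ?L. \<forall>x. norm (b t x) \<le> h t" using field_dominated[OF b] by blast
  have mn: "(\<lambda>s. b s (\<gamma>n n s)) \<in> borel_measurable ?L" for n
    using b by (intro field_along_measurable[OF \<omega> _ \<gamma>n]) (simp add: L1per_fields_def)
  have conv: "(\<lambda>n. b s (\<gamma>n n s)) \<longlonglongrightarrow> b s (\<gamma> s)" if "s \<in> {0..1}" for s
  proof -
    have "b s \<in> c_omega \<omega>" using b that by (simp add: L1per_fields_def)
    then show ?thesis using c_omega_continuous[OF \<omega>, of "b s" UNIV] lim[OF that]
      by (intro continuous_on_tendsto_compose[where s = UNIV and f = "b s"]) auto
  qed
  have m: "(\<lambda>s. b s (\<gamma> s)) \<in> borel_measurable ?L"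
    by (rule borel_measurable_LIMSEQ_metric[where f = "\<lambda>n s. b s (\<gamma>n n s)", OF mn]) (use conv in auto)
  have bd: "AE s in ?L. norm (b s (\<gamma> s)) \<le> h s" using h(2) by eventually_elim simp
  have "integrable ?L (\<lambda>s. b s (\<gamma> s))"
    by (rule Bochner_Integration.integrable_bound[OF h(1) m]) (use bd in \<open>auto elim!: eventually_mono\<close>)
  then have "integrable ?L (\<lambda>s. norm (b s (\<gamma> s)))" by simp
  then show ai: "(\<lambda>s. b s (\<gamma> s)) absolutely_integrable_on {0..1}"
    using m by (simp add: absolutely_integrable_measurable comp_def)
  assume t: "t \<in> {0..1}"
  then have sub: "{0..t} \<subseteq> {0..1}" by auto
  have restr: "f \<in> borel_measurable ?L \<Longrightarrow> f \<in> borel_measurable (lebesgue_on {0..t})" for f :: "real \<Rightarrow> real^2"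
    by (rule measurable_restrict_mono[OF _ sub])
  have ht: "integrable (lebesgue_on {0..t}) h"
    using set_integrable_subset[of lebesgue "{0..1}" h "{0..t}"] h(1) sub
    by (simp add: set_integrable_def integrable_restrict_space)
  have aet: "AE s in lebesgue_on {0..t}. \<forall>x. norm (b s x) \<le> h s"
  proof -
    have "AE s in lebesgue. s \<in> {0..1} \<longrightarrow> (\<forall>x. norm (b s x) \<le> h s)"
      using h(2) by (subst (asm) AE_restrict_space_iff) simp_all
    then have "AE s in lebesgue. s \<in> {0..t} \<longrightarrow> (\<forall>x. norm (b s x) \<le> h s)"
      by (rule eventually_mono) (use sub in auto)
    then show ?thesis by (subst AE_restrict_space_iff) simp_all
  qed
  have "(\<lambda>n. \<integral>s. b s (\<gamma>n n s) \<partial>lebesgue_on {0..t}) \<longlonglongrightarrow> (\<integral>s. b s (\<gamma> s) \<partial>lebesgue_on {0..t})"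
  proof (rule integral_dominated_convergence[OF restr[OF m] restr[OF mn] ht])
    show "AE s in lebesgue_on {0..t}. (\<lambda>n. b s (\<gamma>n n s)) \<longlonglongrightarrow> b s (\<gamma> s)"
      by (rule AE_I2) (use conv t in auto)
    show "AE s in lebesgue_on {0..t}. norm (b s (\<gamma>n n s)) \<le> h s" for n
      using aet by (rule eventually_mono) simp
  qed
  moreover have "(\<integral>s. f s \<partial>lebesgue_on {0..t}) = integral {0..t} f"
    if "f absolutely_integrable_on {0..1}" for f :: "real \<Rightarrow> real^2"
    by (rule lebesgue_integral_eq_integral, rule absolutely_integrable_imp_integrable,
        rule absolutely_integrable_on_subinterval[OF that]) (use t in auto)
  ultimately show "(\<lambda>n. integral {0..t} (\<lambda>s. b s (\<gamma>n n s))) \<longlonglongrightarrow> integral {0..t} (\<lambda>s. b s (\<gamma> s))"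
    using ai field_along_abs_integrable[OF \<omega> b \<gamma>n] by simp
qed

section \<open>Gronwall inequalities in both directions of time\<close>

lemma gronwall_forward:
  fixes u :: "real \<Rightarrow> real"
  assumes u: "continuous_on {a..b} u" and L: "L \<ge> 0"
    and le: "\<And>t. t \<in> {a..b} \<Longrightarrow> u t \<le> A + L * integral {a..t} u" and t: "t \<in> {a..b}"
  shows "u t \<le> A * exp (L * (t - a))"
proof -
  define g where "g s = (A + L * integral {a..s} u) * exp (- L * (s - a))" for s
  have ui: "u integrable_on {a..b}" by (rule integrable_continuous_real[OF u])
  have "g t \<le> g a"
  proof (rule DERIV_nonpos_imp_decreasing_open[where f = g and a = a and b = t])
    show "a \<le> t" using t by simp
    show "\<exists>y. (g has_real_derivative y) (at s) \<and> y \<le> 0" if s: "a < s" "s < t" for s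
    proof (intro exI conjI)
      have "((\<lambda>s. integral {a..s} u) has_real_derivative u s) (at s within {a..b})"
        by (rule integral_has_real_derivative[OF u]) (use s t in auto)
      moreover have "at s within {a..b} = at s" by (rule at_within_Icc_at) (use s t in auto)
      ultimately have d: "((\<lambda>s. integral {a..s} u) has_real_derivative u s) (at s)" by simp
      show "(g has_real_derivative L * (u s - (A + L * integral {a..s} u)) * exp (- L * (s - a))) (at s)"
        unfolding g_def by (rule derivative_eq_intros d refl)+ (simp add: algebra_simps)
      show "L * (u s - (A + L * integral {a..s} u)) * exp (- L * (s - a)) \<le> 0"
        using le[of s] s t L by (intro mult_nonpos_nonneg mult_nonneg_nonpos) auto
    qed
    have "continuous_on {a..t} (\<lambda>s. integral {a..s} u)"
      by (rule continuous_on_subset[OF indefinite_integral_continuous_1[OF ui]]) (use t in auto)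
    then show "continuous_on {a..t} g" unfolding g_def by (intro continuous_intros)
  qed
  then have "(A + L * integral {a..t} u) * exp (- L * (t - a)) \<le> A" by (simp add: g_def)
  then have "(A + L * integral {a..t} u) * exp (- L * (t - a)) * exp (L * (t - a)) \<le> A * exp (L * (t - a))"
    by (intro mult_right_mono) simp_all
  then have "A + L * integral {a..t} u \<le> A * exp (L * (t - a))"
    by (simp add: mult.assoc flip: exp_add)
  then show ?thesis using le[OF t] by simp
qed

text \<open>Reflection of time. It bounds the distance of two curves at an earlier time by that at a
  later one, which yields the expansiveness of X without solving the equation backwards.\<close>

lemma gronwall_backward:
  fixes u :: "real \<Rightarrow> real"
  assumes u: "continuous_on {a..b} u" and L: "L \<ge> 0"
    and le: "\<And>t. t \<in> {a..b} \<Longrightarrow> u t \<le> A + L * integral {t..b} u" and t: "t \<in> {a..b}"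
  shows "u t \<le> A * exp (L * (b - t))"
proof -
  define v where "v s = u (- s)" for s
  have "v (- t) \<le> A * exp (L * (- t - (- b)))"
  proof (rule gronwall_forward)
    show "continuous_on {- b..- a} v" unfolding v_def
      by (rule continuous_on_compose2[OF u]) (auto intro!: continuous_intros)
    show "v s \<le> A + L * integral {- b..s} v" if "s \<in> {- b..- a}" for s
      using le[of "- s"] that Henstock_Kurzweil_Integration.integral_reflect_real[of b "- s" u] by (simp add: v_def[abs_def])
    show "- t \<in> {- b..- a}" using t by simp
  qed (rule L)
  then show ?thesis by (simp add: v_def)
qed

section \<open>Lifted integral curves\<close>

text \<open>The stretching argument measures heights and widths in the plane, so curves are lifted.
  Unit time suffices by periodicity; values outside [0, 1] are left free.\<close>

definition lift_curve :: "velocity \<Rightarrow> real^2 \<Rightarrow> (real \<Rightarrow> real^2) \<Rightarrow> bool" where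
  "lift_curve b z \<zeta> \<longleftrightarrow> (\<lambda>s. b s (torus_proj (\<zeta> s))) absolutely_integrable_on {0..1} \<and>
     (\<forall>t\<in>{0..1}. \<zeta> t = z + integral {0..t} (\<lambda>s. b s (torus_proj (\<zeta> s))))"

lemma continuous_on_proj_comp: "continuous_on S \<zeta> \<Longrightarrow> continuous_on S (\<lambda>s. torus_proj (\<zeta> s))"
  by (rule continuous_on_compose2[OF continuous_on_torus_proj]) auto

lemma lift_curve_0: "lift_curve b z \<zeta> \<Longrightarrow> \<zeta> 0 = z"
  by (simp add: lift_curve_def)

lemma lift_curve_integrable:
  "lift_curve b z \<zeta> \<Longrightarrow> 0 \<le> s \<Longrightarrow> t \<le> 1 \<Longrightarrow> (\<lambda>s. b s (torus_proj (\<zeta> s))) integrable_on {s..t}"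
  unfolding lift_curve_def absolutely_integrable_on_def
  by (meson atLeastatMost_subset_iff integrable_on_subinterval)

lemma lift_curve_continuous:
  assumes "lift_curve b z \<zeta>"
  shows "continuous_on {0..1} \<zeta>"
proof -
  have "continuous_on {0..1} (\<lambda>t. z + integral {0..t} (\<lambda>s. b s (torus_proj (\<zeta> s))))"
    using lift_curve_integrable[OF assms, of 0 1]
    by (intro continuous_intros indefinite_integral_continuous_1) simp
  then show ?thesis by (rule continuous_on_eq) (use assms in \<open>simp add: lift_curve_def\<close>)
qed

lemma lift_curve_increment:
  assumes \<zeta>: "lift_curve b z \<zeta>" and st: "0 \<le> s" "s \<le> t" "t \<le> 1"
  shows "\<zeta> t = \<zeta> s + integral {s..t} (\<lambda>s. b s (torus_proj (\<zeta> s)))"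
proof -
  let ?f = "\<lambda>s. b s (torus_proj (\<zeta> s))"
  have "integral {0..s} ?f + integral {s..t} ?f = integral {0..t} ?f"
    using st by (intro Henstock_Kurzweil_Integration.integral_combine lift_curve_integrable[OF \<zeta>]) auto
  then show ?thesis using \<zeta> st by (simp add: lift_curve_def)
qed

text \<open>Stated through lifts, so that it applies directly to the difference of two curves in the
  plane.\<close>

definition lift_lipschitz :: "real \<Rightarrow> (torus \<Rightarrow> real^2) \<Rightarrow> bool" where
  "lift_lipschitz L f \<longleftrightarrow> (\<forall>x y. norm (f (torus_proj x) - f (torus_proj y)) \<le> L * dist x y)"

text \<open>Insert c along the curve of b: the term b - c is bounded by the L1 distance along any
  curve, the other one by the Lipschitz constant of c. Thus only the centre of a ball of fields has
  to be Lipschitz.\<close>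

lemma lift_curve_stability:
  assumes \<omega>: "nonlipschitz_osgood \<omega>" and b: "b \<in> L1per_fields \<omega>" and c: "c \<in> L1per_fields \<omega>"
    and L: "L \<ge> 0" "\<And>t. t \<in> {0..1} \<Longrightarrow> lift_lipschitz L (c t)"
    and \<zeta>: "lift_curve b z \<zeta>" and \<eta>: "lift_curve c z' \<eta>" and t: "t \<in> {0..1}"
  shows "dist (\<zeta> t) (\<eta> t) \<le> (dist z z' + enn2real (L1_norm \<omega> (\<lambda>t x. b t x - c t x))) * exp L"
proof -
  let ?D = "enn2real (L1_norm \<omega> (\<lambda>t x. b t x - c t x))"
  note cont = lift_curve_continuous[OF \<zeta>] lift_curve_continuous[OF \<eta>]
  have "dist (\<zeta> t) (\<eta> t) \<le> (dist z z' + ?D) * exp (L * (t - 0))"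
  proof (rule gronwall_forward[OF _ L(1) _ t])
    show u: "continuous_on {0..1} (\<lambda>t. dist (\<zeta> t) (\<eta> t))" by (intro continuous_intros cont)
    fix t :: real assume t: "t \<in> {0..1}"
    let ?b\<zeta> = "\<lambda>s. b s (torus_proj (\<zeta> s))" and ?c\<zeta> = "\<lambda>s. c s (torus_proj (\<zeta> s))"
      and ?c\<eta> = "\<lambda>s. c s (torus_proj (\<eta> s))"
    have "?c\<zeta> absolutely_integrable_on {0..1}"
      by (rule field_along_abs_integrable[OF \<omega> c continuous_on_proj_comp[OF cont(1)]])
    then have i: "?b\<zeta> integrable_on {0..t}" "?c\<eta> integrable_on {0..t}" "?c\<zeta> integrable_on {0..t}"
      using t lift_curve_integrable[OF \<zeta>] lift_curve_integrable[OF \<eta>]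
        integrable_on_subinterval[of ?c\<zeta> "{0..1}" 0 t] by (auto simp: absolutely_integrable_on_def)
    have "\<zeta> t - \<eta> t = (z - z') + (integral {0..t} ?b\<zeta> - integral {0..t} ?c\<eta>)"
      using \<zeta> \<eta> t by (simp add: lift_curve_def)
    also have "\<dots> = (z - z') + (integral {0..t} (\<lambda>s. ?b\<zeta> s - ?c\<zeta> s) + integral {0..t} (\<lambda>s. ?c\<zeta> s - ?c\<eta> s))"
      using i by (simp add: Henstock_Kurzweil_Integration.integral_diff)
    finally have e: "\<zeta> t - \<eta> t = (z - z')
        + (integral {0..t} (\<lambda>s. ?b\<zeta> s - ?c\<zeta> s) + integral {0..t} (\<lambda>s. ?c\<zeta> s - ?c\<eta> s))" .
    have "dist (\<zeta> t) (\<eta> t) \<le> dist z z'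
        + (norm (integral {0..t} (\<lambda>s. ?b\<zeta> s - ?c\<zeta> s)) + norm (integral {0..t} (\<lambda>s. ?c\<zeta> s - ?c\<eta> s)))"
      using norm_triangle_ineq[of "z - z'"
          "integral {0..t} (\<lambda>s. ?b\<zeta> s - ?c\<zeta> s) + integral {0..t} (\<lambda>s. ?c\<zeta> s - ?c\<eta> s)"]
        norm_triangle_ineq[of "integral {0..t} (\<lambda>s. ?b\<zeta> s - ?c\<zeta> s)" "integral {0..t} (\<lambda>s. ?c\<zeta> s - ?c\<eta> s)"]
      unfolding dist_norm e by linarith
    moreover have "norm (integral {0..t} (\<lambda>s. ?b\<zeta> s - ?c\<zeta> s)) \<le> ?D"
      by (rule integral_field_diff_bound[OF \<omega> b c continuous_on_proj_comp[OF cont(1)] t])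
    moreover have "norm (integral {0..t} (\<lambda>s. ?c\<zeta> s - ?c\<eta> s)) \<le> integral {0..t} (\<lambda>s. L * dist (\<zeta> s) (\<eta> s))"
    proof (rule integral_norm_bound_integral)
      show "(\<lambda>s. ?c\<zeta> s - ?c\<eta> s) integrable_on {0..t}" by (intro integrable_diff i)
      show "(\<lambda>s. L * dist (\<zeta> s) (\<eta> s)) integrable_on {0..t}"
        using t by (intro integrable_continuous_real continuous_intros continuous_on_subset[OF u]) auto
      show "norm (?c\<zeta> s - ?c\<eta> s) \<le> L * dist (\<zeta> s) (\<eta> s)" if "s \<in> {0..t}" for s
        using L(2)[of s] that t by (simp add: lift_lipschitz_def)
    qed
    ultimately show "dist (\<zeta> t) (\<eta> t) \<le> dist z z' + ?D + L * integral {0..t} (\<lambda>s. dist (\<zeta> s) (\<eta> s))"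
      by simp
  qed
  also have "\<dots> \<le> (dist z z' + ?D) * exp L"
    using t L(1) by (intro mult_left_mono) (auto intro!: mult_left_le)
  finally show ?thesis .
qed

text \<open>The Lipschitz bound is asked only inside the open interval: at time 1 a periodic field
  already has its value at time 0, which for the fields built below is a shear. The two endpoints do
  not affect the integrals.\<close>

lemma lift_curves_bilipschitz:
  assumes \<zeta>: "lift_curve c z \<zeta>" and \<eta>: "lift_curve c z' \<eta>"
    and ab: "0 \<le> a" "a \<le> b" "b \<le> 1"
    and L: "L \<ge> 0" "\<And>t. t \<in> {a<..<b} \<Longrightarrow> lift_lipschitz L (c t)"
  shows "dist (\<zeta> b) (\<eta> b) \<le> exp L * dist (\<zeta> a) (\<eta> a)" "dist (\<zeta> a) (\<eta> a) \<le> exp L * dist (\<zeta> b) (\<eta> b)"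
proof -
  let ?u = "\<lambda>t. dist (\<zeta> t) (\<eta> t)"
  let ?f = "\<lambda>s. c s (torus_proj (\<zeta> s)) - c s (torus_proj (\<eta> s))"
  have u: "continuous_on {a..b} ?u"
    using ab by (intro continuous_intros continuous_on_subset[OF lift_curve_continuous[OF \<zeta>]]
        continuous_on_subset[OF lift_curve_continuous[OF \<eta>]]) auto
  have incr: "norm ((\<zeta> t - \<eta> t) - (\<zeta> s - \<eta> s)) \<le> L * integral {s..t} ?u" if st: "a \<le> s" "s \<le> t" "t \<le> b" for s t
  proof -
    have i: "?f integrable_on {s..t}"
      using st ab by (intro integrable_diff lift_curve_integrable[OF \<zeta>] lift_curve_integrable[OF \<eta>]) auto
    have "(\<zeta> t - \<eta> t) - (\<zeta> s - \<eta> s) = integral {s..t} ?f"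
      using lift_curve_increment[OF \<zeta>, of s t] lift_curve_increment[OF \<eta>, of s t] st ab
      by (subst Henstock_Kurzweil_Integration.integral_diff)
        (auto intro!: lift_curve_integrable[OF \<zeta>] lift_curve_integrable[OF \<eta>])
    also have "\<dots> = integral {s..t} (\<lambda>r. if r \<in> {a<..<b} then ?f r else 0)"
      by (rule integral_spike[of "{a, b}"]) (use st in auto)
    also have "norm \<dots> \<le> integral {s..t} (\<lambda>r. L * ?u r)"
    proof (rule integral_norm_bound_integral)
      show "(\<lambda>r. if r \<in> {a<..<b} then ?f r else 0) integrable_on {s..t}"
        by (rule integrable_spike[OF i, of "{a, b}"]) (use st in auto)
      show "(\<lambda>r. L * ?u r) integrable_on {s..t}"
        using st by (intro integrable_continuous_real continuous_intros continuous_on_subset[OF u]) auto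
      show "norm (if r \<in> {a<..<b} then ?f r else 0) \<le> L * ?u r" for r
        using L by (auto simp: lift_lipschitz_def)
    qed
    finally show ?thesis by simp
  qed
  have 1: "?u b \<le> ?u a * exp (L * (b - a))"
  proof (rule gronwall_forward[OF u L(1)])
    show "?u t \<le> ?u a + L * integral {a..t} ?u" if "t \<in> {a..b}" for t
      using incr[of a t] that norm_triangle_ineq2[of "\<zeta> t - \<eta> t" "\<zeta> a - \<eta> a"] by (simp add: dist_norm)
  qed (use ab in simp)
  have 2: "?u a \<le> ?u b * exp (L * (b - a))"
  proof (rule gronwall_backward[OF u L(1)])
    show "?u t \<le> ?u b + L * integral {t..b} ?u" if "t \<in> {a..b}" for t
      using incr[of t b] that norm_triangle_ineq2[of "\<zeta> t - \<eta> t" "\<zeta> b - \<eta> b"]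
      by (simp add: dist_norm norm_minus_commute)
  qed (use ab in simp)
  have e: "exp (L * (b - a)) \<le> exp L" using ab L(1) by (simp add: mult_left_le)
  show "?u b \<le> exp L * ?u a"
    using 1 mult_left_mono[OF e zero_le_dist[of "\<zeta> a" "\<eta> a"]] by (simp add: mult.commute)
  show "?u a \<le> exp L * ?u b"
    using 2 mult_left_mono[OF e zero_le_dist[of "\<zeta> b" "\<eta> b"]] by (simp add: mult.commute)
qed

text \<open>Write \<open>c n\<close> along its curve as b minus the difference of the two fields.
  The integral of the difference is bounded by the L1 distance, that of b converges by dominated
  convergence; no regularity of b beyond continuity in space enters.\<close>

lemma lift_curve_limit:
  assumes \<omega>: "nonlipschitz_osgood \<omega>" and b: "b \<in> L1per_fields \<omega>" and c: "\<And>n. c n \<in> L1per_fields \<omega>"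
    and conv: "(\<lambda>n. enn2real (L1_norm \<omega> (\<lambda>t x. b t x - c n t x))) \<longlonglongrightarrow> 0"
    and \<eta>: "\<And>n. lift_curve (c n) z (\<eta> n)" and lim: "\<And>t. t \<in> {0..1} \<Longrightarrow> (\<lambda>n. \<eta> n t) \<longlonglongrightarrow> \<zeta> t"
  shows "lift_curve b z \<zeta>"
proof -
  have cont: "continuous_on {0..1} (\<lambda>s. torus_proj (\<eta> n s))" for n
    by (rule continuous_on_proj_comp[OF lift_curve_continuous[OF \<eta>]])
  have limp: "(\<lambda>n. torus_proj (\<eta> n t)) \<longlonglongrightarrow> torus_proj (\<zeta> t)" if "t \<in> {0..1}" for t
    by (rule continuous_on_tendsto_compose[OF continuous_on_torus_proj[of UNIV] lim[OF that]]) auto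
  note int = field_integral_tendsto[OF \<omega> b cont limp]
  have "\<zeta> t = z + integral {0..t} (\<lambda>s. b s (torus_proj (\<zeta> s)))" if t: "t \<in> {0..1}" for t
  proof (rule LIMSEQ_unique[OF lim[OF t]])
    let ?b = "\<lambda>n s. b s (torus_proj (\<eta> n s))" and ?c = "\<lambda>n s. c n s (torus_proj (\<eta> n s))"
    have "(\<lambda>n. integral {0..t} (\<lambda>s. ?b n s - ?c n s)) \<longlonglongrightarrow> 0"
      by (rule Lim_null_comparison[OF _ conv])
        (intro always_eventually allI integral_field_diff_bound[OF \<omega> b c cont t])
    then have "(\<lambda>n. z + (integral {0..t} (?b n) - integral {0..t} (\<lambda>s. ?b n s - ?c n s)))
      \<longlonglongrightarrow> z + (integral {0..t} (\<lambda>s. b s (torus_proj (\<zeta> s))) - 0)"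
      by (intro tendsto_intros int(2)[OF _ t]) auto
    moreover have "z + (integral {0..t} (?b n) - integral {0..t} (\<lambda>s. ?b n s - ?c n s)) = \<eta> n t" for n
    proof -
      have "?b n absolutely_integrable_on {0..1}" by (rule field_along_abs_integrable[OF \<omega> b cont])
      then have "?b n integrable_on {0..t}" "?c n integrable_on {0..t}"
        using t lift_curve_integrable[OF \<eta>] integrable_on_subinterval[of "?b n" "{0..1}" 0 t]
        by (auto simp: absolutely_integrable_on_def)
      then show ?thesis using \<eta>[of n] t
        by (simp add: Henstock_Kurzweil_Integration.integral_diff lift_curve_def)
    qed
    ultimately show "(\<lambda>n. \<eta> n t) \<longlonglongrightarrow> z + integral {0..t} (\<lambda>s. b s (torus_proj (\<zeta> s)))" by simp
  qed
  then show ?thesis using int(1) by (simp add: lift_curve_def)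
qed

text \<open>Picard iteration; the weight \<open>exp (2 * L * t)\<close> makes every step contract by the factor one half.\<close>

lemma lift_curve_exists:
  assumes \<omega>: "nonlipschitz_osgood \<omega>" and c: "c \<in> L1per_fields \<omega>"
    and L: "L > 0" "\<And>t. t \<in> {0..1} \<Longrightarrow> lift_lipschitz L (c t)"
  shows "\<exists>\<zeta>. lift_curve c z \<zeta>"
proof -
  define p where "p = rec_nat (\<lambda>t. z) (\<lambda>n \<zeta> t. z + integral {0..t} (\<lambda>s. c s (torus_proj (\<zeta> s))))"
  have p: "p 0 t = z" "p (Suc n) t = z + integral {0..t} (\<lambda>s. c s (torus_proj (p n s)))" for n t
    by (simp_all add: p_def)
  have cont: "continuous_on {0..1} (p n)" for n
  proof (induction n)
    case 0
    have "p 0 = (\<lambda>t. z)" by (rule ext) (rule p)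
    then show ?case by simp
  next
    case (Suc n)
    have "(\<lambda>s. c s (torus_proj (p n s))) absolutely_integrable_on {0..1}"
      by (rule field_along_abs_integrable[OF \<omega> c continuous_on_proj_comp[OF Suc]])
    then have "continuous_on {0..1} (\<lambda>t. z + integral {0..t} (\<lambda>s. c s (torus_proj (p n s))))"
      by (intro continuous_intros indefinite_integral_continuous_1) (simp add: absolutely_integrable_on_def)
    moreover have "p (Suc n) = (\<lambda>t. z + integral {0..t} (\<lambda>s. c s (torus_proj (p n s))))"
      by (rule ext) (rule p)
    ultimately show ?case by simp
  qed
  have int: "(\<lambda>s. c s (torus_proj (p n s))) integrable_on {0..t}" if "t \<in> {0..1}" for n t
  proof -
    have "(\<lambda>s. c s (torus_proj (p n s))) absolutely_integrable_on {0..1}"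
      by (rule field_along_abs_integrable[OF \<omega> c continuous_on_proj_comp[OF cont]])
    then show ?thesis using that integrable_on_subinterval[of _ "{0..1}" 0 t]
      by (auto simp: absolutely_integrable_on_def)
  qed
  define D where "D = enn2real (L1_norm \<omega> (\<lambda>t x. c t x - 0))"
  have D: "D \<ge> 0" by (simp add: D_def)
  have step: "norm (p (Suc n) t - p n t) \<le> D * (1 / 2) ^ n * exp (2 * L * t)" if "t \<in> {0..1}" for n t
    using that
  proof (induction n arbitrary: t)
    case 0
    have "norm (p (Suc 0) t - p 0 t) \<le> D"
      using integral_field_diff_bound[OF \<omega> c zero_in_L1per_fields continuous_on_proj_comp[OF cont[of 0]] 0]
      by (simp add: p D_def)
    also have "D \<le> D * exp (2 * L * t)" using D L 0 by (simp add: mult_le_cancel_left1)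
    finally show ?case by simp
  next
    case (Suc n)
    let ?E = "D * (1 / 2) ^ n"
    have "p (Suc (Suc n)) t - p (Suc n) t
      = integral {0..t} (\<lambda>s. c s (torus_proj (p (Suc n) s)) - c s (torus_proj (p n s)))"
      unfolding p(2)[of _ t] using int[OF Suc.prems]
      by (simp add: Henstock_Kurzweil_Integration.integral_diff)
    also have "norm \<dots> \<le> integral {0..t} (\<lambda>s. L * ?E * exp (2 * L * s))"
    proof (rule integral_norm_bound_integral)
      show "(\<lambda>s. c s (torus_proj (p (Suc n) s)) - c s (torus_proj (p n s))) integrable_on {0..t}"
        by (intro integrable_diff int Suc.prems)
      show "(\<lambda>s. L * ?E * exp (2 * L * s)) integrable_on {0..t}"
        by (intro integrable_continuous_real continuous_intros)
      show "norm (c s (torus_proj (p (Suc n) s)) - c s (torus_proj (p n s))) \<le> L * ?E * exp (2 * L * s)"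
        if "s \<in> {0..t}" for s
      proof -
        have s: "s \<in> {0..1}" using that Suc.prems by auto
        have "norm (c s (torus_proj (p (Suc n) s)) - c s (torus_proj (p n s))) \<le> L * norm (p (Suc n) s - p n s)"
          using L(2)[OF s] by (simp add: lift_lipschitz_def dist_norm)
        also have "\<dots> \<le> L * (?E * exp (2 * L * s))" using Suc.IH[OF s] L by (intro mult_left_mono) simp_all
        finally show ?thesis by (simp add: mult.assoc)
      qed
    qed
    also have "\<dots> = ?E / 2 * exp (2 * L * t) - ?E / 2 * exp (2 * L * 0)"
    proof (rule integral_unique, rule fundamental_theorem_of_calculus)
      show "((\<lambda>s. ?E / 2 * exp (2 * L * s)) has_vector_derivative L * ?E * exp (2 * L * s)) (at s within {0..t})" for s
        by (auto intro!: derivative_eq_intros simp flip: has_real_derivative_iff_has_vector_derivative)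
    qed (use Suc.prems in simp)
    also have "\<dots> \<le> D * (1 / 2) ^ Suc n * exp (2 * L * t)" using D by simp
    finally show ?case .
  qed
  have "\<exists>l. (\<lambda>n. p n t) \<longlonglongrightarrow> l" if t: "t \<in> {0..1}" for t
  proof -
    have "summable (\<lambda>n. D * (1 / 2) ^ n * exp (2 * L * t))"
      by (intro summable_mult summable_mult2 summable_geometric) simp
    then have "summable (\<lambda>n. p (Suc n) t - p n t)"
      by (rule summable_comparison_test'[where N = 0]) (use step[OF t] in simp)
    then have "convergent (\<lambda>n. \<Sum>i<n. p (Suc i) t - p i t)" by (simp add: summable_iff_convergent)
    then obtain l where "(\<lambda>n. p n t - p 0 t) \<longlonglongrightarrow> l" 
      unfolding convergent_def by (subst (asm) sum_lessThan_telescope[where f = "\<lambda>i. p i t"]) blast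
    then have "(\<lambda>n. p n t - p 0 t + p 0 t) \<longlonglongrightarrow> l + p 0 t" by (intro tendsto_intros)
    then show ?thesis by auto
  qed
  then obtain \<zeta> where lim: "\<And>t. t \<in> {0..1} \<Longrightarrow> (\<lambda>n. p n t) \<longlonglongrightarrow> \<zeta> t" by metis
  have limp: "(\<lambda>n. torus_proj (p n t)) \<longlonglongrightarrow> torus_proj (\<zeta> t)" if "t \<in> {0..1}" for t
    by (rule continuous_on_tendsto_compose[OF continuous_on_torus_proj[of UNIV] lim[OF that]]) auto
  note ft = field_integral_tendsto[OF \<omega> c continuous_on_proj_comp[OF cont] limp]
  have "\<zeta> t = z + integral {0..t} (\<lambda>s. c s (torus_proj (\<zeta> s)))" if t: "t \<in> {0..1}" for t
  proof (rule LIMSEQ_unique)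
    show "(\<lambda>n. p (Suc n) t) \<longlonglongrightarrow> \<zeta> t" by (rule LIMSEQ_Suc[OF lim[OF t]])
    show "(\<lambda>n. p (Suc n) t) \<longlonglongrightarrow> z + integral {0..t} (\<lambda>s. c s (torus_proj (\<zeta> s)))"
      unfolding p by (intro tendsto_intros ft(2)[OF _ t]) auto
  qed
  then show ?thesis using ft(1) by (auto simp: lift_curve_def)
qed

section \<open>The flow of a periodic field\<close>

lemma abs_integrable_shift:
  fixes g :: "real \<Rightarrow> real^2"
  assumes "g absolutely_integrable_on {0..r}"
  shows "(\<lambda>s. g (s - c)) absolutely_integrable_on {c..c + r}"
    "integral {c..c + r} (\<lambda>s. g (s - c)) = integral {0..r} g"
proof -
  have shift: "(h has_integral I) {0..r} \<longleftrightarrow> ((\<lambda>s. h (s - c)) has_integral I) {c..c + r}"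
    for h :: "real \<Rightarrow> 'b::real_normed_vector" and I
    using has_integral_shift_Icc_real[of "\<lambda>s. h (s - c)" c I 0 r] by (simp add: comp_def add.commute)
  then show "(\<lambda>s. g (s - c)) absolutely_integrable_on {c..c + r}"
    using assms shift[of g] shift[of "\<lambda>s. norm (g s)"]
    unfolding absolutely_integrable_on_def integrable_on_def by simp
  show "integral {c..c + r} (\<lambda>s. g (s - c)) = integral {0..r} g"
    using assms shift[of g] by (metis absolutely_integrable_on_def has_integral_integral integral_unique)
qed

lemma torus_proj_add: "torus_proj x = torus_proj y \<Longrightarrow> torus_proj (x + v) = torus_proj (y + v)"
  by (simp add: torus_proj_eq_iff torus_rel_def)

text \<open>By periodicity, curves on the unit time interval concatenate to curves on \<open>[0,\<infinity>)\<close>.\<close>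

lemma integral_curve_exists:
  assumes per: "\<forall>t\<ge>0. b (t + 1) = b t" and ex: "\<And>z. \<exists>\<zeta>. lift_curve b z \<zeta>"
  shows "\<exists>\<gamma>. integral_curve b (torus_proj z) \<gamma>"
proof -
  obtain Z where Z: "\<And>z. lift_curve b z (Z z)" using ex by metis
  \<comment> \<open>P n is the position at time n, from which the next unit-time curve
    starts.\<close>
  define P where "P n = ((\<lambda>z. Z z 1) ^^ n) z" for n
  define \<zeta> where "\<zeta> t = Z (P (nat \<lfloor>t\<rfloor>)) (frac t)" for t
  let ?G = "\<lambda>s. b s (torus_proj (\<zeta> s))"
  have step: "?G absolutely_integrable_on {real n..real n + r} \<and>
      integral {real n..real n + r} ?G = Z (P n) r - P n" if r: "r \<in> {0..1}" for n r
  proof -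
    let ?g = "\<lambda>s. b s (torus_proj (Z (P n) s))"
    have "?g absolutely_integrable_on {0..1}" using Z[of "P n"] unfolding lift_curve_def by blast
    then have g: "?g absolutely_integrable_on {0..r}"
      by (rule absolutely_integrable_on_subinterval) (use r in auto)
    \<comment> \<open>At s = n + 1, which occurs for r = 1, the floor already selects the next
      piece; this single point is negligible.\<close>
    have eq: "?G s = ?g (s - real n)" if "s \<in> {real n..real n + r} - {real n + 1}" for s
    proof -
      have "\<lfloor>s\<rfloor> = int n" using that r by (simp add: floor_eq_iff)
      then have "\<zeta> s = Z (P n) (s - real n)" by (simp add: \<zeta>_def frac_def)
      moreover have "b s = b (s - real n)"
      proof -
        have "s - real n \<ge> 0" using that by simp
        then have "b (s - real n + real n) = b (s - real n)" by (rule periodic_nat[OF per])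
        then show ?thesis by (simp only: diff_add_cancel)
      qed
      ultimately show ?thesis by simp
    qed
    have "?G absolutely_integrable_on {real n..real n + r}"
      by (rule absolutely_integrable_spike[OF abs_integrable_shift(1)[OF g], of "{real n + 1}"])
        (use eq in auto)
    moreover have "integral {real n..real n + r} ?G = integral {0..r} ?g"
      unfolding abs_integrable_shift(2)[OF g, of "real n", symmetric]
      by (rule integral_spike[of "{real n + 1}"]) (use eq in auto)
    moreover have "integral {0..r} ?g = Z (P n) r - P n"
      using Z[of "P n"] r unfolding lift_curve_def by (metis add_diff_cancel_left')
    ultimately show ?thesis by simp
  qed
  have PSuc: "Z (P n) 1 = P (Suc n)" for n by (simp add: P_def)
  have whole: "?G absolutely_integrable_on {0..real n} \<and> integral {0..real n} ?G = P n - z" for n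
  proof (induction n)
    case 0
    show ?case using step[of 0 0] by (simp add: P_def)
  next
    case (Suc n)
    have ai: "?G absolutely_integrable_on {0..real n + 1}"
      using absolutely_integrable_on_combine[where f = ?G and a = 0 and c = "real n" and b = "real n + 1"] Suc step[of 1 n] by simp
    have "integral {0..real n} ?G + integral {real n..real n + 1} ?G = integral {0..real n + 1} ?G"
      using ai by (intro Henstock_Kurzweil_Integration.integral_combine) (auto simp: absolutely_integrable_on_def)
    then show ?case using ai Suc step[of 1 n] PSuc[of n] by (simp add: add.commute)
  qed
  have main: "?G absolutely_integrable_on {0..t} \<and> \<zeta> t = z + integral {0..t} ?G" if t: "t \<ge> 0" for t
  proof -
    define n where "n = nat \<lfloor>t\<rfloor>"
    have n: "t = real n + frac t" using t by (simp add: n_def frac_def)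
    have f: "frac t \<in> {0..1}" using frac_lt_1[of t] by (simp add: less_imp_le)
    have nt: "real n \<le> t" using n frac_ge_0[of t] by linarith
    have ai: "?G absolutely_integrable_on {0..t}"
      using absolutely_integrable_on_combine[where f = ?G and a = 0 and c = "real n" and b = t] whole[of n] step[OF f, of n] n nt by simp
    have "integral {0..real n} ?G + integral {real n..t} ?G = integral {0..t} ?G"
      using ai nt by (intro Henstock_Kurzweil_Integration.integral_combine) (auto simp: absolutely_integrable_on_def)
    moreover have "integral {real n..t} ?G = Z (P n) (frac t) - P n"
      using step[OF f, of n] n by simp
    moreover have "\<zeta> t = Z (P n) (frac t)" by (simp add: \<zeta>_def n_def)
    ultimately have "\<zeta> t = z + integral {0..t} ?G" using whole[of n] by (simp add: algebra_simps)
    then show ?thesis using ai by simp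
  qed
  have "integral_curve b (torus_proj z) (\<lambda>t. torus_proj (\<zeta> t))"
    unfolding integral_curve_def
  proof (intro allI impI conjI)
    fix t :: real and z' assume t: "t \<ge> 0" and z': "torus_proj z' = torus_proj z"
    show "torus_proj (\<zeta> t) = torus_proj (z' + integral {0..t} ?G)"
      using main[OF t] torus_proj_add[OF z'] by metis
  qed (use main in blast)
  then show ?thesis by blast
qed

text \<open>The equation itself provides the lift: add the accumulated displacement to z.\<close>

lemma integral_curve_lift:
  assumes "integral_curve b (torus_proj z) \<gamma>"
  shows "\<exists>\<zeta>. lift_curve b z \<zeta> \<and> (\<forall>t\<ge>0. torus_proj (\<zeta> t) = \<gamma> t)"
proof -
  define \<zeta> where "\<zeta> t = z + integral {0..t} (\<lambda>s. b s (\<gamma> s))" for t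
  have proj: "torus_proj (\<zeta> t) = \<gamma> t" if "t \<ge> 0" for t
    using assms that by (simp add: integral_curve_def \<zeta>_def)
  have "(\<lambda>s. b s (\<gamma> s)) absolutely_integrable_on {0..1}"
    using assms by (simp add: integral_curve_def)
  then have "(\<lambda>s. b s (torus_proj (\<zeta> s))) absolutely_integrable_on {0..1}"
    by (rule absolutely_integrable_spike[of _ _ "{}"]) (simp_all add: proj)
  moreover have "\<zeta> t = z + integral {0..t} (\<lambda>s. b s (torus_proj (\<zeta> s)))" if "t \<in> {0..1}" for t
  proof -
    have "integral {0..t} (\<lambda>s. b s (torus_proj (\<zeta> s))) = integral {0..t} (\<lambda>s. b s (\<gamma> s))"
      by (rule Henstock_Kurzweil_Integration.integral_cong) (simp add: proj)
    then show ?thesis by (simp add: \<zeta>_def)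
  qed
  ultimately show ?thesis using proj by (auto simp: lift_curve_def)
qed

text \<open>The description in \<open>flow\<close> ranges over endpoints, so uniqueness of the
  endpoint at time 1 is enough.\<close>

lemma flow_1_eq:
  assumes per: "\<forall>t\<ge>0. b (t + 1) = b t" and ex: "\<And>z. \<exists>\<zeta>. lift_curve b z \<zeta>"
    and unique: "\<And>\<zeta> \<eta>. lift_curve b z \<zeta> \<Longrightarrow> lift_curve b z \<eta> \<Longrightarrow> \<zeta> 1 = \<eta> 1"
    and \<zeta>: "lift_curve b z \<zeta>"
  shows "flow b 1 (torus_proj z) = torus_proj (\<zeta> 1)"
proof -
  have eq: "\<gamma> 1 = torus_proj (\<zeta> 1)" if "integral_curve b (torus_proj z) \<gamma>" for \<gamma>
    using integral_curve_lift[OF that] unique[OF \<zeta>] by (metis zero_le_one)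
  obtain \<gamma> where \<gamma>: "integral_curve b (torus_proj z) \<gamma>" using integral_curve_exists[OF per ex] by blast
  show ?thesis unfolding flow_def using eq \<gamma> by (intro the_equality) metis+
qed

text \<open>Another lift of the same point differs by at least 2 in some coordinate, so it cannot be
  nearer to x than a lift at distance at most 1.\<close>

lemma dist_torus_proj_eq:
  assumes "dist x y \<le> 1"
  shows "dist (torus_proj x) (torus_proj y) = dist x y"
proof (rule antisym[OF dist_torus_le], rule ccontr)
  assume "\<not> dist x y \<le> dist (torus_proj x) (torus_proj y)"
  then have "dist (torus_proj x) (torus_proj y) < dist x y" by simp
  then obtain y' where y': "torus_proj y' = torus_proj y" "dist x y' < dist x y"
    by (rule dist_torus_approx)
  then have "y' \<noteq> y" by auto
  then obtain i where i: "y' $ i \<noteq> y $ i" by (auto simp: vec_eq_iff)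
  obtain k :: int where k: "y' $ i - y $ i = 2 * of_int k"
    using y'(1) by (auto simp: torus_proj_eq_iff torus_rel_def)
  with i have "k \<noteq> 0" by auto
  then have "\<bar>k\<bar> \<ge> 1" by simp
  then have "\<bar>y' $ i - y $ i\<bar> \<ge> 2" unfolding k by (simp add: abs_mult flip: of_int_abs)
  then have "dist y' y \<ge> 2" using dist_vec_nth_le[of y' i y] by (simp add: dist_real_def)
  then show False using y'(2) assms dist_triangle3[of y' y x] by linarith
qed

section \<open>Smooth fields on the torus\<close>

text \<open>Pairs at distance below 1 are translated by periods until x lies in [-1, 1]^2; both
  points are then in the convex box B, where the derivative is bounded. For the remaining pairs
  boundedness of f suffices.\<close>

lemma smooth_torus_bounded_lipschitz:
  assumes f: "smooth_torus f"
  shows "\<exists>L>0. lift_lipschitz L f"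
proof -
  define g where "g = f \<circ> torus_proj"
  define B where "B = (cbox (\<chi> i. -3) (\<chi> i. 3) :: (real^2) set)"
  have "Ck (Suc 0) g" using f by (simp only: smooth_torus_def g_def)
  then have diff: "\<And>x. g differentiable (at x)"
    and cd: "\<And>v. continuous_on UNIV (\<lambda>x. frechet_derivative g (at x) v)" by auto
  have deriv: "(g has_derivative frechet_derivative g (at x)) (at x)" for x
    using diff frechet_derivative_works by blast
  have B: "compact B" "convex B" by (simp_all add: B_def)
  have "\<exists>M. \<forall>x\<in>B. norm (frechet_derivative g (at x) v) \<le> M" for v
  proof -
    have "compact ((\<lambda>x. frechet_derivative g (at x) v) ` B)"
      by (rule compact_continuous_image[OF continuous_on_subset[OF cd] B(1)]) simp
    then show ?thesis by (meson bounded_iff compact_imp_bounded imageI)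
  qed
  then obtain M where M: "\<And>v x. x \<in> B \<Longrightarrow> norm (frechet_derivative g (at x) v) \<le> M v" by metis
  define C where "C = M (axis 1 1) + M (axis 2 1)"
  \<comment> \<open>\<open>Ck\<close> gives continuity of the derivative in each fixed direction
    only; by linearity the two coordinate directions control the operator norm.\<close>
  have on: "onorm (frechet_derivative g (at x)) \<le> C" if x: "x \<in> B" for x
  proof (rule onorm_le)
    fix v :: "real^2"
    interpret D: bounded_linear "frechet_derivative g (at x)" by (rule has_derivative_bounded_linear[OF deriv])
    have "v = v $ 1 *\<^sub>R axis 1 1 + v $ 2 *\<^sub>R axis 2 1"
      by (simp add: vec_eq_iff forall_2 axis_def)
    then have "frechet_derivative g (at x) v
      = v $ 1 *\<^sub>R frechet_derivative g (at x) (axis 1 1) + v $ 2 *\<^sub>R frechet_derivative g (at x) (axis 2 1)"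
      by (metis D.add D.scale)
    then have "norm (frechet_derivative g (at x) v)
      \<le> \<bar>v $ 1\<bar> * norm (frechet_derivative g (at x) (axis 1 1)) + \<bar>v $ 2\<bar> * norm (frechet_derivative g (at x) (axis 2 1))"
      by (metis norm_scaleR norm_triangle_ineq)
    also have "\<dots> \<le> norm v * M (axis 1 1) + norm v * M (axis 2 1)"
      by (intro add_mono mult_mono component_le_norm_cart M[OF x]) simp_all
    finally show "norm (frechet_derivative g (at x) v) \<le> C * norm v" by (simp add: C_def algebra_simps)
  qed
  have lipB: "norm (g x - g y) \<le> C * norm (x - y)" if "x \<in> B" "y \<in> B" for x y
    by (rule differentiable_bound[OF B(2) _ on that]) (rule has_derivative_at_withinI[OF deriv])
  have "compact (g ` B)"
    by (rule compact_continuous_image[OF _ B(1)])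
      (meson diff continuous_at_imp_continuous_on differentiable_imp_continuous_within)
  then obtain M0 where M0: "\<And>x. x \<in> B \<Longrightarrow> norm (g x) \<le> M0" by (meson bounded_iff compact_imp_bounded imageI)
  define L where "L = \<bar>C\<bar> + 2 * \<bar>M0\<bar> + 1"
  have shift: "\<exists>w. torus_proj (x + w) = torus_proj x \<and> torus_proj (y + w) = torus_proj y \<and>
    (\<forall>i. -1 \<le> (x + w) $ i \<and> (x + w) $ i \<le> 1)" for x y :: "real^2"
  proof -
    define w :: "real^2" where "w = (\<chi> i. - 2 * of_int \<lfloor>(x $ i + 1) / 2\<rfloor>)"
    have "torus_rel (z + w) z" for z
      unfolding torus_rel_def w_def by (auto intro: exI[of _ "- \<lfloor>(x $ i + 1) / 2\<rfloor>" for i])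
    moreover have "-1 \<le> (x + w) $ i \<and> (x + w) $ i \<le> 1" for i
      using floor_correct[of "(x $ i + 1) / 2"] unfolding w_def by (simp add: field_simps)
    ultimately show ?thesis by (metis torus_proj_eq_iff)
  qed
  have "norm (f (torus_proj x) - f (torus_proj y)) \<le> L * dist x y" for x y
  proof (cases "dist x y \<ge> 1")
    case True
    have bd: "norm (f (torus_proj z)) \<le> M0" for z
    proof -
      obtain w where w: "torus_proj (z + w) = torus_proj z" "\<And>i. -1 \<le> (z + w) $ i \<and> (z + w) $ i \<le> 1"
        using shift[of z z] by blast
      have "-3 \<le> (z + w) $ i \<and> (z + w) $ i \<le> 3" for i using w(2)[of i] by linarith
      then have "z + w \<in> B" by (simp add: B_def mem_box_cart)
      then show ?thesis using M0[of "z + w"] w(1) by (simp add: g_def)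
    qed
    have "norm (f (torus_proj x) - f (torus_proj y)) \<le> 2 * \<bar>M0\<bar> * 1"
      using bd[of x] bd[of y] norm_triangle_ineq4[of "f (torus_proj x)" "f (torus_proj y)"] by linarith
    also have "\<dots> \<le> L * dist x y" unfolding L_def using True by (intro mult_mono) auto
    finally show ?thesis .
  next
    case False
    obtain w where w: "torus_proj (x + w) = torus_proj x" "torus_proj (y + w) = torus_proj y"
      "\<And>i. -1 \<le> (x + w) $ i \<and> (x + w) $ i \<le> 1" using shift[of x y] by blast
    have "-3 \<le> (x + w) $ i \<and> (x + w) $ i \<le> 3" for i using w(3)[of i] by linarith
    moreover have "-3 \<le> (y + w) $ i \<and> (y + w) $ i \<le> 3" for i
      using w(3)[of i] dist_vec_nth_le[of x i y] False by (simp add: dist_real_def abs_le_iff)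
    ultimately have "x + w \<in> B" "y + w \<in> B" by (simp_all add: B_def mem_box_cart)
    then have "norm (f (torus_proj x) - f (torus_proj y)) \<le> C * dist x y"
      using lipB[of "x + w" "y + w"] w by (simp add: g_def dist_norm)
    also have "\<dots> \<le> L * dist x y" unfolding L_def by (intro mult_right_mono) auto
    finally show ?thesis .
  qed
  moreover have "L > 0" by (simp add: L_def add_nonneg_pos)
  ultimately show ?thesis unfolding lift_lipschitz_def by blast
qed

lemma lift_lipschitz_dist:
  assumes L: "L \<ge> 0" "lift_lipschitz L f"
  shows "norm (f p - f q) \<le> L * dist p q"
proof (rule field_le_epsilon)
  fix e :: real assume e: "e > 0"
  obtain x where x: "torus_proj x = p" using torus_proj_surj by blast
  have "dist (torus_proj x) q < dist p q + e / (L + 1)" using x e L by simp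
  then obtain y where y: "torus_proj y = q" "dist x y < dist p q + e / (L + 1)" by (rule dist_torus_approx)
  have "norm (f p - f q) \<le> L * dist x y" using L x y unfolding lift_lipschitz_def by metis
  also have "\<dots> \<le> L * (dist p q + e / (L + 1))" using y L by (intro mult_left_mono) simp_all
  also have "\<dots> \<le> L * dist p q + e" using e L by (simp add: field_simps)
  finally show "norm (f p - f q) \<le> L * dist p q + e" .
qed

section \<open>Sine shear fields and their \<omega>-norm\<close>

lemma Ck_sin: "Ck k (\<lambda>x::real^2. sin (c * x $ i + d) *\<^sub>R (v :: real^2))"
proof (induction k arbitrary: d v)
  case 0
  then show ?case by (simp, intro continuous_intros)
next
  case (Suc k)
  \<comment> \<open>The derivative is written as a sine with phase advanced by pi / 2, so that it
    has the same form again and the induction closes for general d and v.\<close>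
  have D: "((\<lambda>x::real^2. sin (c * x $ i + d) *\<^sub>R v) has_derivative
      (\<lambda>h. sin (c * x $ i + (d + pi / 2)) *\<^sub>R ((c * h $ i) *\<^sub>R v))) (at x)" for x d v
  proof -
    have "sin (c * x $ i + (d + pi / 2)) = cos (c * x $ i + d)"
      by (simp add: sin_add flip: add.assoc)
    then show ?thesis
      by (auto intro!: derivative_eq_intros bounded_linear.has_derivative[OF bounded_linear_vec_nth]
          simp: algebra_simps)
  qed
  have fr: "frechet_derivative (\<lambda>x::real^2. sin (c * x $ i + d) *\<^sub>R v) (at x) h
      = sin (c * x $ i + (d + pi / 2)) *\<^sub>R ((c * h $ i) *\<^sub>R v)" for x h
    using frechet_derivative_at[OF D[of d v x]] by metis
  show ?case unfolding Ck.simps(2) fr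
  proof (intro conjI allI)
    show "(\<lambda>x::real^2. sin (c * x $ i + d) *\<^sub>R v) differentiable (at x)" for x
      using D[of d v x] unfolding differentiable_def by blast
  qed (rule Suc)
qed

text \<open>The representative is arbitrary; since k is an integer and the torus has period 2, the
  sine does not depend on it. This restricts the half wavelength to the values 1 / k.\<close>

definition shear_field :: "2 \<Rightarrow> 2 \<Rightarrow> real \<Rightarrow> nat \<Rightarrow> torus \<Rightarrow> real^2" where
  "shear_field i j a k q = (a * sin (pi * real k * rep_torus q $ j)) *\<^sub>R axis i 1"

lemma shear_field_proj: "shear_field i j a k (torus_proj x) = (a * sin (pi * real k * x $ j)) *\<^sub>R axis i 1"
proof -
  have "torus_proj (rep_torus (torus_proj x)) = torus_proj x"
    using Quotient_abs_rep[OF Quotient_torus] by blast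
  then obtain m :: int where m: "rep_torus (torus_proj x) $ j - x $ j = 2 * of_int m"
    by (auto simp: torus_proj_eq_iff torus_rel_def)
  have "pi * real k * rep_torus (torus_proj x) $ j = pi * real k * x $ j + 2 * pi * of_int (int k * m)"
    using m by (simp add: algebra_simps)
  then have "sin (pi * real k * rep_torus (torus_proj x) $ j) = sin (pi * real k * x $ j)"
    by (simp only: sin_add sin_int_2pin cos_int_2pin)
  then show ?thesis by (simp add: shear_field_def)
qed

lemma smooth_shear_field: "smooth_torus (shear_field i j a k)"
proof -
  have "shear_field i j a k \<circ> torus_proj
    = (\<lambda>x. sin ((pi * real k) * x $ j + 0) *\<^sub>R (a *\<^sub>R axis i 1))"
    by (rule ext) (simp add: shear_field_proj mult.commute)
  then show ?thesis unfolding smooth_torus_def using Ck_sin by metis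
qed

lemma abs_sin_diff_le: "\<bar>sin x - sin y\<bar> \<le> \<bar>x - y :: real\<bar>"
proof -
  have "norm (sin x - sin y) \<le> 1 * norm (x - y)"
    by (rule field_differentiable_bound[of UNIV sin cos]) (auto intro!: derivative_eq_intros)
  then show ?thesis by simp
qed

lemma lift_lipschitz_shear_field:
  assumes "a \<ge> 0"
  shows "lift_lipschitz (a * (pi * real k)) (shear_field i j a k)"
  unfolding lift_lipschitz_def
proof (intro allI)
  fix x y :: "real^2"
  have "norm (shear_field i j a k (torus_proj x) - shear_field i j a k (torus_proj y))
    = a * \<bar>sin (pi * real k * x $ j) - sin (pi * real k * y $ j)\<bar>"
    using assms by (simp add: shear_field_proj norm_axis_1 abs_mult
        flip: scaleR_diff_left right_diff_distrib)
  also have "\<dots> \<le> a * \<bar>pi * real k * x $ j - pi * real k * y $ j\<bar>"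
    by (intro mult_left_mono abs_sin_diff_le assms)
  also have "\<dots> = a * (pi * real k) * \<bar>x $ j - y $ j\<bar>"
    by (simp add: abs_mult flip: right_diff_distrib)
  also have "\<dots> \<le> a * (pi * real k) * dist x y"
    using assms dist_vec_nth_le[of x j y] by (intro mult_left_mono) (simp_all add: dist_real_def)
  finally show "norm (shear_field i j a k (torus_proj x) - shear_field i j a k (torus_proj y)) \<le> \<dots>" .
qed

text \<open>Let \<delta> = 1 / k. Up to distance \<delta> the Lipschitz bound is used, and concavity
  gives d / \<omega> d \<le> \<delta> / \<omega> \<delta>; beyond \<delta> the oscillation is at
  most 2 * a \<le> pi * a, and \<omega> is monotone. Both cases lead to the same constant.\<close>

lemma omega_norm_shear_field:
  assumes \<omega>: "nonlipschitz_osgood \<omega>" and a: "a \<ge> 0" and k: "k \<ge> 1"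
  shows "omega_norm \<omega> (shear_field i j a k) \<le> ennreal (a * (1 + pi / \<omega> (1 / real k)))"
proof -
  have mono: "mono_on {0..} \<omega>" and conc: "concave_on {0..} \<omega>" and \<omega>0: "\<omega> 0 = 0"
    and pos: "\<And>s. s > 0 \<Longrightarrow> \<omega> s > 0"
    using \<omega> by (auto simp: nonlipschitz_osgood_def)
  have sup: "norm (shear_field i j a k q) \<le> a" for q
    using a mult_left_mono[OF abs_sin_le_one, of a] by (simp add: shear_field_def norm_axis_1 abs_mult)
  have "C0_norm (shear_field i j a k) \<le> ennreal a"
    unfolding C0_norm_def using sup by (intro SUP_least ennreal_leI) simp
  moreover have "omega_seminorm \<omega> (shear_field i j a k) \<le> ennreal (a * (pi / \<omega> (1 / real k)))"
    unfolding omega_seminorm_def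
  proof (intro SUP_least, clarify, rule ennreal_leI)
    fix p q :: torus assume pq: "p \<noteq> q"
    define d where "d = dist p q"
    define \<delta> where "\<delta> = 1 / real k"
    have d: "d > 0" "\<delta> > 0" using pq k by (simp_all add: d_def \<delta>_def)
    have "norm (shear_field i j a k p - shear_field i j a k q) \<le> a * pi / \<omega> \<delta> * \<omega> d"
    proof (cases "d \<le> \<delta>")
      case True
      have "d / \<delta> * \<omega> \<delta> \<le> \<omega> d"
        using concave_onD[OF conc, of "d / \<delta>" 0 \<delta>] d True \<omega>0 by simp
      then have "d / \<delta> \<le> \<omega> d / \<omega> \<delta>" using pos[OF d(2)] by (simp add: field_simps)
      then have "a * pi * (d / \<delta>) \<le> a * pi * (\<omega> d / \<omega> \<delta>)" using a by (intro mult_left_mono) simp_all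
      moreover have "norm (shear_field i j a k p - shear_field i j a k q) \<le> a * (pi * real k) * d"
        unfolding d_def using a by (intro lift_lipschitz_dist lift_lipschitz_shear_field) simp_all
      ultimately show ?thesis by (simp add: \<delta>_def mult_ac)
    next
      case False
      have "norm (shear_field i j a k p - shear_field i j a k q) \<le> a * 2"
        using sup[of p] sup[of q] norm_triangle_ineq4[of "shear_field i j a k p" "shear_field i j a k q"] by linarith
      also have "\<dots> \<le> a * pi" using a pi_ge_two by (intro mult_left_mono) simp_all
      also have "\<dots> = a * pi * 1" by simp
      also have "\<dots> \<le> a * pi * (\<omega> d / \<omega> \<delta>)"
        using False d a pos[OF d(2)] mono_onD[OF mono, of \<delta> d] by (intro mult_left_mono) simp_all
      finally show ?thesis by simp
    qed
    then show "norm (shear_field i j a k p - shear_field i j a k q) / \<omega> (dist p q) \<le> a * (pi / \<omega> (1 / real k))"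
      using pos[OF d(1)] by (simp add: d_def \<delta>_def pos_divide_le_eq)
  qed
  ultimately have "omega_norm \<omega> (shear_field i j a k) \<le> ennreal a + ennreal (a * (pi / \<omega> (1 / real k)))"
    unfolding omega_norm_def by (rule add_mono)
  also have "\<dots> = ennreal (a * (1 + pi / \<omega> (1 / real k)))"
    using a pos[of "1 / real k"] k by (simp add: distrib_left flip: ennreal_plus)
  finally show ?thesis .
qed

lemma smooth_in_c_omega:
  assumes "smooth_torus f" "omega_norm \<omega> f < \<infinity>"
  shows "f \<in> c_omega \<omega>"
  unfolding c_omega_def C_omega_def
  using assms by (auto intro!: exI[of _ f] simp: omega_norm_zero)

section \<open>Density of simple fields\<close>

text \<open>Finitely many values in time make the bounds of single smooth fields uniform: their sum
  over the range serves. Periodicity is left out and imposed later by composition with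
  \<open>frac\<close>.\<close>

definition smooth_simple_field :: "(real \<Rightarrow> real) \<Rightarrow> velocity \<Rightarrow> bool" where
  "smooth_simple_field \<omega> c \<longleftrightarrow> simple_function (lebesgue_on {0..}) c \<and>
     (\<forall>t\<ge>0. smooth_torus (c t) \<and> omega_norm \<omega> (c t) < \<infinity>)"

lemma simple_strongly_measurable:
  assumes "simple_function (lebesgue_on {0..}) c" "\<And>t. t \<ge> 0 \<Longrightarrow> c t \<in> c_omega \<omega>"
  shows "strongly_measurable \<omega> c"
  unfolding strongly_measurable_def using assms by (intro exI[of _ "\<lambda>n. c"]) (simp add: omega_norm_zero)

lemma smooth_simple_field_strongly_measurable:
  "smooth_simple_field \<omega> c \<Longrightarrow> strongly_measurable \<omega> c"
  unfolding smooth_simple_field_def by (intro simple_strongly_measurable) (auto intro: smooth_in_c_omega)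

lemma smooth_simple_field_finite_range: "smooth_simple_field \<omega> c \<Longrightarrow> finite (c ` {0..})"
  by (simp add: smooth_simple_field_def simple_function_def)

lemma smooth_simple_field_lipschitz:
  assumes c: "smooth_simple_field \<omega> c"
  shows "\<exists>L>0. \<forall>t\<ge>0. lift_lipschitz L (c t)"
proof -
  have "\<forall>f\<in>c ` {0..}. \<exists>L>0. lift_lipschitz L f"
    using c by (auto simp: smooth_simple_field_def intro: smooth_torus_bounded_lipschitz)
  then obtain \<Lambda> where \<Lambda>: "\<And>f. f \<in> c ` {0..} \<Longrightarrow> \<Lambda> f > 0 \<and> lift_lipschitz (\<Lambda> f) f" by metis
  note fin = smooth_simple_field_finite_range[OF c]
  define L where "L = (\<Sum>f\<in>c ` {0..}. \<Lambda> f)"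
  have le: "\<Lambda> f \<le> L" if "f \<in> c ` {0..}" for f
    unfolding L_def using \<Lambda> fin that by (intro member_le_sum) (auto intro: less_imp_le)
  have "lift_lipschitz L (c t)" if "t \<ge> 0" for t
  proof -
    have f: "c t \<in> c ` {0..}" using that by simp
    show ?thesis unfolding lift_lipschitz_def
    proof (intro allI)
      fix x y
      have "norm (c t (torus_proj x) - c t (torus_proj y)) \<le> \<Lambda> (c t) * dist x y"
        using \<Lambda>[OF f] by (simp add: lift_lipschitz_def)
      also have "\<dots> \<le> L * dist x y" using le[OF f] by (intro mult_right_mono) simp_all
      finally show "norm (c t (torus_proj x) - c t (torus_proj y)) \<le> L * dist x y" .
    qed
  qed
  moreover have "L > 0" using \<Lambda>[of "c 0"] le[of "c 0"] by fastforce
  ultimately show ?thesis by blast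
qed

lemma smooth_simple_field_bounded:
  assumes c: "smooth_simple_field \<omega> c"
  shows "\<exists>M\<ge>0. \<forall>t\<ge>0. omega_norm \<omega> (c t) \<le> ennreal M"
proof -
  note fin = smooth_simple_field_finite_range[OF c]
  define M where "M = (\<Sum>f\<in>c ` {0..}. enn2real (omega_norm \<omega> f))"
  have "omega_norm \<omega> (c t) \<le> ennreal M" if "t \<ge> 0" for t
  proof -
    have "enn2real (omega_norm \<omega> (c t)) \<le> M"
      unfolding M_def using fin that by (intro member_le_sum) auto
    moreover have "omega_norm \<omega> (c t) < \<infinity>" using c that by (simp add: smooth_simple_field_def)
    ultimately show ?thesis by (metis ennreal_enn2real ennreal_leI infinity_ennreal_def)
  qed
  moreover have "M \<ge> 0" by (simp add: M_def sum_nonneg)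
  ultimately show ?thesis by blast
qed

lemma smooth_simple_field_L1per:
  assumes c: "smooth_simple_field \<omega> c" and per: "\<forall>t\<ge>0. c (t + 1) = c t"
  shows "c \<in> L1per_fields \<omega>"
proof -
  obtain M where M: "\<And>t. t \<ge> 0 \<Longrightarrow> omega_norm \<omega> (c t) \<le> ennreal M"
    using smooth_simple_field_bounded[OF c] by blast
  have "L1_norm \<omega> c \<le> (\<integral>\<^sup>+t. ennreal M \<partial>lebesgue_on {0..1::real})"
    unfolding L1_norm_def using M by (intro nn_integral_mono) simp
  also have "\<dots> = ennreal M" by (simp add: emeasure_restrict_space)
  finally have "L1_norm \<omega> c < \<infinity>" by (auto simp: less_top[symmetric] top_unique)
  then show ?thesis using c per smooth_simple_field_strongly_measurable[OF c]
    by (auto simp: L1per_fields_def smooth_simple_field_def intro: smooth_in_c_omega)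
qed

lemma frac_vimage_lebesgue:
  fixes A :: "real set"
  assumes A: "A \<in> sets lebesgue" "A \<subseteq> {0..<1}"
  shows "{t. 0 \<le> t \<and> frac t \<in> A} \<in> sets lebesgue"
proof -
  have "{t. 0 \<le> t \<and> frac t \<in> A} = (\<Union>n::nat. (+) (real n) ` A)"
  proof (intro set_eqI iffI)
    fix t assume "t \<in> {t. 0 \<le> t \<and> frac t \<in> A}"
    then show "t \<in> (\<Union>n::nat. (+) (real n) ` A)"
      by (intro UN_I[of "nat \<lfloor>t\<rfloor>"] image_eqI[of _ _ "frac t"]) (auto simp: frac_def)
  next
    fix t assume "t \<in> (\<Union>n::nat. (+) (real n) ` A)"
    then obtain n :: nat and r where r: "r \<in> A" "t = real n + r" by blast
    moreover have "0 \<le> r" "r < 1" using r A(2) by auto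
    moreover have "frac t = r" using calculation by (simp add: frac_unique_iff)
    ultimately show "t \<in> {t. 0 \<le> t \<and> frac t \<in> A}" by simp
  qed
  then show ?thesis using A(1) by (auto intro!: sets.countable_UN lebesgue_sets_translation)
qed

text \<open>Makes a field periodic within the simple ones: preimages under \<open>frac\<close> are
  countable unions of integer translates.\<close>

lemma simple_function_frac:
  fixes s :: "real \<Rightarrow> 'a"
  assumes s: "simple_function (lebesgue_on {0..}) s"
  shows "simple_function (lebesgue_on {0..}) (\<lambda>t. s (frac t))"
proof -
  have sp: "space (lebesgue_on {0..}) = {0::real..}" by simp
  have fin: "finite (s ` {0..})" and sets: "\<And>f. f \<in> s ` {0..} \<Longrightarrow> s -` {f} \<inter> {0..} \<in> sets (lebesgue_on {0..})"
    using s unfolding simple_function_def sp by auto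
  have sub: "(\<lambda>t. s (frac t)) ` {0..} \<subseteq> s ` {0..}" by auto
  have "(\<lambda>t. s (frac t)) -` {f} \<inter> {0..} \<in> sets (lebesgue_on {0..})" if f: "f \<in> s ` {0..}" for f
  proof -
    have "s -` {f} \<inter> {0..} \<in> sets lebesgue" using sets[OF f] by (simp add: sets_restrict_space_iff)
    then have "(s -` {f} \<inter> {0..}) \<inter> {0..<1} \<in> sets lebesgue" by (rule sets.Int) simp
    from frac_vimage_lebesgue[OF this]
    have "{t. 0 \<le> t \<and> frac t \<in> (s -` {f} \<inter> {0..}) \<inter> {0..<1}} \<in> sets lebesgue" by simp
    moreover have "(\<lambda>t. s (frac t)) -` {f} \<inter> {0..} = {t. 0 \<le> t \<and> frac t \<in> (s -` {f} \<inter> {0..}) \<inter> {0..<1}}"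
      by (auto simp: frac_lt_1)
    ultimately show ?thesis by (auto simp: sets_restrict_space_iff)
  qed
  then show ?thesis unfolding simple_function_def sp using sub fin by (meson finite_subset subsetD)
qed

lemma smooth_simple_field_frac:
  "smooth_simple_field \<omega> c \<Longrightarrow> smooth_simple_field \<omega> (\<lambda>t. c (frac t))"
  by (simp add: smooth_simple_field_def simple_function_frac)

text \<open>The definition of \<open>c_omega\<close> does not state that the approximating smooth
  field has finite norm; the triangle inequality adds this.\<close>

lemma smooth_approximation:
  assumes f: "f \<in> c_omega \<omega>" and e: "e > 0"
  shows "\<exists>g. smooth_torus g \<and> omega_norm \<omega> g < \<infinity> \<and> omega_norm \<omega> (\<lambda>x. f x - g x) < ennreal e"
proof -
  obtain g where g: "smooth_torus g" "omega_norm \<omega> (\<lambda>x. f x - g x) < ennreal e"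
    using f e by (auto simp: c_omega_def)
  have "omega_norm \<omega> (\<lambda>x. g x - 0) \<le> omega_norm \<omega> (\<lambda>x. g x - f x) + omega_norm \<omega> (\<lambda>x. f x - 0)"
    by (rule omega_norm_triangle)
  also have "\<dots> < \<infinity>"
    using f g(2) by (auto simp: omega_norm_minus_commute[of \<omega> g f] c_omega_def C_omega_def less_top[symmetric] top_unique)
  finally show ?thesis using g by auto
qed

text \<open>Strong measurability gives convergence for a.e. t but no majorant. Replacing
  \<open>s n t\<close> by zero where its norm exceeds 2 * m t keeps it simple and bounds the error
  by 3 * m t. Where m t > 0 the truncation is eventually inactive; where m t = 0 the bound makes the
  error vanish.\<close>

lemma simple_function_dense:
  assumes b: "b \<in> L1per_fields \<omega>" and e: "e > 0"
  shows "\<exists>s. simple_function (lebesgue_on {0..}) s \<and> (\<forall>t\<ge>0. s t \<in> c_omega \<omega>) \<and>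
    L1_norm \<omega> (\<lambda>t x. b t x - s t x) < e"
proof -
  let ?L = "lebesgue_on {0..1::real}"
  let ?N = "\<lambda>f g. omega_norm \<omega> (\<lambda>x. f x - g x)"
  have bm: "strongly_measurable \<omega> b" using b by (simp add: L1per_fields_def)
  obtain s where s: "\<And>n. simple_function (lebesgue_on {0..}) (s n)" "\<And>n t. t \<ge> 0 \<Longrightarrow> s n t \<in> c_omega \<omega>"
    and lim: "AE t in lebesgue_on {0..}. (\<lambda>n. ?N (b t) (s n t)) \<longlonglongrightarrow> 0"
    using bm unfolding strongly_measurable_def by blast
  obtain m where m: "m \<in> borel_measurable ?L" "AE t in ?L. ?N (b t) (\<lambda>x. 0) = m t"
    using omega_norm_diff_measurable[OF bm strongly_measurable_zero] by blast
  define A where "A n = {t \<in> space ?L. ?N (s n t) (\<lambda>x. 0) \<le> 2 * m t}" for n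
  have A: "A n \<in> sets ?L" for n
  proof -
    have "(\<lambda>t. ?N (s n t) (\<lambda>x. 0)) \<in> borel_measurable (lebesgue_on {0..})"
      by (rule borel_measurable_simple_function, rule simple_function_compose1[OF s(1)])
    then have "(\<lambda>t. ?N (s n t) (\<lambda>x. 0)) \<in> borel_measurable ?L"
      by (rule measurable_restrict_mono) simp
    then show ?thesis unfolding A_def using m(1) by measurable
  qed
  define s' where "s' n t = (if t \<in> A n then s n t else (\<lambda>x. 0))" for n t
  have "{t \<in> space (lebesgue_on {0..}). t \<in> A n} = A n" for n by (auto simp: A_def)
  then have A': "{t \<in> space (lebesgue_on {0..}). t \<in> A n} \<in> sets (lebesgue_on {0..})" for n
    using A[of n] by (simp add: sets_restrict_space_iff subset_iff)
  then have s'1: "simple_function (lebesgue_on {0..}) (s' n)" for n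
    unfolding s'_def[abs_def]
    by (intro simple_function_If s(1) simple_function_const A')
  have s'2: "s' n t \<in> c_omega \<omega>" if "t \<ge> 0" for n t
    using s(2)[OF that] by (simp add: s'_def zero_in_c_omega)
  have "\<exists>k. k \<in> borel_measurable ?L \<and> (AE t in ?L. ?N (b t) (s' n t) = k t)" for n
    by (rule omega_norm_diff_measurable[OF bm simple_strongly_measurable[OF s'1 s'2]])
  then have "\<exists>k. \<forall>n. k n \<in> borel_measurable ?L \<and> (AE t in ?L. ?N (b t) (s' n t) = k n t)"
    by (intro choice allI)
  then obtain k where k: "\<And>n. k n \<in> borel_measurable ?L" "\<And>n. AE t in ?L. ?N (b t) (s' n t) = k n t"
    by blast
  have kall: "AE t in ?L. \<forall>n. ?N (b t) (s' n t) = k n t" using k(2) by (simp add: AE_all_countable)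
  have bound: "AE t in ?L. k n t \<le> 3 * m t" for n
    using m(2) k(2)[of n]
  proof eventually_elim
    case (elim t)
    have "?N (b t) (s' n t) \<le> ?N (b t) (\<lambda>x. 0) + ?N (\<lambda>x. 0) (s' n t)" by (rule omega_norm_triangle)
    also have "?N (\<lambda>x. 0) (s' n t) = ?N (s' n t) (\<lambda>x. 0)" by (rule omega_norm_minus_commute)
    also have "\<dots> \<le> 2 * m t" by (simp add: s'_def A_def omega_norm_zero)
    finally have "?N (b t) (s' n t) \<le> ?N (b t) (\<lambda>x. 0) + 2 * m t" by (simp add: add_left_mono)
    also have "\<dots> = (1 + 2) * m t"
      unfolding elim(1) distrib_right by simp
    finally show ?case using elim(2) by simp
  qed
  have fin: "(\<integral>\<^sup>+t. m t \<partial>?L) < \<infinity>"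
  proof -
    have "(\<integral>\<^sup>+t. m t \<partial>?L) = L1_norm \<omega> b"
      unfolding L1_norm_def using m(2) by (intro nn_integral_cong_AE) (auto elim: eventually_mono)
    then show ?thesis using b by (simp add: L1per_fields_def)
  qed
  have "AE t in ?L. \<forall>n. k n t \<le> 3 * m t" using bound by (simp add: AE_all_countable)
  then have "AE t in ?L. (\<lambda>n. k n t) \<longlonglongrightarrow> 0"
    using m(2) kall AE_unit_interval[OF lim] AE_space[of ?L]
  proof eventually_elim
    case (elim t)
    show ?case
    proof (cases "m t = 0")
      case True
      then show ?thesis using elim(1) by simp
    next
      case False
      then have "\<forall>\<^sub>F n in sequentially. ?N (b t) (s n t) < m t"
        using elim(4) by (intro order_tendstoD(2)) (auto simp: zero_less_iff_neq_zero)
      then have "\<forall>\<^sub>F n in sequentially. ?N (b t) (s n t) = k n t"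
      proof eventually_elim
        case (elim n)
        have "?N (s n t) (\<lambda>x. 0) \<le> ?N (s n t) (b t) + ?N (b t) (\<lambda>x. 0)" by (rule omega_norm_triangle)
        also have "\<dots> \<le> m t + m t"
          using elim \<open>?N (b t) (\<lambda>x. 0) = m t\<close>
          by (intro add_mono) (auto simp: omega_norm_minus_commute[of \<omega> "s n t" "b t"])
        finally have "t \<in> A n" using \<open>t \<in> space ?L\<close> by (simp add: A_def mult_2)
        then have "s' n t = s n t" by (simp add: s'_def)
        then show ?case using \<open>\<forall>n. ?N (b t) (s' n t) = k n t\<close> by metis
      qed
      then show ?thesis by (rule Lim_transform_eventually[OF elim(4)])
    qed
  qed
  then have "(\<lambda>n. \<integral>\<^sup>+t. k n t \<partial>?L) \<longlonglongrightarrow> (\<integral>\<^sup>+t. 0 \<partial>?L)"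
    using fin k(1) m(1) bound
    by (intro nn_integral_dominated_convergence[where w = "\<lambda>t. 3 * m t"]) (auto simp: nn_integral_cmult ennreal_mult_less_top)
  then have "\<forall>\<^sub>F n in sequentially. (\<integral>\<^sup>+t. k n t \<partial>?L) < e"
    using e by (intro order_tendstoD(2)) simp_all
  then obtain n where n: "(\<integral>\<^sup>+t. k n t \<partial>?L) < e" by (auto simp: eventually_sequentially)
  have "L1_norm \<omega> (\<lambda>t x. b t x - s' n t x) = (\<integral>\<^sup>+t. k n t \<partial>?L)"
    unfolding L1_norm_def by (rule nn_integral_cong_AE[OF k(2)])
  then show ?thesis using n s'1 s'2 by (intro exI[of _ "s' n"]) simp
qed

section \<open>Fields starting with two shears\<close>

text \<open>The self-reproducing family consists of the projections of all tall paths, with a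
  vertical segment as a first member. The pieces stay within distance 1 of each other, so the
  projection preserves their distances.\<close>

lemma (in shear_composition) htop_ge:
  assumes N: "N \<ge> 1" and small: "K * (R + 2 * a1 + 2 * a2 + 2 * \<delta>) + 2 * \<delta> \<le> 1"
    and T: "\<And>x. T (torus_proj x) = torus_proj (F x)"
  shows "htop T \<ge> ereal (ln (real N))"
proof -
  define \<K> where "\<K> = {torus_proj ` g ` {u..v} | g u v. tall_path \<delta> R g u v}"
  show ?thesis
  proof (rule htop_ge_horseshoe[where K = \<K> and \<rho> = "2 * \<delta>"])
    fix A assume "A \<in> \<K>"
    then obtain g u v where A: "A = torus_proj ` g ` {u..v}" and g: "tall_path \<delta> R g u v"
      unfolding \<K>_def mem_Collect_eq by (elim exE conjE)
    obtain U V where UV: "\<forall>i<N. {U i..V i} \<subseteq> {u..v} \<and> tall_path \<delta> R (F \<circ> g) (U i) (V i)"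
      and apart: "\<forall>i<N. \<forall>j<N. i \<noteq> j \<longrightarrow> (\<forall>s\<in>{U i..V i}. \<forall>t\<in>{U j..V j}.
        2 * \<delta> \<le> dist (F (g s)) (F (g t)) \<and>
        dist (F (g s)) (F (g t)) \<le> K * (R + 2 * a1 + 2 * a2 + 2 * \<delta>) + 2 * \<delta>)"
      using stretching[OF g] by (elim exE conjE)
    define B where "B i = torus_proj ` g ` {U i..V i}" for i
    have "T ` B i = torus_proj ` (F \<circ> g) ` {U i..V i}" for i
      by (simp add: B_def image_image T)
    then have "T ` B i \<in> \<K>" if "i < N" for i
      using UV that unfolding \<K>_def by blast
    moreover have "B i \<subseteq> A" if "i < N" for i using UV that unfolding A B_def by (intro image_mono) simp
    moreover have "2 * \<delta> \<le> dist (T x) (T y)"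
      if ij: "i < N" "j < N" "i \<noteq> j" and xy: "x \<in> B i" "y \<in> B j" for i j x y
    proof -
      obtain s t where st: "s \<in> {U i..V i}" "t \<in> {U j..V j}" "x = torus_proj (g s)" "y = torus_proj (g t)"
        using xy by (auto simp: B_def)
      have d: "2 * \<delta> \<le> dist (F (g s)) (F (g t))"
        "dist (F (g s)) (F (g t)) \<le> K * (R + 2 * a1 + 2 * a2 + 2 * \<delta>) + 2 * \<delta>"
        using apart ij st(1,2) by simp_all
      then have "dist (F (g s)) (F (g t)) \<le> 1" using small by linarith
      then have "dist (T x) (T y) = dist (F (g s)) (F (g t))"
        by (simp add: st T dist_torus_proj_eq)
      then show ?thesis using d by simp
    qed
    ultimately show "\<exists>B. (\<forall>i<N. B i \<subseteq> A \<and> T ` B i \<in> \<K>) \<and>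
        (\<forall>i<N. \<forall>j<N. i \<noteq> j \<longrightarrow> (\<forall>x\<in>B i. \<forall>y\<in>B j. 2 * \<delta> \<le> dist (T x) (T y)))"
      by (intro exI[of _ B]) blast
  next
    show "{} \<notin> \<K>" by (auto simp: \<K>_def tall_path_def)
    have "tall_path \<delta> R (\<lambda>t. t *\<^sub>R axis 2 1) 0 (2 * \<delta>)"
      unfolding tall_path_def
    proof (intro conjI)
      show "continuous_on {0..2 * \<delta>} (\<lambda>t. t *\<^sub>R axis 2 1 :: real^2)" by (intro continuous_intros)
      show "\<exists>s\<in>{0..2 * \<delta>}. \<exists>t\<in>{0..2 * \<delta>}.
          (s *\<^sub>R axis 2 1 :: real^2) $ 2 + 2 * \<delta> \<le> (t *\<^sub>R axis 2 1 :: real^2) $ 2"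
        by (rule bexI[of _ 0], rule bexI[of _ "2 * \<delta>"]) (use \<delta> in \<open>simp_all add: axis_def\<close>)
      show "\<forall>s\<in>{0..2 * \<delta>}. \<forall>t\<in>{0..2 * \<delta>}.
          \<bar>(s *\<^sub>R axis 2 1 :: real^2) $ 1 - (t *\<^sub>R axis 2 1 :: real^2) $ 1\<bar> \<le> R"
        using constants by (simp add: axis_def)
    qed
    then show "\<K> \<noteq> {}" unfolding \<K>_def by blast
  qed (use \<delta> N compact_torus in auto)
qed

lemma AE_frac_unit: "AE t in lebesgue_on {0..1::real}. frac t = t"
proof -
  have "AE t in lebesgue. t \<noteq> (1::real)" by (rule AE_completion[OF AE_lborel_singleton])
  then have "AE t in lebesgue. t \<in> {0..1::real} \<longrightarrow> frac t = t"
    by (rule eventually_mono) (auto simp: frac_eq)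
  then show ?thesis by (subst AE_restrict_space_iff) simp_all
qed

lemma smooth_simple_dense:
  assumes b: "b \<in> L1per_fields \<omega>" and e: "e > 0"
  shows "\<exists>c. smooth_simple_field \<omega> c \<and> L1_norm \<omega> (\<lambda>t x. b t x - c t x) < ennreal e"
proof -
  obtain s where s: "simple_function (lebesgue_on {0..}) s" "\<And>t. t \<ge> 0 \<Longrightarrow> s t \<in> c_omega \<omega>"
    "L1_norm \<omega> (\<lambda>t x. b t x - s t x) < ennreal (e / 3)"
    using simple_function_dense[OF b, of "ennreal (e / 3)"] e by auto
  \<comment> \<open>The smooth approximation is chosen for each value f and not for each time, so
    that the composition with s remains simple.\<close>
  have "\<exists>g. f \<in> c_omega \<omega> \<longrightarrow> smooth_torus g \<and> omega_norm \<omega> g < \<infinity> \<and> omega_norm \<omega> (\<lambda>x. f x - g x) < ennreal (e / 3)" for f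
    using smooth_approximation[of f \<omega> "e / 3"] e by auto
  then obtain G where G: "\<And>f. f \<in> c_omega \<omega> \<Longrightarrow> smooth_torus (G f)" "\<And>f. f \<in> c_omega \<omega> \<Longrightarrow> omega_norm \<omega> (G f) < \<infinity>"
    "\<And>f. f \<in> c_omega \<omega> \<Longrightarrow> omega_norm \<omega> (\<lambda>x. f x - G f x) < ennreal (e / 3)"
    by metis
  define c where "c t = G (s t)" for t
  have c: "smooth_simple_field \<omega> c"
    unfolding smooth_simple_field_def c_def[abs_def]
    using G s(2) by (auto intro!: simple_function_compose1[OF s(1)])
  have "L1_norm \<omega> (\<lambda>t x. s t x - c t x) \<le> (\<integral>\<^sup>+t. ennreal (e / 3) \<partial>lebesgue_on {0..1::real})"
    unfolding L1_norm_def c_def using G(3) s(2) by (intro nn_integral_mono) (auto intro: less_imp_le)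
  also have "\<dots> = ennreal (e / 3)" by (simp add: emeasure_restrict_space)
  finally have sc: "L1_norm \<omega> (\<lambda>t x. s t x - c t x) \<le> ennreal (e / 3)" .
  have "L1_norm \<omega> (\<lambda>t x. b t x - c t x) \<le> L1_norm \<omega> (\<lambda>t x. b t x - s t x) + L1_norm \<omega> (\<lambda>t x. s t x - c t x)"
    using b by (intro L1_norm_triangle smooth_simple_field_strongly_measurable[OF c]
        simple_strongly_measurable[OF s(1,2)]) (simp add: L1per_fields_def)
  also have "\<dots> \<le> ennreal (e / 3) + ennreal (e / 3)"
    by (rule add_mono[OF less_imp_le[OF s(3)] sc])
  also have "\<dots> < ennreal e" using e by (simp add: ennreal_less_iff flip: ennreal_plus)
  finally show ?thesis using c by blast
qed

definition prefix_field :: "real \<Rightarrow> (torus \<Rightarrow> real^2) \<Rightarrow> (torus \<Rightarrow> real^2) \<Rightarrow> velocity \<Rightarrow> velocity" where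
  "prefix_field \<tau> f g c t = (if frac t < \<tau> / 2 then f else if frac t < \<tau> then g else c (frac t))"

lemma smooth_simple_prefix_field:
  assumes c: "smooth_simple_field \<omega> c" and fg: "smooth_torus f" "smooth_torus g"
    "omega_norm \<omega> f < \<infinity>" "omega_norm \<omega> g < \<infinity>"
  shows "smooth_simple_field \<omega> (prefix_field \<tau> f g c)"
proof -
  have sets: "{t \<in> space (lebesgue_on {0..}). t < r} \<in> sets (lebesgue_on {0..})" for r :: real
  proof -
    have "{t \<in> space (lebesgue_on {0..}). t < r} = {0..<r}" by auto
    then show ?thesis by (simp add: sets_restrict_space_iff subset_iff)
  qed
  have "simple_function (lebesgue_on {0..}) (\<lambda>t. if t < \<tau> / 2 then f else if t < \<tau> then g else c t)"
    using c unfolding smooth_simple_field_def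
    by (intro simple_function_If sets simple_function_const) blast
  then have "smooth_simple_field \<omega> (\<lambda>t. if t < \<tau> / 2 then f else if t < \<tau> then g else c t)"
    using c fg unfolding smooth_simple_field_def by simp
  from smooth_simple_field_frac[OF this] show ?thesis by (simp add: prefix_field_def[abs_def])
qed

lemma prefix_field_periodic: "prefix_field \<tau> f g c (t + 1) = prefix_field \<tau> f g c t"
  by (simp add: prefix_field_def frac_1_eq)

lemma L1_norm_prefix_field:
  assumes \<tau>: "0 < \<tau>" "\<tau> \<le> 1"
    and c: "\<And>t. t \<ge> 0 \<Longrightarrow> omega_norm \<omega> (c t) \<le> ennreal M"
    and fg: "omega_norm \<omega> f \<le> ennreal B" "omega_norm \<omega> g \<le> ennreal B" and MB: "M \<ge> 0" "B \<ge> 0"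
  shows "L1_norm \<omega> (\<lambda>t x. c t x - prefix_field \<tau> f g c t x) \<le> ennreal (\<tau> * (M + B))"
proof -
  have diff: "omega_norm \<omega> (\<lambda>x. c t x - h x) \<le> ennreal (M + B)"
    if "t \<ge> 0" "omega_norm \<omega> h \<le> ennreal B" for t h
  proof -
    have "omega_norm \<omega> (\<lambda>x. c t x - h x) \<le> omega_norm \<omega> (\<lambda>x. c t x - 0) + omega_norm \<omega> (\<lambda>x. 0 - h x)"
      by (rule omega_norm_triangle)
    also have "omega_norm \<omega> (\<lambda>x. 0 - h x) = omega_norm \<omega> (\<lambda>x. h x - 0)" by (rule omega_norm_minus_commute)
    finally show ?thesis using c[OF that(1)] that(2) MB
      by (simp add: ennreal_plus) (meson add_mono order_trans)
  qed
  have "L1_norm \<omega> (\<lambda>t x. c t x - prefix_field \<tau> f g c t x)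
    \<le> (\<integral>\<^sup>+t. ennreal (M + B) * indicator {0..\<tau>} t \<partial>lebesgue_on {0..1})"
    unfolding L1_norm_def
  proof (rule nn_integral_mono_AE)
    show "AE t in lebesgue_on {0..1}. omega_norm \<omega> (\<lambda>x. c t x - prefix_field \<tau> f g c t x)
      \<le> ennreal (M + B) * indicator {0..\<tau>} t"
      using AE_frac_unit AE_space[of "lebesgue_on {0..1::real}"]
    proof eventually_elim
      case (elim t)
      then have "t \<ge> 0" by simp
      then show ?case
        using diff[of t f] diff[of t g] fg elim
        by (cases "t < \<tau>") (auto simp: prefix_field_def omega_norm_zero)
    qed
  qed
  also have "\<dots> = ennreal (M + B) * emeasure (lebesgue_on {0..1}) {0..\<tau>}"
    by (rule nn_integral_cmult_indicator) (use \<tau> in \<open>simp add: sets_restrict_space_iff\<close>)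
  also have "\<dots> = ennreal (M + B) * ennreal \<tau>"
    using \<tau> by (subst emeasure_restrict_space) simp_all
  also have "\<dots> = ennreal (\<tau> * (M + B))" using \<tau> MB by (simp add: ennreal_mult' mult.commute)
  finally show ?thesis .
qed

text \<open>A shear does not change the coordinate it depends on, so the velocity along the curve is
  constant. The final time is left out of the hypothesis because the field may switch there.\<close>

lemma lift_curve_shear_segment:
  assumes \<zeta>: "lift_curve c z \<zeta>" and st: "0 \<le> s" "s \<le> t" "t \<le> 1" and ij: "i \<noteq> j"
    and c: "\<And>r. s \<le> r \<Longrightarrow> r < t \<Longrightarrow> c r = shear_field i j a k"
  shows "\<zeta> t = \<zeta> s + ((t - s) * a * sin (pi * real k * \<zeta> s $ j)) *\<^sub>R axis i 1"
proof -
  let ?f = "\<lambda>r. c r (torus_proj (\<zeta> r))"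
  have f: "?f r = (a * sin (pi * real k * \<zeta> r $ j)) *\<^sub>R axis i 1" if "s \<le> r" "r < t" for r
    using c[OF that] by (simp add: shear_field_proj)
  have const: "\<zeta> r $ j = \<zeta> s $ j" if r: "s \<le> r" "r \<le> t" for r
  proof -
    have int: "?f integrable_on {s..r}" using r st by (intro lift_curve_integrable[OF \<zeta>]) auto
    have "integral {s..r} ?f $ j = integral {s..r} (\<lambda>q. ?f q $ j)"
      using integral_linear[OF int bounded_linear_vec_nth[of j]] by (simp add: comp_def)
    also have "\<dots> = integral {s..r} (\<lambda>q. 0)"
    proof (rule integral_spike[of "{t}"])
      fix q assume "q \<in> {s..r} - {t}"
      then have "s \<le> q" "q < t" using r by auto
      from f[OF this] show "0 = ?f q $ j" using ij by (simp add: axis_def)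
    qed simp
    finally show ?thesis using lift_curve_increment[OF \<zeta>, of s r] r st by simp
  qed
  have "integral {s..t} ?f = integral {s..t} (\<lambda>r. (a * sin (pi * real k * \<zeta> s $ j)) *\<^sub>R axis i 1)"
  proof (rule integral_spike[of "{t}"])
    fix q assume "q \<in> {s..t} - {t}"
    then have "s \<le> q" "q < t" by auto
    then show "(a * sin (pi * real k * \<zeta> s $ j)) *\<^sub>R axis i 1 = ?f q" using f const[of q] by simp
  qed simp
  then show ?thesis using lift_curve_increment[OF \<zeta> st] st by (simp add: mult.assoc)
qed

text \<open>A fixed point of the map sending p to y - X p + p is a preimage of y, and the bound on
  the displacement keeps this map inside a ball about y, where Brouwer's theorem applies.\<close>

lemma surj_bounded_displacement:
  fixes X :: "'a::euclidean_space \<Rightarrow> 'a"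
  assumes cont: "continuous_on UNIV X" and C: "\<And>p. dist (X p) p \<le> C"
  shows "surj X"
  unfolding surj_def
proof
  fix y :: 'a
  define e where "e = \<bar>C\<bar> + 1"
  have "cball y e \<noteq> {}" by (simp add: e_def)
  moreover have "continuous_on (cball y e) (\<lambda>p. y - X p + p)"
    by (intro continuous_intros continuous_on_subset[OF cont]) simp
  moreover have "(\<lambda>p. y - X p + p) \<in> cball y e \<rightarrow> cball y e"
  proof
    fix p
    have "dist y (y - X p + p) = dist (X p) p" by (simp add: dist_norm)
    then show "y - X p + p \<in> cball y e" using C[of p] by (simp add: e_def)
  qed
  ultimately obtain p where "y - X p + p = p" by (rule brouwer[OF compact_cball convex_cball])
  then have "X p = y" by simp
  then show "\<exists>p. y = X p" by blast
qed

lemma hshear_inverse: "hshear (- a) \<delta> (hshear a \<delta> x) = x" "hshear a \<delta> (hshear (- a) \<delta> x) = x"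
  by (simp_all add: vec_eq_iff forall_2)

lemma vshear_inverse: "vshear (- a) \<delta> (vshear a \<delta> x) = x" "vshear a \<delta> (vshear (- a) \<delta> x) = x"
  by (simp_all add: vec_eq_iff forall_2)

section \<open>Infinite entropy from nested balls\<close>

definition L1_distance :: "(real \<Rightarrow> real) \<Rightarrow> velocity \<Rightarrow> velocity \<Rightarrow> real" where
  "L1_distance \<omega> b c = enn2real (L1_norm \<omega> (\<lambda>t x. b t x - c t x))"

lemma L1_distance_triangle:
  assumes "a \<in> L1per_fields \<omega>" "b \<in> L1per_fields \<omega>" "c \<in> L1per_fields \<omega>"
  shows "L1_distance \<omega> a c \<le> L1_distance \<omega> a b + L1_distance \<omega> b c"
proof -
  have "L1_norm \<omega> (\<lambda>t x. a t x - c t x) \<le> L1_norm \<omega> (\<lambda>t x. a t x - b t x) + L1_norm \<omega> (\<lambda>t x. b t x - c t x)"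
    using assms by (intro L1_norm_triangle) (simp_all add: L1per_fields_def)
  moreover have "L1_norm \<omega> (\<lambda>t x. a t x - b t x) < top" "L1_norm \<omega> (\<lambda>t x. b t x - c t x) < top"
    using L1_norm_diff_finite[OF assms(1,2)] L1_norm_diff_finite[OF assms(2,3)] by simp_all
  ultimately show ?thesis unfolding L1_distance_def by (simp add: enn2real_mono flip: enn2real_plus)
qed

lemma L1_distance_commute: "L1_distance \<omega> a b = L1_distance \<omega> b a"
  unfolding L1_distance_def by (subst L1_norm_minus_commute) (rule refl)

lemma L1_distance_less:
  assumes "L1_norm \<omega> (\<lambda>t x. b t x - c t x) < ennreal e"
  shows "L1_distance \<omega> b c < e"
proof -
  have "0 < e" using assms by (cases "e > 0") (simp_all add: ennreal_neg)
  have "enn2real (L1_norm \<omega> (\<lambda>t x. b t x - c t x)) < enn2real (ennreal e)"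
    using assms by (subst enn2real_less_iff) (auto simp: less_top[symmetric] intro: le_less_trans)
  then show ?thesis using \<open>0 < e\<close> by (simp add: L1_distance_def)
qed

text \<open>A ball of radius \<open>r\<close> about \<open>c\<close> in which all curves stay so close to those of \<open>c\<close> that the
  stretching of the time-one map of \<open>c\<close> persists.\<close>

definition horseshoe_ball :: "(real \<Rightarrow> real) \<Rightarrow> nat \<Rightarrow> velocity \<Rightarrow> real \<Rightarrow> bool" where
  "horseshoe_ball \<omega> N c r \<longleftrightarrow> c \<in> L1per_fields \<omega> \<and> 0 < r \<and> r \<le> 1 / real N \<and>
     (\<forall>z. \<exists>\<zeta>. lift_curve c z \<zeta>) \<and>
     (\<exists>L. \<forall>z z' \<zeta> \<zeta>'. lift_curve c z \<zeta> \<longrightarrow> lift_curve c z' \<zeta>' \<longrightarrow> dist (\<zeta> 1) (\<zeta>' 1) \<le> L * dist z z') \<and>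
     (\<exists>\<eta>\<le>1 / real N.
        (\<forall>b\<in>L1per_fields \<omega>. L1_distance \<omega> b c < r \<longrightarrow>
           (\<forall>z \<zeta> \<zeta>'. lift_curve b z \<zeta> \<longrightarrow> lift_curve c z \<zeta>' \<longrightarrow> (\<forall>t\<in>{0..1}. dist (\<zeta> t) (\<zeta>' t) \<le> \<eta>))) \<and>
        (\<forall>F T. continuous_on UNIV F \<longrightarrow> (\<forall>z \<zeta>. lift_curve c z \<zeta> \<longrightarrow> dist (F z) (\<zeta> 1) \<le> \<eta>) \<longrightarrow>
           (\<forall>z. T (torus_proj z) = torus_proj (F z)) \<longrightarrow> htop T \<ge> ereal (ln (real N))))"

lemma horseshoe_ballD:
  assumes "horseshoe_ball \<omega> N c r"
  obtains L \<eta> where "c \<in> L1per_fields \<omega>" "0 < r" "r \<le> 1 / real N" "\<eta> \<le> 1 / real N"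
    "\<And>z. \<exists>\<zeta>. lift_curve c z \<zeta>"
    "\<And>z z' \<zeta> \<zeta>'. lift_curve c z \<zeta> \<Longrightarrow> lift_curve c z' \<zeta>' \<Longrightarrow> dist (\<zeta> 1) (\<zeta>' 1) \<le> L * dist z z'"
    "\<And>b z \<zeta> \<zeta>' t. b \<in> L1per_fields \<omega> \<Longrightarrow> L1_distance \<omega> b c < r \<Longrightarrow> lift_curve b z \<zeta> \<Longrightarrow> lift_curve c z \<zeta>' \<Longrightarrow>
      t \<in> {0..1} \<Longrightarrow> dist (\<zeta> t) (\<zeta>' t) \<le> \<eta>"
    "\<And>F T. continuous_on UNIV F \<Longrightarrow> (\<And>z \<zeta>. lift_curve c z \<zeta> \<Longrightarrow> dist (F z) (\<zeta> 1) \<le> \<eta>) \<Longrightarrow>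
      (\<And>z. T (torus_proj z) = torus_proj (F z)) \<Longrightarrow> htop T \<ge> ereal (ln (real N))"
proof -
  obtain L \<eta> where *: "c \<in> L1per_fields \<omega>" "0 < r" "r \<le> 1 / real N" "\<eta> \<le> 1 / real N"
    "\<forall>z. \<exists>\<zeta>. lift_curve c z \<zeta>"
    "\<forall>z z' \<zeta> \<zeta>'. lift_curve c z \<zeta> \<longrightarrow> lift_curve c z' \<zeta>' \<longrightarrow> dist (\<zeta> 1) (\<zeta>' 1) \<le> L * dist z z'"
    "\<forall>b\<in>L1per_fields \<omega>. L1_distance \<omega> b c < r \<longrightarrow>
       (\<forall>z \<zeta> \<zeta>'. lift_curve b z \<zeta> \<longrightarrow> lift_curve c z \<zeta>' \<longrightarrow> (\<forall>t\<in>{0..1}. dist (\<zeta> t) (\<zeta>' t) \<le> \<eta>))"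
    "\<forall>F T. continuous_on UNIV F \<longrightarrow> (\<forall>z \<zeta>. lift_curve c z \<zeta> \<longrightarrow> dist (F z) (\<zeta> 1) \<le> \<eta>) \<longrightarrow>
       (\<forall>z. T (torus_proj z) = torus_proj (F z)) \<longrightarrow> htop T \<ge> ereal (ln (real N))"
    using assms unfolding horseshoe_ball_def by (elim conjE exE)
  show thesis
    by (rule that[OF *(1-4)]) (use *(5-8) in blast)+
qed

lemma infinite_entropy:
  assumes \<omega>: "nonlipschitz_osgood \<omega>" and b: "b \<in> L1per_fields \<omega>"
    and ball: "\<And>n. horseshoe_ball \<omega> (Suc n) (c n) (r n)" and close: "\<And>n. L1_distance \<omega> b (c n) < r n"
  shows "htop (flow b 1) = \<infinity>"
proof -
  have c: "c n \<in> L1per_fields \<omega>" and r: "r n \<le> 1 / real (Suc n)" and ex: "\<exists>\<zeta>. lift_curve (c n) z \<zeta>" for n z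
    using ball[of n] by (simp_all add: horseshoe_ball_def)
  have near: "dist (\<zeta> t) (\<zeta>' t) \<le> 1 / real (Suc n)"
    if "a \<in> L1per_fields \<omega>" "L1_distance \<omega> a (c n) < r n" "lift_curve a z \<zeta>" "lift_curve (c n) z \<zeta>'" "t \<in> {0..1}"
    for n a z \<zeta> \<zeta>' t
    by (rule horseshoe_ballD[OF ball[of n]]) (use that in \<open>meson order_trans\<close>)
  have lim0: "(\<lambda>n. 1 / real (Suc n)) \<longlonglongrightarrow> 0" by (rule LIMSEQ_Suc[OF lim_1_over_n])
  have "\<bar>L1_distance \<omega> b (c n)\<bar> \<le> 1 / real (Suc n)" for n
    using close[of n] r[of n] by (simp add: L1_distance_def)
  then have conv: "(\<lambda>n. L1_distance \<omega> b (c n)) \<longlonglongrightarrow> 0"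
    by (intro Lim_null_comparison[OF _ lim0]) (simp add: always_eventually)
  have exb: "\<exists>\<zeta>. lift_curve b z \<zeta>" for z
  proof -
    have "\<exists>Z. \<forall>n. lift_curve (c n) z (Z n)" by (intro choice allI ex)
    then obtain Z where Z: "\<And>n. lift_curve (c n) z (Z n)" by blast
    have "\<exists>l. (\<lambda>n. Z n t) \<longlonglongrightarrow> l" if t: "t \<in> {0..1}" for t
    proof -
      have "Cauchy (\<lambda>n. Z n t)"
      proof (rule metric_CauchyI)
        fix e :: real assume "e > 0"
        then have "\<forall>\<^sub>F n in sequentially. 1 / real (Suc n) < e / 2"
          by (intro order_tendstoD(2)[OF lim0]) simp
        then obtain n where n: "1 / real (Suc n) < e / 2" by (auto simp: eventually_sequentially)
        have "\<forall>\<^sub>F m in sequentially. L1_distance \<omega> b (c m) < r n - L1_distance \<omega> b (c n)"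
          using close[of n] by (intro order_tendstoD(2)[OF conv]) simp
        then obtain m0 where m0: "\<And>m. m \<ge> m0 \<Longrightarrow> L1_distance \<omega> b (c m) < r n - L1_distance \<omega> b (c n)"
          by (auto simp: eventually_sequentially)
        have d: "dist (Z m t) (Z n t) < e / 2" if "m \<ge> m0" for m
        proof -
          \<comment> \<open>As b lies strictly inside the ball about \<open>c n\<close>, the later
            centres \<open>c m\<close>, which converge to b, lie in it as well; their curves are
            therefore close to that of \<open>c n\<close>, which gives the Cauchy property.\<close>
          have "L1_distance \<omega> (c m) (c n) < r n"
            using L1_distance_triangle[OF c b c, of m n] m0[OF that] L1_distance_commute[of \<omega> "c m" b] by simp
          then show ?thesis using near[OF c _ Z Z t, of m n] n by simp
        qed
        have "dist (Z m t) (Z m' t) < e" if "m \<ge> m0" "m' \<ge> m0" for m m'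
          using d[OF that(1)] d[OF that(2)] by (rule dist_triangle_half_l)
        then show "\<exists>M. \<forall>m\<ge>M. \<forall>n\<ge>M. dist (Z m t) (Z n t) < e" by blast
      qed
      then show ?thesis by (simp add: Cauchy_convergent_iff convergent_def)
    qed
    then obtain \<zeta> where \<zeta>: "\<And>t. t \<in> {0..1} \<Longrightarrow> (\<lambda>n. Z n t) \<longlonglongrightarrow> \<zeta> t" by metis
    have "lift_curve b z \<zeta>"
      by (rule lift_curve_limit[OF \<omega> b c conv[unfolded L1_distance_def] Z \<zeta>])
    then show ?thesis by blast
  qed
  then have "\<exists>Z. \<forall>z. lift_curve b z (Z z)" by (intro choice allI)
  then obtain Z where Z: "\<And>z. lift_curve b z (Z z)" by blast
  \<comment> \<open>Two curves of b from the same point both stay within 1 / Suc n of one and the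
    same curve of \<open>c n\<close>.\<close>
  have unique: "\<zeta> 1 = \<zeta>' 1" if \<zeta>: "lift_curve b z \<zeta>" "lift_curve b z \<zeta>'" for z \<zeta> \<zeta>'
  proof -
    have le: "dist (\<zeta> 1) (\<zeta>' 1) \<le> 2 * (1 / real (Suc n))" for n
    proof -
      obtain \<eta> where \<eta>: "lift_curve (c n) z \<eta>" using ex by blast
      have "dist (\<zeta> 1) (\<eta> 1) \<le> 1 / real (Suc n)" "dist (\<zeta>' 1) (\<eta> 1) \<le> 1 / real (Suc n)"
        using near[OF b close \<zeta>(1) \<eta>, of 1] near[OF b close \<zeta>(2) \<eta>, of 1] by simp_all
      then show ?thesis using dist_triangle2[of "\<zeta> 1" "\<zeta>' 1" "\<eta> 1"] by linarith
    qed
    have "(\<lambda>n. 2 * (1 / real (Suc n))) \<longlonglongrightarrow> 2 * 0" by (intro tendsto_intros lim0)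
    then have "dist (\<zeta> 1) (\<zeta>' 1) \<le> 2 * 0" by (rule LIMSEQ_le_const) (use le in blast)
    then show ?thesis by simp
  qed
  define F where "F z = Z z 1" for z
  \<comment> \<open>F is a uniform limit of the time-one maps of the fields \<open>c n\<close>, each
    of which is Lipschitz.\<close>
  have cont: "continuous_on UNIV F"
    unfolding continuous_on_iff
  proof (intro ballI allI impI)
    fix z :: "real^2" and e :: real assume e: "e > 0"
    then have "\<forall>\<^sub>F n in sequentially. 1 / real (Suc n) < e / 4"
      by (intro order_tendstoD(2)[OF lim0]) simp
    then obtain n where n: "1 / real (Suc n) < e / 4" by (auto simp: eventually_sequentially)
    obtain L where L: "\<And>z z' \<zeta> \<zeta>'. lift_curve (c n) z \<zeta> \<Longrightarrow> lift_curve (c n) z' \<zeta>' \<Longrightarrow> dist (\<zeta> 1) (\<zeta>' 1) \<le> L * dist z z'"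
      by (rule horseshoe_ballD[OF ball[of n]]) (rule that, blast)
    define l where "l = \<bar>L\<bar> + 1"
    have l: "l > 0" "L \<le> l" by (simp_all add: l_def)
    define d where "d = e / (4 * l)"
    have "dist (F z') (F z) < e" if z': "dist z' z < d" for z'
    proof -
      obtain \<zeta> \<zeta>' where \<zeta>: "lift_curve (c n) z \<zeta>" "lift_curve (c n) z' \<zeta>'" using ex by blast
      have 1: "dist (F z) (\<zeta> 1) \<le> 1 / real (Suc n)" "dist (F z') (\<zeta>' 1) \<le> 1 / real (Suc n)"
        unfolding F_def by (rule near[OF b close Z]; use \<zeta> in simp)+
      have "L * dist z' z \<le> l * d" using z' l by (intro mult_mono) auto
      also have "\<dots> = e / 4" using l by (simp add: d_def)
      finally have "dist (\<zeta>' 1) (\<zeta> 1) \<le> e / 4" using L[OF \<zeta>(2,1)] by linarith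
      then show ?thesis using 1 n dist_triangle[of "F z'" "F z" "\<zeta>' 1"] dist_triangle2[of "\<zeta>' 1" "F z" "\<zeta> 1"]
        e by linarith
    qed
    moreover have "d > 0" using e l by (simp add: d_def)
    ultimately show "\<exists>d>0. \<forall>z'\<in>UNIV. dist z' z < d \<longrightarrow> dist (F z') (F z) < e" by blast
  qed
  have per: "\<forall>t\<ge>0. b (t + 1) = b t" using b by (simp add: L1per_fields_def)
  have flow: "flow b 1 (torus_proj z) = torus_proj (F z)" for z
    unfolding F_def by (rule flow_1_eq[where \<zeta> = "Z z", OF per exb _ Z]) (rule unique)
  have "htop (flow b 1) \<ge> ereal (ln (real (Suc n)))" for n
  proof (rule horseshoe_ballD[OF ball[of n]])
    fix \<eta> :: real
    assume stab: "\<And>a z \<zeta> \<zeta>' t. a \<in> L1per_fields \<omega> \<Longrightarrow> L1_distance \<omega> a (c n) < r n \<Longrightarrow> lift_curve a z \<zeta> \<Longrightarrow>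
        lift_curve (c n) z \<zeta>' \<Longrightarrow> t \<in> {0..1} \<Longrightarrow> dist (\<zeta> t) (\<zeta>' t) \<le> \<eta>"
      and horse: "\<And>F T. continuous_on UNIV F \<Longrightarrow> (\<And>z \<zeta>. lift_curve (c n) z \<zeta> \<Longrightarrow> dist (F z) (\<zeta> 1) \<le> \<eta>) \<Longrightarrow>
        (\<And>z. T (torus_proj z) = torus_proj (F z)) \<Longrightarrow> htop T \<ge> ereal (ln (real (Suc n)))"
    show ?thesis
      by (rule horse[OF cont _ flow]) (unfold F_def, rule stab[OF b close Z], simp_all)
  qed
  moreover have "\<exists>n. B \<le> ln (real (Suc n))" for B :: real
  proof -
    obtain n :: nat where "exp B \<le> real n" using real_arch_simple by blast
    then have "exp B \<le> real (Suc n)" by simp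
    then have "B \<le> ln (real (Suc n))" by (subst ln_ge_iff) simp_all
    then show ?thesis by blast
  qed
  ultimately have "ereal B \<le> htop (flow b 1)" for B by (meson ereal_less_eq(3) order_trans)
  then show ?thesis by (rule ereal_top)
qed

section \<open>Density of fields with a stretching time-one map\<close>

text \<open>The factor 2 / \<tau> in the speed compensates for the duration \<tau> / 2 of each
  shear, so the displacement has amplitude exactly a1 or a2.\<close>

lemma prefix_shear_curve:
  assumes \<zeta>: "lift_curve (prefix_field \<tau> (shear_field 1 2 (2 / \<tau> * a1) k) (shear_field 2 1 (2 / \<tau> * a2) k) c) z \<zeta>"
    and \<tau>: "0 < \<tau>" "\<tau> \<le> 1"
  shows "\<zeta> \<tau> = vshear a2 (1 / real k) (hshear a1 (1 / real k) z)"
proof -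
  have frac: "frac r = r" if "0 \<le> r" "r < 1" for r :: real using that by (simp add: frac_eq)
  have "\<zeta> (\<tau> / 2) = \<zeta> 0 + ((\<tau> / 2 - 0) * (2 / \<tau> * a1) * sin (pi * real k * \<zeta> 0 $ 2)) *\<^sub>R axis 1 1"
    by (rule lift_curve_shear_segment[OF \<zeta>]) (use \<tau> in \<open>simp_all add: prefix_field_def frac\<close>)
  then have 1: "\<zeta> (\<tau> / 2) = hshear a1 (1 / real k) z"
    using \<tau> lift_curve_0[OF \<zeta>] by (simp add: hshear_def mult_ac)
  have "\<zeta> \<tau> = \<zeta> (\<tau> / 2) + ((\<tau> - \<tau> / 2) * (2 / \<tau> * a2) * sin (pi * real k * \<zeta> (\<tau> / 2) $ 1)) *\<^sub>R axis 2 1"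
    by (rule lift_curve_shear_segment[OF \<zeta>]) (use \<tau> in \<open>simp_all add: prefix_field_def frac\<close>)
  also have "(\<tau> - \<tau> / 2) * (2 / \<tau> * a2) = a2" using \<tau> by (simp add: field_simps)
  finally show ?thesis unfolding 1 vshear_def by (simp add: mult_ac)
qed

lemma lift_curve_displacement:
  assumes \<omega>: "nonlipschitz_osgood \<omega>" and c: "c \<in> L1per_fields \<omega>" and \<zeta>: "lift_curve c z \<zeta>" and t: "t \<in> {0..1}"
  shows "dist (\<zeta> t) z \<le> L1_distance \<omega> c (\<lambda>t x. 0)"
  using integral_field_diff_bound[OF \<omega> c zero_in_L1per_fields continuous_on_proj_comp[OF lift_curve_continuous[OF \<zeta>]] t]
    \<zeta> t by (simp add: L1_distance_def lift_curve_def dist_norm)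

text \<open>X is the map from time \<tau> to time 1. In between only \<open>c0\<close> acts, whence
  K = exp L with the Lipschitz constant of \<open>c0\<close> alone.\<close>

lemma prefix_shear_horseshoe:
  assumes \<omega>: "nonlipschitz_osgood \<omega>"
    and c_def: "c = prefix_field \<tau> (shear_field 1 2 (2 / \<tau> * a1) k) (shear_field 2 1 (2 / \<tau> * a2) k) c0"
    and c: "c \<in> L1per_fields \<omega>" and ex: "\<And>z. \<exists>\<zeta>. lift_curve c z \<zeta>"
    and c0: "\<And>t. t \<ge> 0 \<Longrightarrow> lift_lipschitz L (c0 t)" and L: "L \<ge> 0"
    and \<tau>: "0 < \<tau>" "\<tau> \<le> 1" and k: "k \<ge> 1" and N: "N \<ge> 1"
    and par: "\<delta> = 1 / real k" "K = exp L" "S = 2 * K * (2 * K + 2) * \<delta>" "a2 = (K * (2 * K + 2) + 1) * \<delta>"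
      "R = K * (S + 2 * a2 + 2 * \<delta>) + 2 * \<delta>" "real N * (S + 4 * K * \<delta>) + R \<le> 2 * a1"
      "K * (R + 2 * a1 + 2 * a2 + 2 * \<delta>) + 2 * \<delta> \<le> 1"
    and F: "continuous_on UNIV F" "\<And>z \<zeta>. lift_curve c z \<zeta> \<Longrightarrow> dist (F z) (\<zeta> 1) \<le> \<delta>"
    and T: "\<And>z. T (torus_proj z) = torus_proj (F z)"
  shows "htop T \<ge> ereal (ln (real N))"
proof -
  have "\<exists>Z. \<forall>z. lift_curve c z (Z z)" by (intro choice allI ex)
  then obtain Z where Z: "\<And>z. lift_curve c z (Z z)" by blast
  define P where "P z = vshear a2 \<delta> (hshear a1 \<delta> z)" for z
  define Q where "Q z = hshear (- a1) \<delta> (vshear (- a2) \<delta> z)" for z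
  have PQ: "P (Q z) = z" "Q (P z) = z" for z
    by (simp_all add: P_def Q_def hshear_inverse vshear_inverse del: hshear_nth vshear_nth)
  have Z\<tau>: "Z z \<tau> = P z" for z
    using prefix_shear_curve[OF Z[unfolded c_def] \<tau>] by (simp add: P_def par(1))
  \<comment> \<open>Curves are given from time 0 only; the map starting at time \<tau> is obtained
    by first undoing the two shears with their explicit inverse Q.\<close>
  define X where "X p = Z (Q p) 1" for p
  have lip: "lift_lipschitz L (c t)" if "t \<in> {\<tau><..<1}" for t
  proof -
    have "frac t = t" using that \<tau> by (simp add: frac_eq)
    moreover have "\<not> t < \<tau> / 2" "\<not> t < \<tau>" using that \<tau> by auto
    ultimately have "c t = c0 t" by (simp only: c_def prefix_field_def if_False)
    then show ?thesis using c0[of t] that \<tau> by simp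
  qed
  have bilip: "dist (X p) (X q) \<le> K * dist p q" "dist p q \<le> K * dist (X p) (X q)" for p q
    using lift_curves_bilipschitz[OF Z[of "Q p"] Z[of "Q q"] _ \<tau>(2) order_refl L lip] \<tau>
    by (simp_all add: X_def Z\<tau> PQ par(2))
  have "K \<ge> 1" using L by (simp add: par(2))
  have surj: "surj X"
  proof (rule surj_bounded_displacement)
    show "continuous_on UNIV X"
      unfolding continuous_on_iff
    proof (intro ballI allI impI)
      fix p :: "real^2" and e :: real assume "e > 0"
      then show "\<exists>d>0. \<forall>q\<in>UNIV. dist q p < d \<longrightarrow> dist (X q) (X p) < e"
        using \<open>K \<ge> 1\<close> bilip(1)
        by (intro exI[of _ "e / K"]) (auto simp: field_simps intro: le_less_trans)
    qed
    \<comment> \<open>p and X p are the positions at times \<tau> and 1 of one curve, which starts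
      at Q p.\<close>
    show "dist (X p) p \<le> 2 * L1_distance \<omega> c (\<lambda>t x. 0)" for p
    proof -
      have "dist (Z (Q p) 1) (Q p) \<le> L1_distance \<omega> c (\<lambda>t x. 0)" "dist (Z (Q p) \<tau>) (Q p) \<le> L1_distance \<omega> c (\<lambda>t x. 0)"
        using \<tau> by (auto intro!: lift_curve_displacement[OF \<omega> c Z])
      then show ?thesis
        using dist_triangle2[of "X p" p "Q p"] by (simp add: X_def Z\<tau> PQ)
    qed
  qed
  interpret shear_composition X F K \<delta> a1 a2 S R N
  proof
    show "\<delta> > 0" using k by (simp add: par(1))
    show "dist (F x) (X (vshear a2 \<delta> (hshear a1 \<delta> x))) \<le> \<delta>" for x
      using F(2)[OF Z[of x]] PQ(2)[of x] by (simp add: X_def P_def)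
  qed (use par \<open>K \<ge> 1\<close> bilip surj F(1) in auto)
  show ?thesis by (rule htop_ge[OF N par(7) T])
qed

text \<open>The condition with W makes the whole construction fit into distance 1. In the other one
  the dangerous term is s / \<omega> s at s = 1 / k, so the failure of the Lipschitz property is
  what makes strong shears cheap.\<close>

lemma small_wavelength:
  assumes \<omega>: "nonlipschitz_osgood \<omega>" and e: "e > 0"
  shows "\<exists>k\<ge>1. W * (1 / real k) \<le> 1 \<and> A * (1 / real k) * (1 + pi / \<omega> (1 / real k)) < e"
proof -
  have lim: "((\<lambda>s. s / \<omega> s) \<longlongrightarrow> 0) (at_right 0)" using \<omega> by (simp add: nonlipschitz_osgood_def)
  have k0: "(\<lambda>k. 1 / real (Suc k)) \<longlonglongrightarrow> 0" by (rule LIMSEQ_Suc[OF lim_1_over_n])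
  then have "filterlim (\<lambda>k. 1 / real (Suc k)) (at_right 0) sequentially"
    by (intro tendsto_imp_filterlim_at_right) simp_all
  from filterlim_compose[OF lim this]
  have "(\<lambda>k. (1 / real (Suc k)) / \<omega> (1 / real (Suc k))) \<longlonglongrightarrow> 0" .
  then have "(\<lambda>k. A * (1 / real (Suc k) + pi * ((1 / real (Suc k)) / \<omega> (1 / real (Suc k))))) \<longlonglongrightarrow> A * (0 + pi * 0)"
    by (intro tendsto_intros k0)
  then have "\<forall>\<^sub>F k in sequentially. A * (1 / real (Suc k) + pi * ((1 / real (Suc k)) / \<omega> (1 / real (Suc k)))) < e"
    using e by (intro order_tendstoD(2)) simp_all
  moreover have "(\<lambda>k. W * (1 / real (Suc k))) \<longlonglongrightarrow> W * 0" by (intro tendsto_intros k0)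
  then have "\<forall>\<^sub>F k in sequentially. W * (1 / real (Suc k)) < 1" by (rule order_tendstoD(2)) simp
  ultimately have "\<forall>\<^sub>F k in sequentially. W * (1 / real (Suc k)) < 1 \<and>
      A * (1 / real (Suc k) + pi * ((1 / real (Suc k)) / \<omega> (1 / real (Suc k)))) < e"
    by eventually_elim simp
  then obtain k where "W * (1 / real (Suc k)) < 1"
      "A * (1 / real (Suc k) + pi * ((1 / real (Suc k)) / \<omega> (1 / real (Suc k)))) < e"
    by (auto simp: eventually_sequentially)
  then show ?thesis by (intro exI[of _ "Suc k"]) (simp add: distrib_left mult_ac)
qed

lemma horseshoe_ball_dense:
  assumes \<omega>: "nonlipschitz_osgood \<omega>" and b: "b \<in> L1per_fields \<omega>" and e: "e > 0" and N: "N \<ge> 1"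
  shows "\<exists>c r. horseshoe_ball \<omega> N c r \<and> L1_distance \<omega> b c < e"
proof -
  obtain c0 where c0: "smooth_simple_field \<omega> c0" "L1_norm \<omega> (\<lambda>t x. b t x - c0 t x) < ennreal (e / 2)"
    using smooth_simple_dense[OF b, of "e / 2"] e by auto
  obtain M where M: "M \<ge> 0" "\<And>t. t \<ge> 0 \<Longrightarrow> omega_norm \<omega> (c0 t) \<le> ennreal M"
    using smooth_simple_field_bounded[OF c0(1)] by blast
  obtain L where L: "L > 0" "\<And>t. t \<ge> 0 \<Longrightarrow> lift_lipschitz L (c0 t)"
    using smooth_simple_field_lipschitz[OF c0(1)] by blast
  \<comment> \<open>The part of \<open>c0\<close> that is overwritten costs at most \<tau> * M,
    hence at most e / 4.\<close>
  define \<tau> where "\<tau> = min 1 (e / 4 / (M + 1))"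
  have \<tau>: "0 < \<tau>" "\<tau> \<le> 1" using e M by (simp_all add: \<tau>_def)
  have \<tau>M: "\<tau> * M \<le> e / 4"
  proof -
    have "\<tau> * M \<le> e / 4 / (M + 1) * (M + 1)" using M e by (intro mult_mono) (simp_all add: \<tau>_def)
    also have "\<dots> = e / 4" using M by (intro nonzero_divide_eq_eq[THEN iffD1, symmetric]) simp_all
    finally show ?thesis .
  qed
  \<comment> \<open>K and the constants after it are the lengths of the stretching argument in units
    of \<delta>; they are fixed by \<open>c0\<close> and N before the wavelength is chosen.\<close>
  define K where "K = exp L"
  define S0 where "S0 = 2 * K * (2 * K + 2)"
  define A2 where "A2 = K * (2 * K + 2) + 1"
  define R0 where "R0 = K * (S0 + 2 * A2 + 2) + 2"
  \<comment> \<open>The first summand provides room for N boxes; adding A2 gives a2 \<le> a1, so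
    that one bound B serves both shears.\<close>
  define A1 where "A1 = (real N * (S0 + 4 * K) + R0) / 2 + A2"
  have K: "K > 0" by (simp add: K_def)
  have pos: "A2 \<ge> 0" "S0 \<ge> 0" using K by (simp_all add: A2_def S0_def)
  have R0: "R0 \<ge> 0" using K pos by (simp add: R0_def)
  have A12: "A2 \<le> A1" "A1 \<ge> 0" using K pos R0 by (simp_all add: A1_def)
  obtain k where k: "k \<ge> 1" "(K * (R0 + 2 * A1 + 2 * A2 + 2) + 2) * (1 / real k) \<le> 1"
    "2 * A1 * (1 / real k) * (1 + pi / \<omega> (1 / real k)) < e / 4"
    using small_wavelength[OF \<omega>, of "e / 4"] e by (metis divide_pos_pos zero_less_numeral)
  define \<delta> where "\<delta> = 1 / real k"
  have \<delta>: "\<delta> > 0" using k by (simp add: \<delta>_def)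
  define a1 where "a1 = A1 * \<delta>"
  define a2 where "a2 = A2 * \<delta>"
  have a: "0 \<le> a2" "a2 \<le> a1" using A12 pos \<delta> by (simp_all add: a1_def a2_def mult_right_mono)
  have \<omega>\<delta>: "\<omega> \<delta> > 0" using \<omega> \<delta> by (simp add: nonlipschitz_osgood_def)
  define B where "B = 2 / \<tau> * a1 * (1 + pi / \<omega> \<delta>)"
  have B: "B \<ge> 0" using a \<tau> \<omega>\<delta> by (simp add: B_def)
  define f where "f = shear_field 1 2 (2 / \<tau> * a1) k"
  define g where "g = shear_field 2 1 (2 / \<tau> * a2) k"
  have f: "omega_norm \<omega> f \<le> ennreal B"
    unfolding f_def B_def \<delta>_def using a \<tau> k by (intro omega_norm_shear_field[OF \<omega>]) simp_all
  have "omega_norm \<omega> g \<le> ennreal (2 / \<tau> * a2 * (1 + pi / \<omega> \<delta>))"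
    unfolding g_def \<delta>_def using a \<tau> k by (intro omega_norm_shear_field[OF \<omega>]) simp_all
  also have "\<dots> \<le> ennreal B"
    unfolding B_def using a \<tau> \<omega>\<delta> by (intro ennreal_leI mult_right_mono mult_left_mono) simp_all
  finally have g: "omega_norm \<omega> g \<le> ennreal B" .
  define c where "c = prefix_field \<tau> f g c0"
  have c: "smooth_simple_field \<omega> c"
    unfolding c_def using c0 f g
    by (intro smooth_simple_prefix_field) (auto simp: f_def g_def smooth_shear_field intro: le_less_trans)
  have cL1: "c \<in> L1per_fields \<omega>"
    by (rule smooth_simple_field_L1per[OF c]) (simp add: c_def prefix_field_periodic)
  \<comment> \<open>This constant includes the shears and may be large; it is used for the existence
    of curves, the Lipschitz bound of the time-one map and the radius of the ball, not for
    K.\<close>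
  obtain Lc where Lc: "Lc > 0" "\<And>t. t \<ge> 0 \<Longrightarrow> lift_lipschitz Lc (c t)"
    using smooth_simple_field_lipschitz[OF c] by blast
  have ex: "\<exists>\<zeta>. lift_curve c z \<zeta>" for z
    by (rule lift_curve_exists[OF \<omega> cL1 Lc(1)]) (simp add: Lc)
  have "\<tau> * (M + B) < e / 2"
  proof -
    \<comment> \<open>\<tau> cancels: a shorter interval requires a proportionally faster
      shear.\<close>
    have "\<tau> * B = 2 * A1 * \<delta> * (1 + pi / \<omega> \<delta>)" using \<tau> by (simp add: B_def a1_def)
    also have "\<dots> < e / 4" using k(3) by (simp add: \<delta>_def)
    finally show ?thesis using \<tau>M by (simp add: distrib_left)
  qed
  have "L1_norm \<omega> (\<lambda>t x. b t x - c t x) \<le> L1_norm \<omega> (\<lambda>t x. b t x - c0 t x) + L1_norm \<omega> (\<lambda>t x. c0 t x - c t x)"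
    using b by (intro L1_norm_triangle smooth_simple_field_strongly_measurable[OF c]
        smooth_simple_field_strongly_measurable[OF c0(1)]) (simp add: L1per_fields_def)
  also have "\<dots> \<le> ennreal (e / 2) + ennreal (\<tau> * (M + B))"
    unfolding c_def
    by (rule add_mono[OF less_imp_le[OF c0(2)] L1_norm_prefix_field[OF \<tau> M(2) f g M(1) B]])
  also have "\<dots> < ennreal e"
    using \<open>\<tau> * (M + B) < e / 2\<close> e \<tau> M B by (simp add: ennreal_less_iff flip: ennreal_plus)
  finally have close: "L1_distance \<omega> b c < e" by (rule L1_distance_less)
  \<comment> \<open>\<eta> \<le> \<delta> keeps the stretching alive under perturbation, and \<eta>
    \<le> 1 / N makes curves converge along nested balls; r absorbs the Gronwall factor exp
    Lc.\<close>
  define \<eta> where "\<eta> = min \<delta> (1 / real N)"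
  define r where "r = min (1 / real N) (\<eta> / exp Lc)"
  have \<eta>: "\<eta> > 0" "\<eta> \<le> 1 / real N" "\<eta> \<le> \<delta>" using \<delta> N by (simp_all add: \<eta>_def)
  have r: "r > 0" "r \<le> 1 / real N" "r * exp Lc \<le> \<eta>"
    using \<eta> N by (auto simp: r_def min_def field_simps)
  have stab: "dist (\<zeta> t) (\<zeta>' t) \<le> \<eta>"
    if "b' \<in> L1per_fields \<omega>" "L1_distance \<omega> b' c < r" "lift_curve b' z \<zeta>" "lift_curve c z \<zeta>'" "t \<in> {0..1}"
    for b' z \<zeta> \<zeta>' t
  proof -
    have "dist (\<zeta> t) (\<zeta>' t) \<le> (dist z z + L1_distance \<omega> b' c) * exp Lc"
      unfolding L1_distance_def
      by (rule lift_curve_stability[OF \<omega> that(1) cL1 _ _ that(3-5)]) (use Lc in simp_all)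
    also have "\<dots> \<le> r * exp Lc" using that(2) by (intro mult_right_mono) simp_all
    finally show ?thesis using r(3) by simp
  qed
  have lip: "dist (\<zeta> 1) (\<zeta>' 1) \<le> exp Lc * dist z z'" if "lift_curve c z \<zeta>" "lift_curve c z' \<zeta>'" for z z' \<zeta> \<zeta>'
    using lift_curves_bilipschitz(1)[OF that, of 0 1 Lc] Lc that[THEN lift_curve_0] by simp
  have horse: "htop T \<ge> ereal (ln (real N))"
    if F: "continuous_on UNIV F" "\<And>z \<zeta>. lift_curve c z \<zeta> \<Longrightarrow> dist (F z) (\<zeta> 1) \<le> \<eta>"
      "\<And>z. T (torus_proj z) = torus_proj (F z)" for F T
  proof (rule prefix_shear_horseshoe[OF \<omega> c_def[unfolded f_def g_def] cL1 ex L(2) _ \<tau> k(1) N \<delta>_def K_def])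
    show "S0 * \<delta> = 2 * K * (2 * K + 2) * \<delta>" "a2 = (K * (2 * K + 2) + 1) * \<delta>"
      by (simp_all add: S0_def a2_def A2_def)
    show "R0 * \<delta> = K * (S0 * \<delta> + 2 * a2 + 2 * \<delta>) + 2 * \<delta>"
      by (simp add: R0_def a2_def algebra_simps)
    have "real N * (S0 * \<delta> + 4 * K * \<delta>) + R0 * \<delta> = (real N * (S0 + 4 * K) + R0) * \<delta>"
      by (simp add: algebra_simps)
    also have "\<dots> \<le> (2 * A1) * \<delta>"
    proof (rule mult_right_mono)
      have "2 * A1 = real N * (S0 + 4 * K) + R0 + 2 * A2" by (simp add: A1_def field_simps)
      then show "real N * (S0 + 4 * K) + R0 \<le> 2 * A1" using pos(1) by linarith
    qed (use \<delta> in simp)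
    finally show "real N * (S0 * \<delta> + 4 * K * \<delta>) + R0 * \<delta> \<le> 2 * a1" by (simp add: a1_def)
    have "K * (R0 * \<delta> + 2 * a1 + 2 * a2 + 2 * \<delta>) + 2 * \<delta> = (K * (R0 + 2 * A1 + 2 * A2 + 2) + 2) * \<delta>"
      by (simp add: a1_def a2_def algebra_simps)
    then show "K * (R0 * \<delta> + 2 * a1 + 2 * a2 + 2 * \<delta>) + 2 * \<delta> \<le> 1" using k(2) by (simp add: \<delta>_def)
    show "dist (F z) (\<zeta> 1) \<le> \<delta>" if "lift_curve c z \<zeta>" for z \<zeta> using F(2)[OF that] \<eta>(3) by simp
  qed (use F L in auto)
  have "horseshoe_ball \<omega> N c r"
    unfolding horseshoe_ball_def
  proof (intro conjI)
    show "\<exists>L. \<forall>z z' \<zeta> \<zeta>'. lift_curve c z \<zeta> \<longrightarrow> lift_curve c z' \<zeta>' \<longrightarrow> dist (\<zeta> 1) (\<zeta>' 1) \<le> L * dist z z'"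
      using lip by blast
  qed (use cL1 r ex \<eta> stab horse in \<open>auto intro!: exI[of _ \<eta>]\<close>)
  then show ?thesis using close by blast
qed

section \<open>Residuality in the space of classes of fields\<close>

theorem theorem1p1:
  fixes \<omega> :: "real \<Rightarrow> real"
  assumes "nonlipschitz_osgood \<omega>"
  shows "\<exists>\<X>. residual_in (L1per_topology \<omega>) \<X> \<and>
           (\<forall>B\<in>\<X>. \<forall>b\<in>B. htop (flow b 1) = \<infinity>)"
proof -
  interpret L: Metric_space "L1per \<omega>" "L1per_dist \<omega>" by (rule Metric_space_L1per)
  define cls where "cls c = ae_eq \<omega> `` {c}" for c
  have cls: "cls c \<in> L1per \<omega>" "c \<in> cls c" if "c \<in> L1per_fields \<omega>" for c
    using that equiv_class_self[OF equiv_ae_eq that] by (auto simp: cls_def L1per_def intro: quotientI)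
  have rep: "b \<in> L1per_fields \<omega>" if "B \<in> L1per \<omega>" "b \<in> B" for b B
    using that in_quotient_imp_subset[OF equiv_ae_eq] unfolding L1per_def by blast
  have dist: "L1per_dist \<omega> (cls c) B = L1_distance \<omega> b c"
    if "c \<in> L1per_fields \<omega>" "B \<in> L1per \<omega>" "b \<in> B" for b c B
    unfolding L1_distance_commute[of \<omega> b c] unfolding L1_distance_def
    by (rule L1per_dist_eq) (use that cls in auto)
  define U where "U n = (\<Union>(c, r)\<in>{(c, r). horseshoe_ball \<omega> (Suc n) c r}. L.mball (cls c) r)" for n
  have top: "topspace (L1per_topology \<omega>) = L1per \<omega>" by (simp add: L1per_topology_def)
  have U: "openin (L1per_topology \<omega>) (U n)" for n
    unfolding U_def L1per_topology_def by (intro openin_Union) auto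
  have dense: "L1per_topology \<omega> closure_of (U n) = L1per \<omega>" for n
  proof -
    have "\<exists>C\<in>U n. C \<in> L.mball A e" if A: "A \<in> L1per \<omega>" and e: "e > 0" for A e
    proof -
      have "A \<noteq> {}" using A in_quotient_imp_non_empty[OF equiv_ae_eq] unfolding L1per_def by blast
      then obtain a where a: "a \<in> A" by blast
      obtain c r where c: "horseshoe_ball \<omega> (Suc n) c r" "L1_distance \<omega> a c < e"
        using horseshoe_ball_dense[OF assms rep[OF A a] e, of "Suc n"] by auto
      then have cr: "c \<in> L1per_fields \<omega>" "r > 0" by (simp_all add: horseshoe_ball_def)
      have "cls c \<in> L.mball A e"
        using c(2) dist[OF cr(1) A a] A cls(1)[OF cr(1)] L.commute[of A "cls c"] by simp
      moreover have "cls c \<in> L.mball (cls c) r" using cls(1)[OF cr(1)] cr(2) by simp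
      then have "cls c \<in> U n" using c(1) by (auto simp: U_def)
      ultimately show ?thesis by blast
    qed
    then show ?thesis unfolding L1per_topology_def L.metric_closure_of by auto
  qed
  \<comment> \<open>Distances of classes can be computed with any representatives, so the argument
    runs for each b in B separately and no comparison of the flows of different representatives
    arises.\<close>
  have "htop (flow b 1) = \<infinity>" if B: "B \<in> (\<Inter>n. U n)" and b: "b \<in> B" for B b
  proof -
    have "\<exists>c r. horseshoe_ball \<omega> (Suc n) c r \<and> B \<in> L.mball (cls c) r" for n
      using B by (auto simp: U_def)
    then obtain c r where c: "\<And>n. horseshoe_ball \<omega> (Suc n) (c n) (r n)" "\<And>n. B \<in> L.mball (cls (c n)) (r n)"
      by metis
    have BL: "B \<in> L1per \<omega>" using c(2)[of 0] by simp
    have "L1_distance \<omega> b (c n) < r n" for n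
      using c(2)[of n] dist[of "c n" B b] c(1)[of n] BL b by (simp add: horseshoe_ball_def)
    then show ?thesis by (rule infinite_entropy[OF assms rep[OF BL b] c(1)])
  qed
  moreover have "residual_in (L1per_topology \<omega>) (\<Inter>n. U n)"
    unfolding residual_in_def top
  proof (intro conjI exI[of _ U] allI)
    show "(\<Inter>n. U n) \<subseteq> L1per \<omega>" using openin_subset[OF U[of 0]] top by auto
  qed (use U dense in auto)
  ultimately show ?thesis by blast
qed

end
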